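(* Let $q_1,\ldots,q_d \in \mathrm{Han}$ and let $r_1,\ldots,r_d \in [0,1]$. For $j=1,\ldots,d$, let $$T_j = \begin{bmatrix} r_j M_{\zeta} & 0 \\ H_{q_j} & r_j M_{\overline{\zeta}}^* \end{bmatrix} \in B(H^2\oplus\overline{H^2}),$$ and assume that each $T_j$ is a contraction (that is, $\|T_j\|\le 1$). Then the operators $T_1,\dots,T_d$ commute and for every $p \in \mathbb{C}[z_1,\ldots,z_d]$, $$\|p(T_1,\ldots,T_d)\| \le \sup_{z\in\mathbb{D}^d}|p(z)|.$$
   Context: $H^2$ is the classical Hardy space on the unit disc $\mathbb{D}$, regarded as a closed subspace of $L^2=L^2(\mathbb{T})$ (normalized arc length measure on the unit circle $\mathbb{T}$), and $\overline{H^2}=\{\overline{f}: f\in H^2\}\subset L^2$. $M_\zeta: H^2\to H^2$, $(M_\zeta f)(\zeta)=\zeta f(\zeta)$, is the unilateral shift; $M_{\overline{\zeta}}:\overline{H^2}\to\overline{H^2}$ is multiplication by $\overline{\zeta}$, and $M_{\overline{\zeta}}^*$ is its adjoint on $\overline{H^2}$. For $q\in H^2$, the Hankel operator $H_q: H^2\to\overline{H^2}$ with symbol $q$ is determined by $\langle H_q f,\overline{g}\rangle_{\overline{H^2}} = \langle fg, q\rangle_{H^2}$ for all polynomials $f,g$ (equivalently, $H_q f = P_{\overline{H^2}}(\overline{q}f)$, with $P_{\overline{H^2}}$ the orthogonal projection of $L^2$ onto $\overline{H^2}$). $\mathrm{Han}\subset H^2$ is the space of those $q\in H^2$ for which $H_q$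 extends to a bounded operator $H^2\to\overline{H^2}$. *)

theory Defs
  imports
    "HOL-Analysis.Analysis"
    "HOL-Computational_Algebra.Polynomial"
    "HOL-Library.Poly_Mapping"
begin

section \<open>Complex inner product spaces\<close>

text \<open>The complex inner product is linear in the first argument and conjugate-linear in the
  second; its real part is the real inner product, so that the norm, the topology and the bounded
  operators of the library can be used.\<close>

class complex_inner = real_inner +
  fixes scaleC :: "complex \<Rightarrow> 'a \<Rightarrow> 'a"  (infixr "*\<^sub>C" 75)
    and cinner :: "'a \<Rightarrow> 'a \<Rightarrow> complex"
  assumes scaleC_add_right: "c *\<^sub>C (x + y) = c *\<^sub>C x + c *\<^sub>C y"
    and scaleC_add_left: "(c + c') *\<^sub>C x = c *\<^sub>C x + c' *\<^sub>C x"
    and scaleC_scaleC: "c *\<^sub>C c' *\<^sub>C x = (c * c') *\<^sub>C x"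
    and scaleC_of_real: "complex_of_real a *\<^sub>C x = a *\<^sub>R x"
    and cinner_commute: "cinner x y = cnj (cinner y x)"
    and cinner_add_left: "cinner (x + y) z = cinner x z + cinner y z"
    and cinner_scaleC_left: "cinner (c *\<^sub>C x) y = c * cinner x y"
    and Re_cinner: "Re (cinner x y) = inner x y"

lemma cinner_self: "cinner x x = complex_of_real ((norm x)\<^sup>2)"
proof (rule complex_eqI)
  show "Re (cinner x x) = Re (complex_of_real ((norm x)\<^sup>2))"
    by (simp add: Re_cinner power2_norm_eq_inner)
  have "Im (cinner x x) = Im (cnj (cinner x x))"
    by (rule arg_cong[OF cinner_commute])
  then show "Im (cinner x x) = Im (complex_of_real ((norm x)\<^sup>2))" by simp
qed

lemma norm_scaleC: "norm (c *\<^sub>C x) = cmod c * norm (x :: 'a :: complex_inner)"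
proof -
  have "cinner (c *\<^sub>C x) (c *\<^sub>C x) = c * cnj (cinner (c *\<^sub>C x) x)"
    by (subst cinner_scaleC_left) (rule arg_cong[OF cinner_commute])
  also have "cnj (cinner (c *\<^sub>C x) x) = cnj c * cnj (cinner x x)"
    by (simp only: cinner_scaleC_left complex_cnj_mult)
  also have "c * (cnj c * cnj (cinner x x)) = (c * cnj c) * cnj (cinner x x)"
    by (simp only: mult.assoc)
  also have "c * cnj c = complex_of_real ((cmod c)\<^sup>2)"
    by (rule complex_norm_square[symmetric])
  finally have "complex_of_real ((norm (c *\<^sub>C x))\<^sup>2) = of_real ((cmod c * norm x)\<^sup>2)"
    by (simp only: cinner_self complex_cnj_complex_of_real of_real_mult[symmetric] power_mult_distrib)
  then have "(norm (c *\<^sub>C x))\<^sup>2 = (cmod c * norm x)\<^sup>2"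
    using of_real_eq_iff by blast
  then show ?thesis by (simp add: power2_eq_iff_nonneg)
qed

instantiation prod :: (complex_inner, complex_inner) complex_inner
begin

definition scaleC_prod :: "complex \<Rightarrow> 'a \<times> 'b \<Rightarrow> 'a \<times> 'b"
  where "scaleC_prod c x = (c *\<^sub>C fst x, c *\<^sub>C snd x)"

definition cinner_prod :: "'a \<times> 'b \<Rightarrow> 'a \<times> 'b \<Rightarrow> complex"
  where "cinner_prod x y = cinner (fst x) (fst y) + cinner (snd x) (snd y)"

instance
proof
  fix x y z :: "'a \<times> 'b" and c c' :: complex and a :: real
  show "cinner x y = cnj (cinner y x)"
    unfolding cinner_prod_def using cinner_commute[of "fst x" "fst y"] cinner_commute[of "snd x" "snd y"]
    by simp
qed (simp_all add: scaleC_prod_def cinner_prod_def scaleC_add_right scaleC_add_left scaleC_scaleC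
    scaleC_of_real cinner_add_left cinner_scaleC_left Re_cinner inner_prod_def prod_eq_iff
    algebra_simps)

end

definition is_complex_linear :: "('a::complex_inner \<Rightarrow>\<^sub>L 'b::complex_inner) \<Rightarrow> bool"
  where "is_complex_linear A \<longleftrightarrow> (\<forall>c x. blinfun_apply A (c *\<^sub>C x) = c *\<^sub>C blinfun_apply A x)"

definition hadjoint :: "('a::complex_inner \<Rightarrow>\<^sub>L 'b::complex_inner) \<Rightarrow> ('b \<Rightarrow>\<^sub>L 'a)"
  where "hadjoint A = (THE B. \<forall>x y. cinner (blinfun_apply A x) y = cinner x (blinfun_apply B y))"

lift_definition scaleC_op ::
    "complex \<Rightarrow> ('a::real_normed_vector \<Rightarrow>\<^sub>L 'b::complex_inner) \<Rightarrow> ('a \<Rightarrow>\<^sub>L 'b)"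
  is "\<lambda>c A x. c *\<^sub>C A x"
proof -
  fix c and A :: "'a \<Rightarrow> 'b"
  assume A: "bounded_linear A"
  have "bounded_linear (\<lambda>x::'b. c *\<^sub>C x)"
    by (rule bounded_linear_intro[where K = "cmod c"])
      (simp_all add: scaleC_add_right norm_scaleC scaleC_scaleC mult.commute
        flip: scaleC_of_real)
  then show "bounded_linear (\<lambda>x. c *\<^sub>C A x)"
    using A by (rule bounded_linear_compose)
qed

text \<open>The operator given by the block matrix with rows \<open>(A, B)\<close> and \<open>(C, D)\<close>.\<close>

lift_definition block_op ::
    "('a::real_normed_vector \<Rightarrow>\<^sub>L 'c::real_normed_vector) \<Rightarrow> ('b::real_normed_vector \<Rightarrow>\<^sub>L 'c)
      \<Rightarrow> ('a \<Rightarrow>\<^sub>L 'd::real_normed_vector) \<Rightarrow> ('b \<Rightarrow>\<^sub>L 'd) \<Rightarrow> (('a \<times> 'b) \<Rightarrow>\<^sub>L ('c \<times> 'd))"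
  is "\<lambda>A B C D x. (A (fst x) + B (snd x), C (fst x) + D (snd x))"
  by (intro bounded_linear_Pair bounded_linear_add)
    (auto intro: bounded_linear_compose bounded_linear_fst bounded_linear_snd)


section \<open>The space \<open>L\<^sup>2\<close> of the unit circle\<close>

text \<open>Normalized arc length, as a Borel measure on the complex plane for which the complement of
  the unit circle is a null set.\<close>

definition arc_length :: "complex measure"
  where "arc_length = distr (uniform_measure lborel {0..2 * pi}) borel cis"

definition square_integrable :: "(complex \<Rightarrow> complex) \<Rightarrow> bool"
  where "square_integrable f \<longleftrightarrow>
    f \<in> borel_measurable borel \<and> integrable arc_length (\<lambda>z. (cmod (f z))\<^sup>2)"

lemma sets_arc_length [simp, measurable_cong]: "sets arc_length = sets borel"
  and space_arc_length [simp]: "space arc_length = UNIV"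
  by (simp_all add: arc_length_def)

lemma cis_borel_measurable: "cis \<in> borel_measurable borel"
  by (intro borel_measurable_continuous_onI continuous_intros)

lemma cnj_borel_measurable: "cnj \<in> borel_measurable borel"
  by (intro borel_measurable_continuous_onI continuous_intros)

lemma prob_space_arc_length: "emeasure arc_length UNIV = 1"
proof -
  have "emeasure arc_length UNIV = emeasure (uniform_measure lborel {0..2 * pi}) UNIV"
    unfolding arc_length_def using cis_borel_measurable by (subst emeasure_distr) auto
  also have "\<dots> = 1"
    by (subst emeasure_uniform_measure) (auto intro!: ennreal_divide_self)
  finally show ?thesis .
qed

lemma finite_measure_arc_length: "finite_measure arc_length"
  by (rule finite_measureI) (simp add: prob_space_arc_length)

lemma AE_arc_length: "AE z in arc_length. cmod z = 1"
  unfolding arc_length_def using cis_borel_measurable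
  by (subst AE_distr_iff) auto

lemma square_integrable_measurable:
  "square_integrable f \<Longrightarrow> f \<in> borel_measurable arc_length"
  "square_integrable f \<Longrightarrow> f \<in> borel_measurable borel"
  by (simp_all add: square_integrable_def measurable_cong_sets[OF sets_arc_length refl])

lemma square_integrable_zero: "square_integrable (\<lambda>z. 0)"
  by (simp add: square_integrable_def)

lemma square_integrable_add:
  assumes "square_integrable f" "square_integrable g"
  shows "square_integrable (\<lambda>z. f z + g z)"
  unfolding square_integrable_def
proof
  note [measurable] = square_integrable_measurable[OF assms(1)] square_integrable_measurable[OF assms(2)]
  show "(\<lambda>z. f z + g z) \<in> borel_measurable borel" by measurable
  have "integrable arc_length (\<lambda>z. 2 * (cmod (f z))\<^sup>2 + 2 * (cmod (g z))\<^sup>2)"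
    using assms by (simp add: square_integrable_def)
  then show "integrable arc_length (\<lambda>z. (cmod (f z + g z))\<^sup>2)"
  proof (rule Bochner_Integration.integrable_bound)
    show "AE z in arc_length. norm ((cmod (f z + g z))\<^sup>2)
        \<le> norm (2 * (cmod (f z))\<^sup>2 + 2 * (cmod (g z))\<^sup>2)"
    proof (rule AE_I2)
      fix z
      have "(cmod (f z + g z))\<^sup>2 \<le> (cmod (f z) + cmod (g z))\<^sup>2"
        by (intro power_mono norm_triangle_ineq) simp
      also have "\<dots> \<le> 2 * (cmod (f z))\<^sup>2 + 2 * (cmod (g z))\<^sup>2"
        using sum_squares_bound[of "cmod (f z)" "cmod (g z)"] by (simp add: power2_sum)
      finally show "norm ((cmod (f z + g z))\<^sup>2) \<le> norm (2 * (cmod (f z))\<^sup>2 + 2 * (cmod (g z))\<^sup>2)"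
        by simp
    qed
  qed measurable
qed

lemma square_integrable_bounded_mult:
  assumes "square_integrable f" "h \<in> borel_measurable borel"
    and "\<And>z. cmod z = 1 \<Longrightarrow> cmod (h z) \<le> B"
  shows "square_integrable (\<lambda>z. h z * f z)"
  unfolding square_integrable_def
proof
  note [measurable] = square_integrable_measurable[OF assms(1)] assms(2)
  have [measurable]: "h \<in> borel_measurable arc_length"
    using assms(2) by (simp add: measurable_cong_sets[OF sets_arc_length refl])
  show "(\<lambda>z. h z * f z) \<in> borel_measurable borel" by measurable
  have "integrable arc_length (\<lambda>z. B\<^sup>2 * (cmod (f z))\<^sup>2)"
    using assms(1) by (simp add: square_integrable_def)
  then show "integrable arc_length (\<lambda>z. (cmod (h z * f z))\<^sup>2)"
  proof (rule Bochner_Integration.integrable_bound)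
    show "AE z in arc_length. norm ((cmod (h z * f z))\<^sup>2) \<le> norm (B\<^sup>2 * (cmod (f z))\<^sup>2)"
      using AE_arc_length
    proof eventually_elim
      case (elim z)
      then have "(cmod (h z))\<^sup>2 \<le> B\<^sup>2"
        using assms(3) by (intro power_mono) auto
      then show ?case by (simp add: norm_mult power_mult_distrib mult_right_mono)
    qed
  qed measurable
qed

lemma square_integrable_scale: "square_integrable f \<Longrightarrow> square_integrable (\<lambda>z. c * f z)"
  using square_integrable_bounded_mult[of f "\<lambda>_. c" "cmod c"] by simp

lemma square_integrable_cnj: "square_integrable f \<Longrightarrow> square_integrable (\<lambda>z. cnj (f z))"
  by (auto simp: square_integrable_def
      intro: measurable_compose[OF _ cnj_borel_measurable])

lemma integrable_square_integrable_mult: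
  assumes "square_integrable f" "square_integrable g"
  shows "integrable arc_length (\<lambda>z. f z * g z)"
proof -
  note [measurable] = square_integrable_measurable[OF assms(1)] square_integrable_measurable[OF assms(2)]
  have "integrable arc_length (\<lambda>z. (cmod (f z))\<^sup>2 + (cmod (g z))\<^sup>2)"
    using assms by (simp add: square_integrable_def)
  then show ?thesis
  proof (rule Bochner_Integration.integrable_bound)
    show "AE z in arc_length. norm (f z * g z) \<le> norm ((cmod (f z))\<^sup>2 + (cmod (g z))\<^sup>2)"
    proof (rule AE_I2)
      fix z
      have "2 * cmod (f z) * cmod (g z) \<le> (cmod (f z))\<^sup>2 + (cmod (g z))\<^sup>2"
        by (rule sum_squares_bound)
      moreover have "0 \<le> cmod (f z) * cmod (g z)" by simp
      ultimately have "cmod (f z) * cmod (g z) \<le> (cmod (f z))\<^sup>2 + (cmod (g z))\<^sup>2" by linarith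
      then show "norm (f z * g z) \<le> norm ((cmod (f z))\<^sup>2 + (cmod (g z))\<^sup>2)"
        by (simp add: norm_mult)
    qed
  qed measurable
qed

lemma integrable_cinner:
  "square_integrable f \<Longrightarrow> square_integrable g \<Longrightarrow> integrable arc_length (\<lambda>z. f z * cnj (g z))"
  by (intro integrable_square_integrable_mult square_integrable_cnj)

definition L2_eq :: "(complex \<Rightarrow> complex) \<Rightarrow> (complex \<Rightarrow> complex) \<Rightarrow> bool"
  where "L2_eq f g \<longleftrightarrow>
    square_integrable f \<and> square_integrable g \<and> (AE z in arc_length. f z = g z)"

quotient_type l2 = "complex \<Rightarrow> complex" / partial: L2_eq
proof (rule part_equivpI)
  show "\<exists>f. L2_eq f f"
    using square_integrable_zero by (auto simp: L2_eq_def)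
  show "symp L2_eq"
    by (auto simp: symp_def L2_eq_def eq_commute)
  show "transp L2_eq"
    by (auto simp: transp_def L2_eq_def elim: eventually_elim2)
qed

lemma L2_eq_integral_cong:
  assumes "L2_eq f f'" "L2_eq g g'"
  shows "(LINT z|arc_length. f z * cnj (g z)) = (LINT z|arc_length. f' z * cnj (g' z))"
proof (rule integral_cong_AE)
  have i: "integrable arc_length (\<lambda>z. f z * cnj (g z))" "integrable arc_length (\<lambda>z. f' z * cnj (g' z))"
    using assms by (auto simp: L2_eq_def intro: integrable_cinner)
  then show "(\<lambda>z. f z * cnj (g z)) \<in> borel_measurable arc_length"
    "(\<lambda>z. f' z * cnj (g' z)) \<in> borel_measurable arc_length"
    by (auto dest: borel_measurable_integrable)
  have "AE z in arc_length. f z = f' z" "AE z in arc_length. g z = g' z"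
    using assms by (auto simp: L2_eq_def)
  then show "AE z in arc_length. f z * cnj (g z) = f' z * cnj (g' z)"
    by eventually_elim simp
qed

instantiation l2 :: complex_inner
begin

lift_definition zero_l2 :: l2 is "\<lambda>z. 0"
  by (simp add: L2_eq_def square_integrable_zero)

lift_definition plus_l2 :: "l2 \<Rightarrow> l2 \<Rightarrow> l2" is "\<lambda>f g z. f z + g z"
  by (auto simp: L2_eq_def intro: square_integrable_add elim: eventually_elim2)

lift_definition scaleC_l2 :: "complex \<Rightarrow> l2 \<Rightarrow> l2" is "\<lambda>c f z. c * f z"
  by (auto simp: L2_eq_def intro: square_integrable_scale elim: eventually_mono)

lift_definition cinner_l2 :: "l2 \<Rightarrow> l2 \<Rightarrow> complex" is "\<lambda>f g. LINT z|arc_length. f z * cnj (g z)"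
  by (rule L2_eq_integral_cong)

definition uminus_l2 :: "l2 \<Rightarrow> l2" where "uminus_l2 f = (-1) *\<^sub>C f"
definition minus_l2 :: "l2 \<Rightarrow> l2 \<Rightarrow> l2" where "minus_l2 f g = f + (- g)"
definition scaleR_l2 :: "real \<Rightarrow> l2 \<Rightarrow> l2" where "scaleR_l2 a f = complex_of_real a *\<^sub>C f"
definition inner_l2 :: "l2 \<Rightarrow> l2 \<Rightarrow> real" where "inner_l2 f g = Re (cinner f g)"
definition norm_l2 :: "l2 \<Rightarrow> real" where "norm_l2 f = sqrt (inner f f)"
definition sgn_l2 :: "l2 \<Rightarrow> l2" where "sgn_l2 f = scaleR (inverse (norm f)) f"
definition dist_l2 :: "l2 \<Rightarrow> l2 \<Rightarrow> real" where "dist_l2 f g = norm (f - g)"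
definition uniformity_l2 :: "(l2 \<times> l2) filter"
  where "uniformity_l2 = (INF e\<in>{0<..}. principal {(f, g). dist f g < e})"
definition open_l2 :: "l2 set \<Rightarrow> bool"
  where "open_l2 U \<longleftrightarrow> (\<forall>f\<in>U. \<forall>\<^sub>F (f', g) in uniformity. f' = f \<longrightarrow> g \<in> U)"

instance
proof
  fix f g h :: l2 and c c' :: complex and a b :: real and U :: "l2 set"
  show add_assoc: "f + g + h = f + (g + h)"
    by transfer (auto simp: L2_eq_def add.assoc intro!: square_integrable_add)
  show add_comm: "f + g = g + f"
    by transfer (auto simp: L2_eq_def add.commute intro!: square_integrable_add)
  show "0 + f = f"
    by transfer (auto simp: L2_eq_def)
  show "- f + f = 0" unfolding uminus_l2_def
    by transfer (auto simp: L2_eq_def square_integrable_zero)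
  show "f - g = f + - g" by (rule minus_l2_def)
  have sc1: "c *\<^sub>C (f + g) = c *\<^sub>C f + c *\<^sub>C g" for c :: complex and f g :: l2
    by transfer (auto simp: L2_eq_def algebra_simps intro!: square_integrable_add square_integrable_scale)
  have sc2: "(c + c') *\<^sub>C f = c *\<^sub>C f + c' *\<^sub>C f" for c c' :: complex and f :: l2
    by transfer (auto simp: L2_eq_def algebra_simps intro!: square_integrable_add square_integrable_scale)
  have sc3: "c *\<^sub>C c' *\<^sub>C f = (c * c') *\<^sub>C f" for c c' :: complex and f :: l2
    by transfer (auto simp: L2_eq_def algebra_simps intro!: square_integrable_scale)
  have sc4: "1 *\<^sub>C f = f"
    by transfer (auto simp: L2_eq_def)
  show "complex_of_real a *\<^sub>C f = a *\<^sub>R f" by (simp add: scaleR_l2_def)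
  show "a *\<^sub>R (f + g) = a *\<^sub>R f + a *\<^sub>R g" "(a + b) *\<^sub>R f = a *\<^sub>R f + b *\<^sub>R f"
    "a *\<^sub>R b *\<^sub>R f = (a * b) *\<^sub>R f" "1 *\<^sub>R f = f"
    by (simp_all add: scaleR_l2_def sc1 sc2 sc3 sc4)
  have c1: "cinner f g = cnj (cinner g f)" for f g :: l2
  proof transfer
    fix f g :: "complex \<Rightarrow> complex"
    have "cnj (LINT z|arc_length. g z * cnj (f z)) = (LINT z|arc_length. cnj (g z * cnj (f z)))"
      by (rule Bochner_Integration.integral_cnj[symmetric])
    then show "(LINT z|arc_length. f z * cnj (g z)) = cnj (LINT z|arc_length. g z * cnj (f z))"
      by (simp add: mult.commute)
  qed
  have c2: "cinner (f + g) h = cinner f h + cinner g h" for f g h :: l2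
    by transfer (auto simp: L2_eq_def distrib_right integrable_cinner)
  have c3: "cinner (c *\<^sub>C f) g = c * cinner f g" for c :: complex and f g :: l2
    by transfer (simp add: mult.assoc)
  show "c *\<^sub>C (f + g) = c *\<^sub>C f + c *\<^sub>C g" by (rule sc1)
  show "(c + c') *\<^sub>C f = c *\<^sub>C f + c' *\<^sub>C f" by (rule sc2)
  show "c *\<^sub>C c' *\<^sub>C f = (c * c') *\<^sub>C f" by (rule sc3)
  show "cinner f g = cnj (cinner g f)" by (rule c1)
  show "cinner (f + g) h = cinner f h + cinner g h" by (rule c2)
  show "cinner (c *\<^sub>C f) g = c * cinner f g" by (rule c3)
  show "Re (cinner f g) = inner f g" by (simp add: inner_l2_def)
  show "inner f g = inner g f"
    using arg_cong[OF c1, of Re f g] by (simp add: inner_l2_def)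
  show "inner (f + g) h = inner f h + inner g h" by (simp add: inner_l2_def c2)
  show "inner (a *\<^sub>R f) g = a * inner f g" by (simp add: inner_l2_def scaleR_l2_def c3)
  have inner_eq: "inner (f::l2) f = (LINT z|arc_length. (cmod (rep_l2 f z))\<^sup>2)" for f
  proof -
    have "cinner f f = (LINT z|arc_length. rep_l2 f z * cnj (rep_l2 f z))"
      by (simp add: cinner_l2.rep_eq)
    also have "\<dots> = (LINT z|arc_length. complex_of_real ((cmod (rep_l2 f z))\<^sup>2))"
      by (simp add: complex_norm_square[symmetric] del: of_real_power)
    also have "\<dots> = complex_of_real (LINT z|arc_length. (cmod (rep_l2 f z))\<^sup>2)"
      by (rule integral_complex_of_real)
    finally show ?thesis by (simp add: inner_l2_def del: of_real_power)
  qed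
  show "0 \<le> inner f f" by (simp add: inner_eq)
  have rep: "L2_eq (rep_l2 f) (rep_l2 f)" by (rule Quotient3_rep_reflp[OF Quotient3_l2])
  have int: "integrable arc_length (\<lambda>z. (cmod (rep_l2 f z))\<^sup>2)"
    using rep by (simp add: L2_eq_def square_integrable_def)
  have "inner f f = 0 \<longleftrightarrow> (AE z in arc_length. rep_l2 f z = 0)"
    unfolding inner_eq using integral_nonneg_eq_0_iff_AE[OF int] by simp
  also have "\<dots> \<longleftrightarrow> L2_eq (rep_l2 f) (\<lambda>z. 0)"
    using rep square_integrable_zero by (simp add: L2_eq_def)
  also have "\<dots> \<longleftrightarrow> f = 0"
  proof
    assume "L2_eq (rep_l2 f) (\<lambda>z. 0)"
    then have "abs_l2 (rep_l2 f) = abs_l2 (\<lambda>z. 0)"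
      by (rule Quotient3_rel_abs[OF Quotient3_l2])
    then show "f = 0" by (simp add: zero_l2_def Quotient3_abs_rep[OF Quotient3_l2])
  next
    assume "f = 0"
    then show "L2_eq (rep_l2 f) (\<lambda>z. 0)"
      unfolding zero_l2_def
      using Quotient3_rep_abs[OF Quotient3_l2, of "\<lambda>z. 0"] square_integrable_zero
      by (simp add: L2_eq_def)
  qed
  finally show "inner f f = 0 \<longleftrightarrow> f = 0" .
  show "norm f = sqrt (inner f f)" by (rule norm_l2_def)
  show "sgn f = inverse (norm f) *\<^sub>R f" by (rule sgn_l2_def)
  show "dist f g = norm (f - g)" by (rule dist_l2_def)
  show "uniformity = (INF e\<in>{0<..}. principal {(f, g :: l2). dist f g < e})"
    by (rule uniformity_l2_def)
  show "open U \<longleftrightarrow> (\<forall>f\<in>U. \<forall>\<^sub>F (f', g) in uniformity. f' = f \<longrightarrow> g \<in> U)"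
    by (rule open_l2_def)
qed

end

lift_definition l2_cnj :: "l2 \<Rightarrow> l2" is "\<lambda>f z. cnj (f z)"
  by (auto simp: L2_eq_def intro: square_integrable_cnj elim: eventually_mono)

lift_definition l2_mult_zeta :: "l2 \<Rightarrow> l2" is "\<lambda>f z. z * f z"
  by (auto simp: L2_eq_def intro: square_integrable_bounded_mult[where B = 1] elim: eventually_mono)

lift_definition l2_mult_cnj_zeta :: "l2 \<Rightarrow> l2" is "\<lambda>f z. cnj z * f z"
  by (auto simp: L2_eq_def elim: eventually_mono
      intro: square_integrable_bounded_mult[where B = 1] cnj_borel_measurable)

lemma power_int_borel_measurable: "(\<lambda>z::complex. z powi n) \<in> borel_measurable borel"
  by (cases "n \<ge> 0") (simp_all add: power_int_def)

lift_definition l2_char :: "int \<Rightarrow> l2" is "\<lambda>n z. z powi n"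
  proof -
  fix n :: int
  have "square_integrable (\<lambda>z. 1)"
    using finite_measure.integrable_const[OF finite_measure_arc_length]
    by (simp add: square_integrable_def)
  then have "square_integrable (\<lambda>z. z powi n * 1)"
    using power_int_borel_measurable
    by (rule square_integrable_bounded_mult[where B = 1]) (simp add: norm_power_int)
  then show "L2_eq (\<lambda>z. z powi n) (\<lambda>z. z powi n)" by (simp add: L2_eq_def)
qed

lemma l2_cnj_add: "l2_cnj (f + g) = l2_cnj f + l2_cnj g"
  by transfer (auto simp: L2_eq_def intro!: square_integrable_cnj square_integrable_add)

lemma l2_cnj_zero: "l2_cnj 0 = 0"
  by transfer (auto simp: L2_eq_def square_integrable_zero)

lemma l2_cnj_scaleC: "l2_cnj (c *\<^sub>C f) = cnj c *\<^sub>C l2_cnj f"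
  by transfer (auto simp: L2_eq_def simp del: complex_cnj_mult
      intro!: square_integrable_cnj square_integrable_scale, simp)

lemma l2_mult_zeta_add: "l2_mult_zeta (f + g) = l2_mult_zeta f + l2_mult_zeta g"
  by transfer (auto simp: L2_eq_def distrib_left
      intro!: square_integrable_add square_integrable_bounded_mult[where B = 1])

lemma l2_mult_zeta_scaleC: "l2_mult_zeta (c *\<^sub>C f) = c *\<^sub>C l2_mult_zeta f"
  by transfer (auto simp: L2_eq_def mult.left_commute
      intro!: square_integrable_scale square_integrable_bounded_mult[where B = 1])

lemma l2_mult_cnj_zeta_cnj: "l2_mult_cnj_zeta (l2_cnj f) = l2_cnj (l2_mult_zeta f)"
  by transfer (auto simp: L2_eq_def simp flip: complex_cnj_mult
      intro!: square_integrable_cnj square_integrable_bounded_mult[where B = 1])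

lemma cinner_l2_mult_zeta: "cinner (l2_mult_zeta f) (l2_mult_zeta g) = cinner f g"
proof (transfer, rule integral_cong_AE)
  fix f g assume fg: "L2_eq f f" "L2_eq g g"
  then have [measurable]: "f \<in> borel_measurable arc_length" "g \<in> borel_measurable arc_length"
    by (auto simp: L2_eq_def intro: square_integrable_measurable)
  show "(\<lambda>z. z * f z * cnj (z * g z)) \<in> borel_measurable arc_length"
    "(\<lambda>z. f z * cnj (g z)) \<in> borel_measurable arc_length"
    using fg by (auto simp: L2_eq_def simp del: complex_cnj_mult
        intro!: borel_measurable_integrable[OF integrable_cinner]
        square_integrable_bounded_mult[where B = 1])
  show "AE z in arc_length. z * f z * cnj (z * g z) = f z * cnj (g z)"
    using AE_arc_length
  proof eventually_elim
    case (elim z)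
    then have "z * cnj z = 1" by (simp flip: complex_norm_square)
    have "z * f z * cnj (z * g z) = (z * cnj z) * (f z * cnj (g z))"
      by (simp add: mult_ac)
    with \<open>z * cnj z = 1\<close> show ?case by simp
  qed
qed

lemma norm_l2_mult_zeta: "norm (l2_mult_zeta f) = norm f"
  by (simp add: norm_eq_sqrt_inner cinner_l2_mult_zeta flip: Re_cinner)

lemma cinner_l2_cnj: "cinner (l2_cnj f) (l2_cnj g) = cinner g f"
  by transfer (simp add: mult.commute)

lemma norm_l2_cnj: "norm (l2_cnj f) = norm f"
  by (simp add: norm_eq_sqrt_inner cinner_l2_cnj flip: Re_cinner)

lemma l2_mult_zeta_char: "l2_mult_zeta (l2_char n) = l2_char (n + 1)"
proof transfer
  fix n :: int
  have s: "square_integrable (\<lambda>z. z powi m)" for m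
    using l2_char.rsp unfolding rel_fun_def L2_eq_def by auto
  have "AE z in arc_length. z * z powi n = z powi (n + 1)"
    using AE_arc_length
  proof eventually_elim
    case (elim z)
    then have "z \<noteq> 0" by auto
    then show ?case by (simp add: power_int_add)
  qed
  then show "L2_eq (\<lambda>z. z * z powi n) (\<lambda>z. z powi (n + 1))"
    by (auto simp: L2_eq_def s intro!: square_integrable_bounded_mult[where B = 1])
qed

lemma cinner_l2_char: "cinner (l2_char m) (l2_char n) = (if m = n then 1 else 0)"
proof -
  define k where "k = m - n"
  have "cinner (l2_char m) (l2_char n) = (LINT z|arc_length. z powi m * cnj (z powi n))"
    by transfer simp
  also have "\<dots> = (LINT t|uniform_measure lborel {0..2 * pi}. cis t powi m * cnj (cis t powi n))"
  proof -
    have [measurable]: "(\<lambda>z::complex. z powi m * cnj (z powi n)) \<in> borel_measurable borel"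
      by (intro borel_measurable_times power_int_borel_measurable
          measurable_compose[OF _ cnj_borel_measurable])
    show ?thesis
      unfolding arc_length_def using cis_borel_measurable by (subst integral_distr) (auto simp del: complex_cnj_power_int)
  qed
  also have "\<dots> = (LINT t|uniform_measure lborel {0..2 * pi}. cis (of_int k * t))"
    by (simp add: k_def cis_power_int cis_cnj cis_mult left_diff_distrib)
  also have "\<dots> = (LINT t|density lborel (\<lambda>t. ennreal (indicator {0..2 * pi} t / (2 * pi))). cis (of_int k * t))"
  proof -
    have "indicator {0..2 * pi} t / ennreal (2 * pi) = ennreal (indicator {0..2 * pi} t / (2 * pi))" for t
      by (simp add: divide_ennreal flip: ennreal_indicator)
    then show ?thesis by (simp add: uniform_measure_def)
  qed
  also have "\<dots> = (LINT t|lborel. (indicator {0..2 * pi} t / (2 * pi)) *\<^sub>R cis (of_int k * t))"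
  proof (rule integral_density)
    show "(\<lambda>t. cis (of_int k * t)) \<in> borel_measurable lborel"
      by (auto intro!: borel_measurable_continuous_onI continuous_intros)
  qed auto
  also have "\<dots> = (LINT t|lborel. indicator {0..2 * pi} t *\<^sub>R (cis (of_int k * t) / complex_of_real (2 * pi)))"
    by (intro Bochner_Integration.integral_cong) (auto simp: scaleR_conv_of_real)
  also have "\<dots> = (if m = n then 1 else 0)"
  proof (cases "k = 0")
    case True
    have "(LINT t|lborel. indicator {0..2 * pi} t *\<^sub>R (cis (of_int k * t) / complex_of_real (2 * pi))) = 
      complex_of_real (2 * pi) / complex_of_real (2 * pi) - complex_of_real 0 / complex_of_real (2 * pi)"
      using True
      by (intro integral_FTC_atLeastAtMost)
        (auto intro!: derivative_eq_intros continuous_intros simp: has_vector_derivative_def scaleR_conv_of_real)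
    then show ?thesis using True by (simp add: k_def)
  next
    case False
    define F where "F t = cis (of_int k * t) / (\<i> * of_int k * complex_of_real (2 * pi))" for t :: real
    have "(LINT t|lborel. indicator {0..2 * pi} t *\<^sub>R (cis (of_int k * t) / complex_of_real (2 * pi))) =
      F (2 * pi) - F 0"
    proof (rule integral_FTC_atLeastAtMost)
      fix t
      have "((\<lambda>t. exp (\<i> * of_int k * complex_of_real t) / (\<i> * of_int k * complex_of_real (2 * pi)))
          has_vector_derivative
          exp (\<i> * of_int k * complex_of_real t) / complex_of_real (2 * pi)) (at t within {0..2 * pi})"
        using False
        by (auto intro!: derivative_eq_intros has_vector_derivative_real_field simp: field_simps)
      then show "(F has_vector_derivative cis (of_int k * t) / complex_of_real (2 * pi))
          (at t within {0..2 * pi})"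
        by (simp add: F_def[abs_def] cis_conv_exp mult.assoc)
    qed (auto intro!: continuous_intros)
    also have "\<dots> = 0"
    proof -
      have "cis (of_int k * (2 * pi)) = 1"
        using cis_multiple_2pi[of "of_int k"] by (simp add: mult.commute mult.left_commute)
      then show ?thesis by (simp add: F_def)
    qed
    finally show ?thesis using False by (simp add: k_def)
  qed
  finally show ?thesis .
qed


section \<open>Hardy spaces\<close>

text \<open>A Hardy function on the disc is identified with its boundary function, so that \<open>H\<^sup>2\<close> is the
  subspace of \<open>L\<^sup>2\<close> whose elements have vanishing negative Fourier coefficients. The typedefs below
  turn it and its conjugate into inner product spaces of their own, with the structure inherited
  from \<open>L\<^sup>2\<close>.\<close>

definition hardy :: "l2 set"
  where "hardy = {f. \<forall>n<0. cinner f (l2_char n) = 0}"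

definition conj_hardy :: "l2 set"
  where "conj_hardy = l2_cnj ` hardy"

lemma hardy_zero: "0 \<in> hardy"
proof -
  have "cinner (0 :: l2) g = 0" for g
    using cinner_add_left[of 0 0 g] by simp
  then show ?thesis by (simp add: hardy_def)
qed

lemma hardy_add: "f \<in> hardy \<Longrightarrow> g \<in> hardy \<Longrightarrow> f + g \<in> hardy"
  by (simp add: hardy_def cinner_add_left)

lemma hardy_scaleC: "f \<in> hardy \<Longrightarrow> c *\<^sub>C f \<in> hardy"
  by (simp add: hardy_def cinner_scaleC_left)

lemma hardy_mult_zeta: "f \<in> hardy \<Longrightarrow> l2_mult_zeta f \<in> hardy"
  unfolding hardy_def
proof safe
  fix n :: int assume f: "\<forall>n<0. cinner f (l2_char n) = 0" and n: "n < 0"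
  have "cinner (l2_mult_zeta f) (l2_char n) = cinner (l2_mult_zeta f) (l2_mult_zeta (l2_char (n - 1)))"
    by (simp add: l2_mult_zeta_char)
  also have "\<dots> = 0" using f n by (simp add: cinner_l2_mult_zeta)
  finally show "cinner (l2_mult_zeta f) (l2_char n) = 0" .
qed

lemma conj_hardy_zero: "0 \<in> conj_hardy"
  unfolding conj_hardy_def using hardy_zero l2_cnj_zero by (metis image_eqI)

lemma conj_hardy_add: "f \<in> conj_hardy \<Longrightarrow> g \<in> conj_hardy \<Longrightarrow> f + g \<in> conj_hardy"
  unfolding conj_hardy_def by (auto simp flip: l2_cnj_add intro: hardy_add)

lemma conj_hardy_scaleC: "f \<in> conj_hardy \<Longrightarrow> c *\<^sub>C f \<in> conj_hardy"
  unfolding conj_hardy_def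
proof safe
  fix f assume "f \<in> hardy"
  then show "c *\<^sub>C l2_cnj f \<in> l2_cnj ` hardy"
    by (intro image_eqI[where x = "cnj c *\<^sub>C f"]) (simp_all add: l2_cnj_scaleC hardy_scaleC)
qed

lemma conj_hardy_mult_cnj_zeta: "f \<in> conj_hardy \<Longrightarrow> l2_mult_cnj_zeta f \<in> conj_hardy"
  unfolding conj_hardy_def by (auto simp: l2_mult_cnj_zeta_cnj intro: hardy_mult_zeta)

typedef h2 = hardy
  using hardy_zero by blast

typedef ch2 = conj_hardy
  using conj_hardy_zero by blast

setup_lifting type_definition_h2
setup_lifting type_definition_ch2

instantiation h2 :: complex_inner
begin

lift_definition zero_h2 :: h2 is 0 by (rule hardy_zero)
lift_definition plus_h2 :: "h2 \<Rightarrow> h2 \<Rightarrow> h2" is "(+)" by (rule hardy_add)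
lift_definition scaleC_h2 :: "complex \<Rightarrow> h2 \<Rightarrow> h2" is "(*\<^sub>C)" by (rule hardy_scaleC)
lift_definition cinner_h2 :: "h2 \<Rightarrow> h2 \<Rightarrow> complex" is cinner .
lift_definition uminus_h2 :: "h2 \<Rightarrow> h2" is uminus
  unfolding uminus_l2_def by (rule hardy_scaleC)
lift_definition minus_h2 :: "h2 \<Rightarrow> h2 \<Rightarrow> h2" is "(-)"
  unfolding minus_l2_def uminus_l2_def by (intro hardy_add hardy_scaleC)
lift_definition scaleR_h2 :: "real \<Rightarrow> h2 \<Rightarrow> h2" is "(*\<^sub>R)"
  unfolding scaleR_l2_def by (rule hardy_scaleC)
lift_definition inner_h2 :: "h2 \<Rightarrow> h2 \<Rightarrow> real" is inner .
lift_definition norm_h2 :: "h2 \<Rightarrow> real" is norm .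
lift_definition dist_h2 :: "h2 \<Rightarrow> h2 \<Rightarrow> real" is dist .
definition sgn_h2 :: "h2 \<Rightarrow> h2" where "sgn_h2 f = scaleR (inverse (norm f)) f"
definition uniformity_h2 :: "(h2 \<times> h2) filter"
  where "uniformity_h2 = (INF e\<in>{0<..}. principal {(f, g). dist f g < e})"
definition open_h2 :: "h2 set \<Rightarrow> bool"
  where "open_h2 U \<longleftrightarrow> (\<forall>f\<in>U. \<forall>\<^sub>F (f', g) in uniformity. f' = f \<longrightarrow> g \<in> U)"

instance
proof
  fix f g h :: h2 and c c' :: complex and a b :: real and U :: "h2 set"
  show "f + g + h = f + (g + h)" by transfer (rule add.assoc)
  show "f + g = g + f" by transfer (rule add.commute)
  show "0 + f = f" by transfer simp
  show "- f + f = 0" by transfer simp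
  show "f - g = f + - g" by transfer simp
  show "a *\<^sub>R (f + g) = a *\<^sub>R f + a *\<^sub>R g" by transfer (rule scaleR_add_right)
  show "(a + b) *\<^sub>R f = a *\<^sub>R f + b *\<^sub>R f" by transfer (rule scaleR_add_left)
  show "a *\<^sub>R b *\<^sub>R f = (a * b) *\<^sub>R f" by transfer simp
  show "1 *\<^sub>R f = f" by transfer simp
  show "c *\<^sub>C (f + g) = c *\<^sub>C f + c *\<^sub>C g" by transfer (rule scaleC_add_right)
  show "(c + c') *\<^sub>C f = c *\<^sub>C f + c' *\<^sub>C f" by transfer (rule scaleC_add_left)
  show "c *\<^sub>C c' *\<^sub>C f = (c * c') *\<^sub>C f" by transfer (rule scaleC_scaleC)
  show "complex_of_real a *\<^sub>C f = a *\<^sub>R f" by transfer (rule scaleC_of_real)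
  show "cinner f g = cnj (cinner g f)" by transfer (rule cinner_commute)
  show "cinner (f + g) h = cinner f h + cinner g h" by transfer (rule cinner_add_left)
  show "cinner (c *\<^sub>C f) g = c * cinner f g" by transfer (rule cinner_scaleC_left)
  show "Re (cinner f g) = inner f g" by transfer (rule Re_cinner)
  show "inner f g = inner g f" by transfer (rule inner_commute)
  show "inner (f + g) h = inner f h + inner g h" by transfer (rule inner_add_left)
  show "inner (a *\<^sub>R f) g = a * inner f g" by transfer simp
  show "0 \<le> inner f f" by transfer simp
  show "inner f f = 0 \<longleftrightarrow> f = 0" by transfer simp
  show "norm f = sqrt (inner f f)" by transfer (rule norm_eq_sqrt_inner)
  show "dist f g = norm (f - g)" by transfer (rule dist_norm)
  show "sgn f = inverse (norm f) *\<^sub>R f" by (rule sgn_h2_def)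
  show "uniformity = (INF e\<in>{0<..}. principal {(f, g :: h2). dist f g < e})"
    by (rule uniformity_h2_def)
  show "open U \<longleftrightarrow> (\<forall>f\<in>U. \<forall>\<^sub>F (f', g) in uniformity. f' = f \<longrightarrow> g \<in> U)"
    by (rule open_h2_def)
qed

end

instantiation ch2 :: complex_inner
begin

lift_definition zero_ch2 :: ch2 is 0 by (rule conj_hardy_zero)
lift_definition plus_ch2 :: "ch2 \<Rightarrow> ch2 \<Rightarrow> ch2" is "(+)" by (rule conj_hardy_add)
lift_definition scaleC_ch2 :: "complex \<Rightarrow> ch2 \<Rightarrow> ch2" is "(*\<^sub>C)" by (rule conj_hardy_scaleC)
lift_definition cinner_ch2 :: "ch2 \<Rightarrow> ch2 \<Rightarrow> complex" is cinner .
lift_definition uminus_ch2 :: "ch2 \<Rightarrow> ch2" is uminus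
  unfolding uminus_l2_def by (rule conj_hardy_scaleC)
lift_definition minus_ch2 :: "ch2 \<Rightarrow> ch2 \<Rightarrow> ch2" is "(-)"
  unfolding minus_l2_def uminus_l2_def by (intro conj_hardy_add conj_hardy_scaleC)
lift_definition scaleR_ch2 :: "real \<Rightarrow> ch2 \<Rightarrow> ch2" is "(*\<^sub>R)"
  unfolding scaleR_l2_def by (rule conj_hardy_scaleC)
lift_definition inner_ch2 :: "ch2 \<Rightarrow> ch2 \<Rightarrow> real" is inner .
lift_definition norm_ch2 :: "ch2 \<Rightarrow> real" is norm .
lift_definition dist_ch2 :: "ch2 \<Rightarrow> ch2 \<Rightarrow> real" is dist .
definition sgn_ch2 :: "ch2 \<Rightarrow> ch2" where "sgn_ch2 f = scaleR (inverse (norm f)) f"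
definition uniformity_ch2 :: "(ch2 \<times> ch2) filter"
  where "uniformity_ch2 = (INF e\<in>{0<..}. principal {(f, g). dist f g < e})"
definition open_ch2 :: "ch2 set \<Rightarrow> bool"
  where "open_ch2 U \<longleftrightarrow> (\<forall>f\<in>U. \<forall>\<^sub>F (f', g) in uniformity. f' = f \<longrightarrow> g \<in> U)"

instance
proof
  fix f g h :: ch2 and c c' :: complex and a b :: real and U :: "ch2 set"
  show "f + g + h = f + (g + h)" by transfer (rule add.assoc)
  show "f + g = g + f" by transfer (rule add.commute)
  show "0 + f = f" by transfer simp
  show "- f + f = 0" by transfer simp
  show "f - g = f + - g" by transfer simp
  show "a *\<^sub>R (f + g) = a *\<^sub>R f + a *\<^sub>R g" by transfer (rule scaleR_add_right)
  show "(a + b) *\<^sub>R f = a *\<^sub>R f + b *\<^sub>R f" by transfer (rule scaleR_add_left)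
  show "a *\<^sub>R b *\<^sub>R f = (a * b) *\<^sub>R f" by transfer simp
  show "1 *\<^sub>R f = f" by transfer simp
  show "c *\<^sub>C (f + g) = c *\<^sub>C f + c *\<^sub>C g" by transfer (rule scaleC_add_right)
  show "(c + c') *\<^sub>C f = c *\<^sub>C f + c' *\<^sub>C f" by transfer (rule scaleC_add_left)
  show "c *\<^sub>C c' *\<^sub>C f = (c * c') *\<^sub>C f" by transfer (rule scaleC_scaleC)
  show "complex_of_real a *\<^sub>C f = a *\<^sub>R f" by transfer (rule scaleC_of_real)
  show "cinner f g = cnj (cinner g f)" by transfer (rule cinner_commute)
  show "cinner (f + g) h = cinner f h + cinner g h" by transfer (rule cinner_add_left)
  show "cinner (c *\<^sub>C f) g = c * cinner f g" by transfer (rule cinner_scaleC_left)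
  show "Re (cinner f g) = inner f g" by transfer (rule Re_cinner)
  show "inner f g = inner g f" by transfer (rule inner_commute)
  show "inner (f + g) h = inner f h + inner g h" by transfer (rule inner_add_left)
  show "inner (a *\<^sub>R f) g = a * inner f g" by transfer simp
  show "0 \<le> inner f f" by transfer simp
  show "inner f f = 0 \<longleftrightarrow> f = 0" by transfer simp
  show "norm f = sqrt (inner f f)" by transfer (rule norm_eq_sqrt_inner)
  show "dist f g = norm (f - g)" by transfer (rule dist_norm)
  show "sgn f = inverse (norm f) *\<^sub>R f" by (rule sgn_ch2_def)
  show "uniformity = (INF e\<in>{0<..}. principal {(f, g :: ch2). dist f g < e})"
    by (rule uniformity_ch2_def)
  show "open U \<longleftrightarrow> (\<forall>f\<in>U. \<forall>\<^sub>F (f', g) in uniformity. f' = f \<longrightarrow> g \<in> U)"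
    by (rule open_ch2_def)
qed

end

lift_definition h2_cnj :: "h2 \<Rightarrow> ch2" is l2_cnj
  by (simp add: conj_hardy_def)

lift_definition poly_l2 :: "complex poly \<Rightarrow> l2" is "\<lambda>p z. poly p z"
proof -
  fix p :: "complex poly"
  have c: "continuous_on S (poly p)" for S by (intro continuous_intros)
  have "compact (poly p ` sphere 0 1)"
    by (intro compact_continuous_image c) simp
  then obtain B where B: "\<And>z. cmod z = 1 \<Longrightarrow> cmod (poly p z) \<le> B"
    using compact_imp_bounded bounded_pos by (metis imageI mem_sphere_0)
  have "square_integrable (\<lambda>z. 1)"
    using finite_measure.integrable_const[OF finite_measure_arc_length]
    by (simp add: square_integrable_def)
  then have "square_integrable (\<lambda>z. poly p z * 1)"
    using borel_measurable_continuous_onI[OF c] B by (rule square_integrable_bounded_mult)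
  then show "L2_eq (poly p) (poly p)" by (simp add: L2_eq_def)
qed

lemma poly_l2_0: "poly_l2 0 = 0"
  by transfer (simp add: L2_eq_def square_integrable_zero)

lemma poly_l2_pCons: "poly_l2 (pCons a p) = a *\<^sub>C l2_char 0 + l2_mult_zeta (poly_l2 p)"
proof -
  have "square_integrable (poly q)" for q :: "complex poly"
    using poly_l2.rsp unfolding rel_fun_def L2_eq_def by auto
  from this[of "pCons a p"] have "square_integrable (\<lambda>z. a + z * poly p z)"
    by (simp add: poly_pCons[abs_def])
  then show ?thesis
    by transfer (simp add: L2_eq_def poly_pCons[abs_def])
qed

lift_definition poly_h2 :: "complex poly \<Rightarrow> h2" is poly_l2
proof -
  fix p :: "complex poly"
  have "l2_char 0 \<in> hardy" by (simp add: hardy_def cinner_l2_char)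
  then show "poly_l2 p \<in> hardy"
    by (induction p) (simp_all add: poly_l2_0 poly_l2_pCons hardy_zero hardy_add hardy_scaleC hardy_mult_zeta)
qed


section \<open>Shifts and Hankel operators\<close>

lift_definition h2_mult_zeta :: "h2 \<Rightarrow> h2" is l2_mult_zeta
  by (rule hardy_mult_zeta)

lift_definition ch2_mult_cnj_zeta :: "ch2 \<Rightarrow> ch2" is l2_mult_cnj_zeta
  by (rule conj_hardy_mult_cnj_zeta)

lift_definition M_zeta :: "h2 \<Rightarrow>\<^sub>L h2" is h2_mult_zeta
proof (rule bounded_linear_intro[where K = 1])
  fix f g :: h2 and a :: real
  show "h2_mult_zeta (f + g) = h2_mult_zeta f + h2_mult_zeta g"
    by transfer (rule l2_mult_zeta_add)
  show "h2_mult_zeta (a *\<^sub>R f) = a *\<^sub>R h2_mult_zeta f"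
    by transfer (simp add: l2_mult_zeta_scaleC flip: scaleC_of_real)
  show "norm (h2_mult_zeta f) \<le> norm f * 1"
    by transfer (simp add: norm_l2_mult_zeta)
qed

lift_definition M_cnj_zeta :: "ch2 \<Rightarrow>\<^sub>L ch2" is ch2_mult_cnj_zeta
proof (rule bounded_linear_intro[where K = 1])
  fix f g :: ch2 and a :: real
  show "ch2_mult_cnj_zeta (f + g) = ch2_mult_cnj_zeta f + ch2_mult_cnj_zeta g"
    by transfer (auto simp: conj_hardy_def l2_mult_cnj_zeta_cnj l2_mult_zeta_add simp flip: l2_cnj_add)
  show "ch2_mult_cnj_zeta (a *\<^sub>R f) = a *\<^sub>R ch2_mult_cnj_zeta f"
  proof transfer
    fix a :: real and f assume "f \<in> conj_hardy"
    then obtain g where f: "f = l2_cnj g" by (auto simp: conj_hardy_def)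
    have "l2_cnj (a *\<^sub>R h) = a *\<^sub>R l2_cnj h" for h
      by (simp add: l2_cnj_scaleC flip: scaleC_of_real)
    moreover have "l2_mult_zeta (a *\<^sub>R h) = a *\<^sub>R l2_mult_zeta h" for h
      by (simp add: l2_mult_zeta_scaleC flip: scaleC_of_real)
    ultimately show "l2_mult_cnj_zeta (a *\<^sub>R f) = a *\<^sub>R l2_mult_cnj_zeta f"
      unfolding f by (metis l2_mult_cnj_zeta_cnj)
  qed
  show "norm (ch2_mult_cnj_zeta f) \<le> norm f * 1"
    by transfer (auto simp: conj_hardy_def l2_mult_cnj_zeta_cnj norm_l2_cnj norm_l2_mult_zeta)
qed

definition is_hankel_op :: "h2 \<Rightarrow> (h2 \<Rightarrow>\<^sub>L ch2) \<Rightarrow> bool"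
  where "is_hankel_op q H \<longleftrightarrow> is_complex_linear H \<and>
    (\<forall>f g. cinner (blinfun_apply H (poly_h2 f)) (h2_cnj (poly_h2 g)) = cinner (poly_h2 (f * g)) q)"

definition Han :: "h2 set"
  where "Han = {q. \<exists>H. is_hankel_op q H}"

text \<open>By density of the polynomials there is at most one such operator; the description is
  therefore proper exactly for the symbols in \<^const>\<open>Han\<close>.\<close>

definition hankel :: "h2 \<Rightarrow> (h2 \<Rightarrow>\<^sub>L ch2)"
  where "hankel q = (THE H. is_hankel_op q H)"


section \<open>Polynomials in \<open>d\<close> variables\<close>

text \<open>A polynomial is a finitely supported family of coefficients indexed by exponent vectors;
  the variables are numbered \<open>1, \<dots>, d\<close>.\<close>

type_synonym mpolynomial = "(nat \<Rightarrow>\<^sub>0 nat) \<Rightarrow>\<^sub>0 complex"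

definition mpolynomials :: "nat \<Rightarrow> mpolynomial set"
  where "mpolynomials d = {p. \<forall>m\<in>Poly_Mapping.keys p. Poly_Mapping.keys m \<subseteq> {1..d}}"

definition mpoly_eval :: "nat \<Rightarrow> mpolynomial \<Rightarrow> (nat \<Rightarrow> complex) \<Rightarrow> complex"
  where "mpoly_eval d p z =
    (\<Sum>m\<in>Poly_Mapping.keys p.
      Poly_Mapping.lookup p m * (\<Prod>j\<in>{1..d}. z j ^ Poly_Mapping.lookup m j))"

primrec blinfun_power :: "('a::real_normed_vector \<Rightarrow>\<^sub>L 'a) \<Rightarrow> nat \<Rightarrow> ('a \<Rightarrow>\<^sub>L 'a)"
  where
    "blinfun_power A 0 = id_blinfun"
  | "blinfun_power A (Suc n) = A o\<^sub>L blinfun_power A n"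

text \<open>The monomial \<open>T\<^sub>1\<^bsup>m 1\<^esup> \<cdots> T\<^sub>d\<^bsup>m d\<^esup>\<close>; the order of the factors is immaterial for commuting
  operators.\<close>

definition op_monomial ::
    "nat \<Rightarrow> (nat \<Rightarrow> ('a::real_normed_vector \<Rightarrow>\<^sub>L 'a)) \<Rightarrow> (nat \<Rightarrow>\<^sub>0 nat) \<Rightarrow> ('a \<Rightarrow>\<^sub>L 'a)"
  where "op_monomial d T m =
    foldr (\<lambda>j A. blinfun_power (T j) (Poly_Mapping.lookup m j) o\<^sub>L A) [1..<Suc d] id_blinfun"

definition op_mpoly :: "nat \<Rightarrow> mpolynomial \<Rightarrow> (nat \<Rightarrow> ('a::complex_inner \<Rightarrow>\<^sub>L 'a)) \<Rightarrow> ('a \<Rightarrow>\<^sub>L 'a)"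
  where "op_mpoly d p T =
    (\<Sum>m\<in>Poly_Mapping.keys p. scaleC_op (Poly_Mapping.lookup p m) (op_monomial d T m))"

definition polydisc :: "nat \<Rightarrow> (nat \<Rightarrow> complex) set"
  where "polydisc d = (\<Pi>\<^sub>E j\<in>{1..d}. ball 0 1)"

end

theory Submission
  imports
    Defs
    "HOL-Complex_Analysis.Complex_Analysis"
    "HOL-Computational_Algebra.Fundamental_Theorem_Algebra"
begin

text \<open>Write \<open>S = M\<^sub>\<zeta>\<close> and \<open>B\<close> for the adjoint of multiplication by the conjugate of \<open>\<zeta>\<close>. The intertwining \<open>H\<^sub>j S = B H\<^sub>j\<close> makes the \<open>T\<^sub>j\<close> commute and
  gives \<open>p(T)\<close> the rows \<open>(a(S), 0)\<close> and \<open>(\<Sum>\<^sub>j H\<^sub>j b\<^sub>j(S), a(B))\<close>, where \<open>a(z) = p(r\<^sub>1 z, \<dots>, r\<^sub>d z)\<close> and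
  \<open>b\<^sub>j(z) = (\<partial>\<^sub>j p)(r\<^sub>1 z, \<dots>, r\<^sub>d z)\<close>. Testing \<open>\<parallel>T\<^sub>j\<parallel> \<le> 1\<close> on suitable vectors yields
  \<open>\<parallel>H\<^sub>j\<parallel> \<le> 1 - r\<^sub>j\<^sup>2\<close>. If \<open>|p| < M\<close> on the closed polydisc, then the Schwarz-Pick inequality gives
  \<open>M \<Sum>\<^sub>j (1 - r\<^sub>j\<^sup>2) |b\<^sub>j| \<le> M\<^sup>2 - |a|\<^sup>2\<close> on the circle. Since \<open>b\<^sub>j = u v\<close> with analytic \<open>u, v\<close> such that
  \<open>|u|\<^sup>2 = |v|\<^sup>2 = |b\<^sub>j|\<close> on the circle, \<open>\<langle>H\<^sub>j b\<^sub>j(S) f, g'\<rangle>\<close> with \<open>g'\<close> the conjugate of \<open>g\<close> is at most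
  \<open>\<parallel>H\<^sub>j\<parallel> (\<integral> |b\<^sub>j| |f|\<^sup>2)\<^bsup>1/2\<^esup> (\<integral> |b\<^sub>j| |g|\<^sup>2)\<^bsup>1/2\<^esup>\<close>, and the Cauchy-Schwarz inequality bounds the whole
  form of \<open>p(T)\<close> by \<open>M\<close>.\<close>

section \<open>The Schwarz-Pick inequality on the polydisc\<close>

text \<open>This is why the Moebius map \<open>M * (x - y) / (M^2 - cnj y * x)\<close> takes the
  open disc of radius \<open>M\<close> into the unit disc when \<open>|y| < M\<close>: both factors
  on the right are then positive.\<close>

lemma cmod_moebius_diff:
  fixes x y :: complex
  shows "(cmod (of_real (M\<^sup>2) - cnj y * x))\<^sup>2 - (M * cmod (x - y))\<^sup>2 = (M\<^sup>2 - (cmod x)\<^sup>2) * (M\<^sup>2 - (cmod y)\<^sup>2)"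
  unfolding cmod_power2 power_mult_distrib by (simp add: power2_eq_square algebra_simps)

text \<open>Follow \<open>G\<close> by the Moebius map that takes the disc of radius
  \<open>M\<close> to the unit disc and \<open>G 0\<close> to 0. The Schwarz lemma bounds the
  derivative at 0 of the resulting \<open>K\<close> by 1, and that derivative is
  \<open>M * deriv G 0 / (M^2 - |G 0|^2)\<close>.\<close>

lemma Schwarz_Pick_0:
  assumes hol: "G holomorphic_on ball 0 1" and bd: "\<And>z. z \<in> ball 0 1 \<Longrightarrow> cmod (G z) < M"
  shows "M * cmod (deriv G 0) \<le> M\<^sup>2 - (cmod (G 0))\<^sup>2"
proof -
  define K where "K z = of_real M * (G z - G 0) / (of_real (M\<^sup>2) - cnj (G 0) * G z)" for z
  have M: "M > 0" using bd[of 0] norm_ge_zero[of "G 0"] by (simp del: norm_ge_zero)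
  have sq: "(cmod (G z))\<^sup>2 < M\<^sup>2" if "z \<in> ball 0 1" for z
    using bd[OF that] by (simp add: power_strict_mono)
  have less: "M * cmod (G z - G 0) < cmod (of_real (M\<^sup>2) - cnj (G 0) * G z)" if "z \<in> ball 0 1" for z
  proof (rule power2_less_imp_less)
    have "(M\<^sup>2 - (cmod (G z))\<^sup>2) * (M\<^sup>2 - (cmod (G 0))\<^sup>2) > 0"
      using sq[OF that] sq[of 0] by simp
    then show "(M * cmod (G z - G 0))\<^sup>2 < (cmod (of_real (M\<^sup>2) - cnj (G 0) * G z))\<^sup>2"
      unfolding cmod_moebius_diff[of M "G 0" "G z", symmetric] by simp
  qed simp
  have nz: "of_real (M\<^sup>2) - cnj (G 0) * G z \<noteq> 0" if "z \<in> ball 0 1" for z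
  proof -
    have "0 \<le> M * cmod (G z - G 0)" using M by simp
    with less[OF that] show ?thesis by auto
  qed
  have "norm (deriv K 0) \<le> 1"
  proof (rule Schwarz_Lemma(2)[where \<xi> = 0])
    show "K holomorphic_on ball 0 1"
      unfolding K_def by (intro holomorphic_intros hol nz) auto
    show "cmod (K z) < 1" if "cmod z < 1" for z
    proof -
      have "z \<in> ball 0 1" using that by simp
      then show ?thesis
        using less[of z] nz[of z] M by (simp add: K_def norm_mult norm_divide)
    qed
  qed (simp_all add: K_def)
  moreover have "(K has_field_derivative of_real M * deriv G 0 / of_real (M\<^sup>2 - (cmod (G 0))\<^sup>2)) (at 0)"
  proof -
    have "(G has_field_derivative deriv G 0) (at 0)"
      using hol by (rule holomorphic_derivI) auto
    moreover have "cnj (G 0) * G 0 = of_real ((cmod (G 0))\<^sup>2)"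
      by (simp add: complex_norm_square[symmetric] mult.commute)
    moreover have "of_real (M\<^sup>2) - cnj (G 0) * G 0 \<noteq> 0" by (rule nz) simp
    ultimately show ?thesis
      unfolding K_def by (auto intro!: derivative_eq_intros simp del: of_real_power)
  qed
  then have "deriv K 0 = of_real M * deriv G 0 / of_real (M\<^sup>2 - (cmod (G 0))\<^sup>2)"
    by (rule DERIV_imp_deriv)
  ultimately have "M * cmod (deriv G 0) / \<bar>M\<^sup>2 - (cmod (G 0))\<^sup>2\<bar> \<le> 1"
    using M by (simp add: norm_mult norm_divide del: of_real_power of_real_diff)
  then show ?thesis
    using sq[of 0] by (simp add: pos_divide_le_eq)
qed

text \<open>The one-variable inequality is applied to \<open>F\<close> along an analytic disc
  through \<open>w\<close>. Each coordinate of the disc is a Moebius map, with its phase chosen so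
  that all terms of the chain rule become nonnegative and their sum is the weighted sum of the
  moduli. \<open>F\<close> enters only through its behaviour along curves, where \<open>b j\<close>
  acts as its partial derivative at \<open>w\<close>.\<close>

lemma Schwarz_Pick_polydisc:
  fixes F :: "('i \<Rightarrow> complex) \<Rightarrow> complex"
  assumes J: "finite J" and w: "\<And>j. j \<in> J \<Longrightarrow> cmod (w j) \<le> 1"
    and bd: "\<And>x. (\<And>j. j \<in> J \<Longrightarrow> cmod (x j) \<le> 1) \<Longrightarrow> cmod (F x) < M"
    and hol: "\<And>\<phi>. (\<And>j. \<phi> j holomorphic_on ball 0 1) \<Longrightarrow>
      (\<lambda>t. F (\<lambda>j. \<phi> j t)) holomorphic_on ball 0 1"
    and der: "\<And>\<phi> v. (\<And>j. \<phi> j 0 = w j) \<Longrightarrow> (\<And>j. (\<phi> j has_field_derivative v j) (at 0)) \<Longrightarrow>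
      ((\<lambda>t. F (\<lambda>j. \<phi> j t)) has_field_derivative (\<Sum>j\<in>J. v j * b j)) (at 0)"
  shows "M * (\<Sum>j\<in>J. (1 - (cmod (w j))\<^sup>2) * cmod (b j)) \<le> M\<^sup>2 - (cmod (F w))\<^sup>2"
proof -
  \<comment> \<open>The phase that rotates \<open>b j\<close> to its modulus; the value 1 for
    \<open>b j = 0\<close> keeps \<open>cmod (c j) = 1\<close> in every case.\<close>
  define c where "c j = (if b j = 0 then 1 else cnj (b j) / of_real (cmod (b j)))" for j
  have c1: "cmod (c j) = 1" for j by (auto simp: c_def norm_divide)
  have cb: "c j * b j = of_real (cmod (b j))" for j
  proof (cases "b j = 0")
    case False
    have "cnj (b j) * b j = of_real (cmod (b j)) * of_real (cmod (b j))"
      using complex_norm_square[of "b j"] by (simp add: mult.commute power2_eq_square)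
    then show ?thesis using False by (simp add: c_def)
  qed (simp add: c_def)
  \<comment> \<open>For \<open>|w j| < 1\<close> a disc automorphism with value \<open>w j\<close>
    and derivative \<open>(1 - |w j|^2) * c j\<close> at 0; for \<open>|w j| = 1\<close> it
    degenerates to the constant \<open>w j\<close>. Coordinates outside \<open>J\<close> are frozen,
    since \<open>hol\<close> and \<open>der\<close> speak of all indices.\<close>
  define \<phi> where "\<phi> j t = (if j \<in> J then (w j + c j * t) / (1 + cnj (w j) * (c j * t)) else w j)" for j t
  have nz: "1 + cnj (w j) * (c j * t) \<noteq> 0" if "j \<in> J" "t \<in> ball 0 1" for j t
  proof
    assume "1 + cnj (w j) * (c j * t) = 0"
    then have "cmod (cnj (w j) * (c j * t)) = cmod (- 1 :: complex)"
      by (metis add.commute eq_neg_iff_add_eq_0)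
    then have "cmod (w j) * cmod t = 1" by (simp add: norm_mult c1)
    moreover have "cmod (w j) * cmod t \<le> 1 * cmod t" using w[OF that(1)] by (intro mult_right_mono) auto
    ultimately show False using that by simp
  qed
  have \<phi>1: "cmod (\<phi> j t) \<le> 1" if "j \<in> J" "t \<in> ball 0 1" for j t
  proof -
    have "(cmod t)\<^sup>2 \<le> 1" "(cmod (w j))\<^sup>2 \<le> 1"
      using that w by (auto intro!: power_le_one)
    \<comment> \<open>The Moebius identity for radius 1 at the points \<open>c j * t\<close> and
      \<open>- w j\<close>.\<close>
    then have "0 \<le> (1\<^sup>2 - (cmod (c j * t))\<^sup>2) * (1\<^sup>2 - (cmod (- w j))\<^sup>2)"
      by (simp add: norm_mult c1)
    also have "\<dots> = (cmod (1 + cnj (w j) * (c j * t)))\<^sup>2 - (cmod (w j + c j * t))\<^sup>2"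
      unfolding cmod_moebius_diff[symmetric] by (simp add: add.commute)
    finally have "(cmod (w j + c j * t))\<^sup>2 \<le> (cmod (1 + cnj (w j) * (c j * t)))\<^sup>2"
      by (simp only: diff_ge_0_iff_ge)
    then have "cmod (w j + c j * t) \<le> cmod (1 + cnj (w j) * (c j * t))"
      by (rule power2_le_imp_le) (rule norm_ge_zero)
    then show ?thesis using that nz[OF that] by (simp add: \<phi>_def norm_divide)
  qed
  have hol\<phi>: "\<phi> j holomorphic_on ball 0 1" for j
    using nz unfolding \<phi>_def by (cases "j \<in> J") (auto intro!: holomorphic_intros)
  define v where "v j = (if j \<in> J then of_real (1 - (cmod (w j))\<^sup>2) * c j else 0)" for j
  have der\<phi>: "(\<phi> j has_field_derivative v j) (at 0)" for j
  proof (cases "j \<in> J")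
    case True
    have "w j * cnj (w j) = of_real ((cmod (w j))\<^sup>2)"
      by (simp add: complex_norm_square[symmetric])
    then have "c j - w j * (c j * cnj (w j)) = v j"
      using True by (simp add: v_def left_diff_distrib mult.commute[of "c j"] flip: mult.assoc)
    with True show ?thesis
      unfolding \<phi>_def by (auto intro!: derivative_eq_intros)
  qed (simp add: \<phi>_def[abs_def] v_def)
  have "((\<lambda>t. F (\<lambda>j. \<phi> j t)) has_field_derivative (\<Sum>j\<in>J. v j * b j)) (at 0)"
    by (rule der[OF _ der\<phi>]) (simp add: \<phi>_def)
  then have "deriv (\<lambda>t. F (\<lambda>j. \<phi> j t)) 0 = (\<Sum>j\<in>J. v j * b j)"
    by (rule DERIV_imp_deriv)
  also have "\<dots> = of_real (\<Sum>j\<in>J. (1 - (cmod (w j))\<^sup>2) * cmod (b j))"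
    unfolding of_real_sum by (intro sum.cong) (auto simp: v_def mult.assoc cb)
  finally have "cmod (deriv (\<lambda>t. F (\<lambda>j. \<phi> j t)) 0) =
      \<bar>\<Sum>j\<in>J. (1 - (cmod (w j))\<^sup>2) * cmod (b j)\<bar>"
    by (simp only: norm_of_real)
  also have "\<dots> = (\<Sum>j\<in>J. (1 - (cmod (w j))\<^sup>2) * cmod (b j))"
    using w by (intro abs_of_nonneg sum_nonneg mult_nonneg_nonneg) (auto intro!: power_le_one)
  finally have eq: "cmod (deriv (\<lambda>t. F (\<lambda>j. \<phi> j t)) 0) =
      (\<Sum>j\<in>J. (1 - (cmod (w j))\<^sup>2) * cmod (b j))" .
  have "M * cmod (deriv (\<lambda>t. F (\<lambda>j. \<phi> j t)) 0) \<le> M\<^sup>2 - (cmod (F (\<lambda>j. \<phi> j 0)))\<^sup>2"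
    by (intro Schwarz_Pick_0 hol bd \<phi>1 hol\<phi>)
  also have "(\<lambda>j. \<phi> j 0) = w" by (auto simp: \<phi>_def)
  finally show ?thesis by (simp only: eq)
qed

section \<open>Balanced factorization of polynomials on the circle\<close>

text \<open>The Taylor polynomials at 0 converge uniformly on the closed unit disc because the
  radius of convergence exceeds 1.\<close>

lemma holomorphic_poly_approx:
  assumes hol: "f holomorphic_on ball 0 R" and R: "R > 1" and e: "e > 0"
  shows "\<exists>p. \<forall>z\<in>cball 0 1. cmod (f z - poly p z) < e"
proof -
  define a where "a n = (deriv ^^ n) f 0 / fact n" for n
  have sums: "(\<lambda>n. a n * z ^ n) sums f z" if "z \<in> ball 0 R" for z
    using holomorphic_power_series[OF hol that] by (simp add: a_def)
  \<comment> \<open>The expansion is known on the open ball only, so convergence at an intermediate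
    \<open>s\<close> provides a radius of convergence strictly above 1.\<close>
  obtain s where s: "1 < s" "s < R" using R dense by blast
  have "summable (\<lambda>n. a n * of_real s ^ n)"
    using sums[of "of_real s"] s by (auto simp: sums_iff)
  then have "conv_radius a \<ge> norm (of_real s :: complex)"
    by (rule conv_radius_geI)
  then have "conv_radius a \<ge> ereal s" using s by simp
  moreover have "ereal 1 < ereal s" using s by simp
  ultimately have "ereal 1 < conv_radius a" by (rule less_le_trans[rotated])
  then have "uniform_limit (cball 0 1) (\<lambda>n x. \<Sum>i<n. a i * (x - 0) ^ i) (\<lambda>x. suminf (\<lambda>i. a i * (x - 0) ^ i)) sequentially"
    by (rule powser_uniform_limit)
  then have "\<forall>\<^sub>F n in sequentially. \<forall>x\<in>cball 0 1. dist (\<Sum>i<n. a i * x ^ i) (suminf (\<lambda>i. a i * x ^ i)) < e"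
    using e by (auto dest!: uniform_limitD)
  then obtain n where "\<forall>x\<in>cball 0 1. dist (\<Sum>i<n. a i * x ^ i) (suminf (\<lambda>i. a i * x ^ i)) < e"
    using eventually_happens trivial_limit_sequentially by blast
  then have n: "dist (\<Sum>i<n. a i * x ^ i) (suminf (\<lambda>i. a i * x ^ i)) < e" if "x \<in> cball 0 1" for x
    using that by blast
  have "cmod (f z - poly (\<Sum>i<n. monom (a i) i) z) < e" if z: "z \<in> cball 0 1" for z
  proof -
    have "z \<in> ball 0 R" using z R by simp
    then have "(suminf (\<lambda>i. a i * z ^ i)) = f z" using sums sums_iff by blast
    with n[OF z] show ?thesis
      by (simp add: poly_sum poly_monom dist_norm norm_minus_commute)
  qed
  then show ?thesis by blast
qed

text \<open>Telescoping, with \<open>norm y \<le> B + 1\<close> from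
  \<open>\<delta> \<le> 1\<close>. The setting of normed algebras covers both complex values and
  their real moduli.\<close>

lemma norm_mult_diff_le:
  fixes x y :: "'a::real_normed_algebra"
  assumes "norm (x - x') \<le> \<delta>" "norm (y - y') \<le> \<delta>" "norm x' \<le> B" "norm y' \<le> B" "\<delta> \<le> 1"
  shows "norm (x * y - x' * y') \<le> \<delta> * (2 * B + 1)"
proof -
  have "0 \<le> \<delta>" "0 \<le> B" using assms norm_ge_zero order_trans by blast+
  have "norm y \<le> B + 1"
    using assms norm_triangle_ineq[of "y - y'" y'] by simp
  have "x * y - x' * y' = (x - x') * y + x' * (y - y')" by (simp add: algebra_simps)
  also have "norm \<dots> \<le> norm (x - x') * norm y + norm x' * norm (y - y')"
    by (intro order_trans[OF norm_triangle_ineq] add_mono norm_mult_ineq)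
  also have "\<dots> \<le> \<delta> * (B + 1) + B * \<delta>"
    by (intro add_mono mult_mono assms) (use \<open>norm y \<le> B + 1\<close> \<open>0 \<le> \<delta>\<close> \<open>0 \<le> B\<close> in auto)
  finally show ?thesis by (simp add: algebra_simps)
qed

text \<open>The factors are approximate because they have to be polynomials, on which the Hankel
  form is given; exact factors with \<open>|u|^2 = |v|^2 = |b|\<close> involve square roots.\<close>

definition balanced_factors :: "real \<Rightarrow> (complex \<Rightarrow> complex) \<Rightarrow> complex poly \<Rightarrow> complex poly \<Rightarrow> bool"
  where "balanced_factors e b u v \<longleftrightarrow> (\<forall>z\<in>sphere 0 1. cmod (poly u z * poly v z - b z) \<le> e \<and>
    \<bar>(cmod (poly u z))\<^sup>2 - cmod (b z)\<bar> \<le> e \<and> \<bar>(cmod (poly v z))\<^sup>2 - cmod (b z)\<bar> \<le> e)"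

definition has_balanced_factors :: "(complex \<Rightarrow> complex) \<Rightarrow> bool"
  where "has_balanced_factors b \<longleftrightarrow> (\<forall>e>0. \<exists>u v. balanced_factors e b u v)"

lemma bounded_on_sphereE:
  fixes b :: "complex \<Rightarrow> complex"
  assumes "continuous_on (sphere 0 1) b"
  obtains B where "\<And>z. z \<in> sphere 0 1 \<Longrightarrow> cmod (b z) \<le> B" "B \<ge> 0"
proof -
  have "bounded (b ` sphere 0 1)"
    by (intro compact_imp_bounded compact_continuous_image assms) simp
  then obtain B where "B > 0" "\<forall>x\<in>b ` sphere 0 1. cmod x \<le> B" using bounded_pos by blast
  then show ?thesis by (intro that[of B]) auto
qed

lemma small_multiple:
  fixes e C :: real
  assumes "e > 0" "C \<ge> 0"
  obtains \<delta> where "\<delta> > 0" "\<delta> \<le> 1" "\<delta> * C \<le> e"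
proof (rule that[of "min 1 (e / (C + 1))"])
  have "min 1 (e / (C + 1)) * C \<le> e / (C + 1) * (C + 1)"
    using assms by (intro mult_mono) auto
  then show "min 1 (e / (C + 1)) * C \<le> e" using assms by simp
qed (use assms in auto)

text \<open>Factors of \<open>b\<close> and \<open>c\<close> are multiplied separately. All three
  errors are differences of products of bounded quantities, so \<open>norm_mult_diff_le\<close>
  controls each. This reduces polynomials to their linear factors.\<close>

lemma has_balanced_factors_mult:
  assumes b: "has_balanced_factors b" "continuous_on (sphere 0 1) b"
    and c: "has_balanced_factors c" "continuous_on (sphere 0 1) c"
  shows "has_balanced_factors (\<lambda>z. b z * c z)"
  unfolding has_balanced_factors_def
proof safe
  fix e :: real assume e: "e > 0"
  obtain B1 where B1: "\<And>z. z \<in> sphere 0 1 \<Longrightarrow> cmod (b z) \<le> B1" "B1 \<ge> 0"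
    using bounded_on_sphereE[OF b(2)] by metis
  obtain B2 where B2: "\<And>z. z \<in> sphere 0 1 \<Longrightarrow> cmod (c z) \<le> B2" "B2 \<ge> 0"
    using bounded_on_sphereE[OF c(2)] by metis
  define B where "B = max B1 B2"
  have B: "cmod (b z) \<le> B" "cmod (c z) \<le> B" if "z \<in> sphere 0 1" for z
    using B1(1)[OF that] B2(1)[OF that] by (auto simp: B_def)
  have "2 * B + 1 \<ge> 0" using B1 by (auto simp: B_def)
  with e obtain \<delta> where \<delta>: "\<delta> > 0" "\<delta> \<le> 1" "\<delta> * (2 * B + 1) \<le> e"
    using small_multiple by blast
  obtain u1 v1 where 1: "balanced_factors \<delta> b u1 v1"
    using b(1) \<delta>(1) unfolding has_balanced_factors_def by blast
  obtain u2 v2 where 2: "balanced_factors \<delta> c u2 v2"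
    using c(1) \<delta>(1) unfolding has_balanced_factors_def by blast
  have "balanced_factors (\<delta> * (2 * B + 1)) (\<lambda>z. b z * c z) (u1 * u2) (v1 * v2)"
    unfolding balanced_factors_def
  proof (intro ballI conjI)
    fix z :: complex assume z: "z \<in> sphere 0 1"
    note 1 = 1[unfolded balanced_factors_def, rule_format, OF z]
      and 2 = 2[unfolded balanced_factors_def, rule_format, OF z]
    have "cmod ((poly u1 z * poly v1 z) * (poly u2 z * poly v2 z) - b z * c z) \<le> \<delta> * (2 * B + 1)"
      using 1 2 B[OF z] \<delta> by (intro norm_mult_diff_le) auto
    then show "cmod (poly (u1 * u2) z * poly (v1 * v2) z - b z * c z) \<le> \<delta> * (2 * B + 1)"
      by (simp add: mult_ac)
    have "norm ((cmod (poly u1 z))\<^sup>2 * (cmod (poly u2 z))\<^sup>2 - cmod (b z) * cmod (c z)) \<le> \<delta> * (2 * B + 1)"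
      "norm ((cmod (poly v1 z))\<^sup>2 * (cmod (poly v2 z))\<^sup>2 - cmod (b z) * cmod (c z)) \<le> \<delta> * (2 * B + 1)"
      using 1 2 B[OF z] \<delta> by (intro norm_mult_diff_le; auto)+
    then show "\<bar>(cmod (poly (u1 * u2) z))\<^sup>2 - cmod (b z * c z)\<bar> \<le> \<delta> * (2 * B + 1)"
      "\<bar>(cmod (poly (v1 * v2) z))\<^sup>2 - cmod (b z * c z)\<bar> \<le> \<delta> * (2 * B + 1)"
      by (simp_all add: norm_mult power_mult_distrib)
  qed
  then have "balanced_factors e (\<lambda>z. b z * c z) (u1 * u2) (v1 * v2)"
    unfolding balanced_factors_def using \<delta>(3) by force
  then show "\<exists>u v. balanced_factors e (\<lambda>z. b z * c z) u v" by blast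
qed

text \<open>Closure under uniform limits on the circle serves to reach roots of modulus 1.\<close>

lemma has_balanced_factors_limit:
  assumes "\<And>e. e > 0 \<Longrightarrow> \<exists>c. has_balanced_factors c \<and> (\<forall>z\<in>sphere 0 1. cmod (c z - b z) \<le> e)"
  shows "has_balanced_factors b"
  unfolding has_balanced_factors_def
proof safe
  fix e :: real assume e: "e > 0"
  then obtain c where c: "has_balanced_factors c" "\<And>z. z \<in> sphere 0 1 \<Longrightarrow> cmod (c z - b z) \<le> e / 2"
    using assms[of "e / 2"] by auto
  then obtain u v where uv: "balanced_factors (e / 2) c u v"
    using e unfolding has_balanced_factors_def by (meson half_gt_zero)
  have "balanced_factors e b u v"
    unfolding balanced_factors_def
  proof (intro ballI conjI)
    fix z :: complex assume z: "z \<in> sphere 0 1"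
    note uv = uv[unfolded balanced_factors_def, rule_format, OF z]
    have "cmod (poly u z * poly v z - b z) \<le> cmod (poly u z * poly v z - c z) + cmod (c z - b z)"
      by (rule norm_diff_triangle_le) auto
    then show "cmod (poly u z * poly v z - b z) \<le> e" using uv c(2)[OF z] by linarith
    have "\<bar>cmod (c z) - cmod (b z)\<bar> \<le> cmod (c z - b z)" by (rule norm_triangle_ineq3)
    then show "\<bar>(cmod (poly u z))\<^sup>2 - cmod (b z)\<bar> \<le> e" "\<bar>(cmod (poly v z))\<^sup>2 - cmod (b z)\<bar> \<le> e"
      using uv c(2)[OF z] by linarith+
  qed
  then show "\<exists>u v. balanced_factors e b u v" by blast
qed

text \<open>Exact factors that are analytic across the circle are replaced by Taylor polynomials,
  uniformly close to them on the closed disc.\<close>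

lemma has_balanced_factors_holomorphic:
  assumes R: "R > 1" and u: "u holomorphic_on ball 0 R" and v: "v holomorphic_on ball 0 R"
    and uv: "\<And>z. z \<in> sphere 0 1 \<Longrightarrow> u z * v z = b z"
      "\<And>z. z \<in> sphere 0 1 \<Longrightarrow> (cmod (u z))\<^sup>2 = cmod (b z)"
      "\<And>z. z \<in> sphere 0 1 \<Longrightarrow> (cmod (v z))\<^sup>2 = cmod (b z)"
  shows "has_balanced_factors b"
  unfolding has_balanced_factors_def
proof safe
  fix e :: real assume e: "e > 0"
  have sub: "sphere 0 1 \<subseteq> ball (0 :: complex) R" using R by auto
  obtain B1 where B1: "\<And>z. z \<in> sphere 0 1 \<Longrightarrow> cmod (u z) \<le> B1" "B1 \<ge> 0"
    using bounded_on_sphereE[OF holomorphic_on_imp_continuous_on[OF holomorphic_on_subset[OF u sub]]] by metis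
  obtain B2 where B2: "\<And>z. z \<in> sphere 0 1 \<Longrightarrow> cmod (v z) \<le> B2" "B2 \<ge> 0"
    using bounded_on_sphereE[OF holomorphic_on_imp_continuous_on[OF holomorphic_on_subset[OF v sub]]] by metis
  define B where "B = max B1 B2"
  have B: "cmod (u z) \<le> B" "cmod (v z) \<le> B" if "z \<in> sphere 0 1" for z
    using B1(1)[OF that] B2(1)[OF that] by (auto simp: B_def)
  have "2 * B + 1 \<ge> 0" using B1 by (auto simp: B_def)
  with e obtain \<delta> where \<delta>: "\<delta> > 0" "\<delta> \<le> 1" "\<delta> * (2 * B + 1) \<le> e"
    using small_multiple by blast
  obtain p where p: "\<And>z. z \<in> cball 0 1 \<Longrightarrow> cmod (u z - poly p z) < \<delta>"
    using holomorphic_poly_approx[OF u R \<delta>(1)] by blast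
  obtain q where q: "\<And>z. z \<in> cball 0 1 \<Longrightarrow> cmod (v z - poly q z) < \<delta>"
    using holomorphic_poly_approx[OF v R \<delta>(1)] by blast
  have "balanced_factors (\<delta> * (2 * B + 1)) b p q"
    unfolding balanced_factors_def
  proof (intro ballI conjI)
    fix z :: complex assume z: "z \<in> sphere 0 1"
    have pu: "cmod (poly p z - u z) \<le> \<delta>" and qv: "cmod (poly q z - v z) \<le> \<delta>"
      using p[of z] q[of z] z by (auto simp: norm_minus_commute less_imp_le)
    show "cmod (poly p z * poly q z - b z) \<le> \<delta> * (2 * B + 1)"
      unfolding uv(1)[OF z, symmetric] using pu qv B[OF z] \<delta> by (intro norm_mult_diff_le) auto
    have "\<bar>cmod (poly p z) - cmod (u z)\<bar> \<le> \<delta>" "\<bar>cmod (poly q z) - cmod (v z)\<bar> \<le> \<delta>"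
      using pu qv norm_triangle_ineq3 order_trans by blast+
    then have "norm (cmod (poly p z) * cmod (poly p z) - cmod (u z) * cmod (u z)) \<le> \<delta> * (2 * B + 1)"
      "norm (cmod (poly q z) * cmod (poly q z) - cmod (v z) * cmod (v z)) \<le> \<delta> * (2 * B + 1)"
      using B[OF z] \<delta> by (intro norm_mult_diff_le; auto)+
    then show "\<bar>(cmod (poly p z))\<^sup>2 - cmod (b z)\<bar> \<le> \<delta> * (2 * B + 1)"
      "\<bar>(cmod (poly q z))\<^sup>2 - cmod (b z)\<bar> \<le> \<delta> * (2 * B + 1)"
      using uv(2,3)[OF z] by (simp_all add: power2_eq_square)
  qed
  then have "balanced_factors e b p q"
    unfolding balanced_factors_def using \<delta>(3) by force
  then show "\<exists>u v. balanced_factors e b u v" by blast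
qed

lemma one_minus_not_nonpos: "cmod w < 1 \<Longrightarrow> 1 - w \<notin> \<real>\<^sub>\<le>\<^sub>0"
  using complex_Re_le_cmod[of w] by (auto simp: complex_nonpos_Reals_iff)

lemma csqrt_mult_self: "csqrt z * csqrt z = z"
  using power2_csqrt[of z] by (simp only: power2_eq_square)

lemma cmod_csqrt: "(cmod (csqrt z))\<^sup>2 = cmod z"
  by (simp only: norm_power[symmetric] power2_csqrt)

lemma has_balanced_factors_const: "has_balanced_factors (\<lambda>z. a)"
  by (rule has_balanced_factors_holomorphic[where R = 2 and u = "\<lambda>_. csqrt a" and v = "\<lambda>_. csqrt a"])
    (simp_all add: csqrt_mult_self cmod_csqrt)

text \<open>A function without zeros in a disc larger than the unit disc has an analytic square root
  there, which serves as both factors.\<close>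

lemma has_balanced_factors_root_outside:
  assumes a: "cmod a > 1"
  shows "has_balanced_factors (\<lambda>z. a - z)"
proof (rule has_balanced_factors_holomorphic)
  \<comment> \<open>For \<open>|z| < |a|\<close> the number \<open>1 - z / a\<close> has positive
    real part and stays off the branch cut of \<open>csqrt\<close>, which \<open>a - z\<close>
    itself need not do.\<close>
  define u where "u z = csqrt a * csqrt (1 - z / a)" for z
  have nz: "1 - z / a \<notin> \<real>\<^sub>\<le>\<^sub>0" if "z \<in> ball 0 (cmod a)" for z
    using that a by (intro one_minus_not_nonpos) (auto simp: norm_divide divide_less_eq)
  show "1 < cmod a" by (rule a)
  show "u holomorphic_on ball 0 (cmod a)"
    unfolding u_def using a by (intro holomorphic_intros nz) auto
  then show "u holomorphic_on ball 0 (cmod a)" .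
  have sq: "u z * u z = a - z" for z
  proof -
    have "u z * u z = (csqrt a * csqrt a) * (csqrt (1 - z / a) * csqrt (1 - z / a))"
      by (simp only: u_def mult_ac)
    also have "\<dots> = a * (1 - z / a)"
      by (simp only: csqrt_mult_self)
    also have "\<dots> = a - z" using a by (cases "a = 0") (simp_all add: right_diff_distrib)
    finally show ?thesis .
  qed
  show "u z * u z = a - z" for z by (rule sq)
  show "(cmod (u z))\<^sup>2 = cmod (a - z)" for z
    unfolding sq[of z, symmetric] by (simp add: norm_mult power2_eq_square)
  then show "(cmod (u z))\<^sup>2 = cmod (a - z)" for z .
qed

text \<open>For a root inside the disc the Blaschke factor goes into one of the two factors.\<close>

lemma has_balanced_factors_root_inside:
  assumes a: "cmod a < 1"
  shows "has_balanced_factors (\<lambda>z. a - z)"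
proof -
  obtain R where R: "R > 1" "R * cmod a < 1"
  proof (cases "a = 0")
    case True
    then show ?thesis by (intro that[of 2]) auto
  next
    case False
    then have "1 < 1 / cmod a" using a by (simp add: field_simps)
    then obtain R where "1 < R" "R < 1 / cmod a" using dense by blast
    then show ?thesis using False by (intro that[of R]) (auto simp: field_simps)
  qed
  \<comment> \<open>On the circle \<open>1 - cnj a * z\<close> has the same modulus as
    \<open>a - z\<close>, but it has no zero in the ball of radius \<open>R\<close>. Since
    \<open>R * |a| < 1\<close>, it also avoids the branch cut, so \<open>w\<close> is analytic; the
    other factor is \<open>(a - z) / w z\<close>.\<close>
  define w where "w z = csqrt (1 - cnj a * z)" for z
  have less: "cmod (cnj a * z) < 1" if "z \<in> ball 0 R" for z
  proof -
    have "cmod (cnj a * z) \<le> cmod a * R" using that by (auto simp: norm_mult intro!: mult_left_mono)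
    then show ?thesis using R by (simp add: mult.commute)
  qed
  have holw: "w holomorphic_on ball 0 R"
    unfolding w_def by (intro holomorphic_intros one_minus_not_nonpos less)
  have sq: "w z * w z = 1 - cnj a * z" for z
    by (simp only: w_def csqrt_mult_self)
  have nz: "w z \<noteq> 0" if "z \<in> ball 0 R" for z
    using less[OF that] by (auto simp: w_def)
  have eq: "cmod (1 - cnj a * z) = cmod (a - z)" if z: "z \<in> sphere 0 1" for z
  proof -
    \<comment> \<open>Multiplying by \<open>cnj z\<close>, of modulus 1, turns the expression into
      the conjugate of \<open>z - a\<close>, up to sign.\<close>
    have "cmod (1 - cnj a * z) = cmod (cnj z) * cmod (1 - cnj a * z)" using z by simp
    also have "\<dots> = cmod (cnj z - cnj a * (z * cnj z))"
      unfolding norm_mult[symmetric] by (simp add: algebra_simps)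
    also have "z * cnj z = 1" using z by (simp flip: complex_norm_square)
    also have "cmod (cnj z - cnj a * 1) = cmod (cnj (a - z))"
      by (simp add: norm_minus_commute)
    finally show ?thesis by (simp only: complex_mod_cnj)
  qed
  have sq': "(cmod (w z))\<^sup>2 = cmod (a - z)" if "z \<in> sphere 0 1" for z
    unfolding eq[OF that, symmetric] sq[symmetric] by (simp add: norm_mult power2_eq_square)
  have sub: "z \<in> ball 0 R" if "z \<in> sphere 0 1" for z :: complex using that R by auto
  show ?thesis
  proof (rule has_balanced_factors_holomorphic[OF R(1)])
    show "(\<lambda>z. (a - z) / w z) holomorphic_on ball 0 R"
      by (intro holomorphic_intros holw nz)
    show "w holomorphic_on ball 0 R" by (rule holw)
    show "(a - z) / w z * w z = a - z" if "z \<in> sphere 0 1" for z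
      using nz[OF sub[OF that]] by simp
    show "(cmod ((a - z) / w z))\<^sup>2 = cmod (a - z)" if "z \<in> sphere 0 1" for z
    proof -
      have "cmod (a - z) \<noteq> 0" using sq'[OF that] nz[OF sub[OF that]] by fastforce
      then show ?thesis
        using sq'[OF that] by (simp add: norm_divide power_divide power2_eq_square)
    qed
  qed (rule sq')
qed

lemma has_balanced_factors_linear: "has_balanced_factors (\<lambda>z. a - z)"
proof -
  consider "cmod a < 1" | "cmod a > 1" | "cmod a = 1" by linarith
  then show ?thesis
  proof cases
    case 3
    show ?thesis
    proof (rule has_balanced_factors_limit)
      fix e :: real assume e: "e > 0"
      \<comment> \<open>A root on the circle is pushed outside by the factor \<open>1 + e\<close>,
        which changes \<open>a - z\<close> by exactly \<open>e\<close> in modulus.\<close>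
      have "cmod (of_real (1 + e) * a) > 1" using e 3 by (simp only: norm_mult norm_of_real) simp
      then have "has_balanced_factors (\<lambda>z. of_real (1 + e) * a - z)"
        by (rule has_balanced_factors_root_outside)
      moreover have "cmod (of_real (1 + e) * a - z - (a - z)) \<le> e" for z
      proof -
        have "of_real (1 + e) * a - z - (a - z) = of_real e * a" by (simp add: algebra_simps)
        then show ?thesis using e 3 by (simp add: norm_mult)
      qed
      ultimately show "\<exists>c. has_balanced_factors c \<and> (\<forall>z\<in>sphere 0 1. cmod (c z - (a - z)) \<le> e)"
        by blast
    qed
  qed (auto intro: has_balanced_factors_root_outside has_balanced_factors_root_inside)
qed

text \<open>Induction over the roots: linear factors and constants have balanced factors, and
  products preserve them.\<close>

lemma has_balanced_factors_poly: "has_balanced_factors (poly b)"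
proof (induction b rule: poly_root_induct[where P = "\<lambda>_. True"])
  case 0
  then show ?case using has_balanced_factors_const[of 0] by (simp add: poly_0[abs_def])
next
  case (no_roots p)
  \<comment> \<open>With the trivial predicate in the induction rule this case concerns polynomials
    without any complex root.\<close>
  then have "constant (poly p)" using Fundamental_Theorem_Algebra.fundamental_theorem_of_algebra[of p] by metis
  then have "poly p = (\<lambda>z. poly p 0)" unfolding constant_def by (intro ext) metis
  then show ?case using has_balanced_factors_const[of "poly p 0"] by simp
next
  case (root a p)
  have "has_balanced_factors (\<lambda>z. (a - z) * poly p z)"
    by (intro has_balanced_factors_mult has_balanced_factors_linear root continuous_intros)
  moreover have "poly ([:a, -1:] * p) = (\<lambda>z. (a - z) * poly p z)"
    by (rule ext) (simp add: algebra_simps)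
  ultimately show ?case by (simp only:)
qed

section \<open>Density of polynomials in the Hardy space\<close>

lemma integrable_arc_length_square: "square_integrable f \<Longrightarrow> integrable arc_length (\<lambda>z. (cmod (f z))\<^sup>2)"
  by (simp add: square_integrable_def)

lemma square_integrable_bound:
  assumes "square_integrable h" "f \<in> borel_measurable borel" "\<And>z. cmod z = 1 \<Longrightarrow> cmod (f z) \<le> cmod (h z)"
  shows "square_integrable f"
  unfolding square_integrable_def
proof
  have [measurable]: "f \<in> borel_measurable arc_length"
    using assms(2) by (simp add: measurable_cong_sets[OF sets_arc_length refl])
  show "integrable arc_length (\<lambda>z. (cmod (f z))\<^sup>2)"
  proof (rule Bochner_Integration.integrable_bound[OF integrable_arc_length_square[OF assms(1)]])
    show "AE z in arc_length. norm ((cmod (f z))\<^sup>2) \<le> norm ((cmod (h z))\<^sup>2)"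
      using AE_arc_length by eventually_elim (simp add: assms(3) power_mono)
  qed measurable
qed (rule assms(2))

lemma square_integrable_const: "square_integrable (\<lambda>_. c)"
  using finite_measure.integrable_const[OF finite_measure_arc_length]
  by (simp add: square_integrable_def)

lemma square_integrable_continuous:
  assumes "continuous_on UNIV f"
  shows "square_integrable f"
proof -
  have "compact (f ` sphere 0 1)"
    by (intro compact_continuous_image continuous_on_subset[OF assms]) auto
  then obtain B where B: "\<And>z. cmod z = 1 \<Longrightarrow> cmod (f z) \<le> B"
    using compact_imp_bounded bounded_pos by (metis imageI mem_sphere_0)
  then have "cmod (f z) \<le> cmod (complex_of_real B)" if "cmod z = 1" for z
    using that by fastforce
  then show ?thesis
    by (rule square_integrable_bound[OF square_integrable_const borel_measurable_continuous_onI[OF assms]])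
qed

lemma square_integrable_diff:
  "square_integrable f \<Longrightarrow> square_integrable g \<Longrightarrow> square_integrable (\<lambda>z. f z - g z)"
  using square_integrable_add[OF _ square_integrable_scale[of g "-1"], of f] by simp

lemma cmod_add_square_le: "(cmod (x + y))\<^sup>2 \<le> 2 * (cmod x)\<^sup>2 + 2 * (cmod y)\<^sup>2"
proof -
  have "(cmod (x + y))\<^sup>2 \<le> (cmod x + cmod y)\<^sup>2"
    by (intro power_mono norm_triangle_ineq) simp
  also have "\<dots> \<le> 2 * (cmod x)\<^sup>2 + 2 * (cmod y)\<^sup>2"
    using sum_squares_bound[of "cmod x" "cmod y"] by (simp add: power2_sum)
  finally show ?thesis .
qed

lemma integral_cmod_add_square_le:
  assumes "square_integrable f" "square_integrable g"
  shows "(LINT z|arc_length. (cmod (f z + g z))\<^sup>2) \<le>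
    2 * (LINT z|arc_length. (cmod (f z))\<^sup>2) + 2 * (LINT z|arc_length. (cmod (g z))\<^sup>2)"
proof -
  have "(LINT z|arc_length. (cmod (f z + g z))\<^sup>2) \<le> (LINT z|arc_length. 2 * (cmod (f z))\<^sup>2 + 2 * (cmod (g z))\<^sup>2)"
    using assms by (intro integral_mono integrable_arc_length_square square_integrable_add
        Bochner_Integration.integrable_add integrable_mult_right cmod_add_square_le)
  also have "\<dots> = 2 * (LINT z|arc_length. (cmod (f z))\<^sup>2) + 2 * (LINT z|arc_length. (cmod (g z))\<^sup>2)"
    using assms by (simp add: integrable_arc_length_square)
  finally show ?thesis .
qed

lemma square_integrable_polynomial_function:
  "polynomial_function (t :: complex \<Rightarrow> complex) \<Longrightarrow> square_integrable t"
  by (intro square_integrable_continuous continuous_on_polymonial_function)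

text \<open>Here \<open>polynomial_function\<close> means polynomial in \<open>Re z\<close> and
  \<open>Im z\<close>. This class is rich enough for the Stone-Weierstrass theorem; analytic
  polynomials alone are not dense in L2 of the circle.\<close>

definition polynomially_approximable :: "(complex \<Rightarrow> complex) \<Rightarrow> bool"
  where "polynomially_approximable f \<longleftrightarrow> square_integrable f \<and>
    (\<forall>e>0. \<exists>t. polynomial_function t \<and> (LINT z|arc_length. (cmod (f z - t z))\<^sup>2) < e)"

lemma polynomially_approximable_add:
  assumes "polynomially_approximable f" "polynomially_approximable g"
  shows "polynomially_approximable (\<lambda>z. f z + g z)"
  unfolding polynomially_approximable_def
proof safe
  have sf: "square_integrable f" and sg: "square_integrable g"
    using assms by (auto simp: polynomially_approximable_def)
  then show "square_integrable (\<lambda>z. f z + g z)" by (rule square_integrable_add)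
  fix e :: real assume e: "e > 0"
  \<comment> \<open>A quarter of \<open>e\<close> for each, since
    \<open>integral_cmod_add_square_le\<close> doubles both errors.\<close>
  obtain s where s: "polynomial_function s" "(LINT z|arc_length. (cmod (f z - s z))\<^sup>2) < e / 4"
    using assms(1) e unfolding polynomially_approximable_def by (meson divide_pos_pos zero_less_numeral)
  obtain t where t: "polynomial_function t" "(LINT z|arc_length. (cmod (g z - t z))\<^sup>2) < e / 4"
    using assms(2) e unfolding polynomially_approximable_def by (meson divide_pos_pos zero_less_numeral)
  have "(LINT z|arc_length. (cmod ((f z - s z) + (g z - t z)))\<^sup>2) < e"
    using integral_cmod_add_square_le[OF square_integrable_diff[OF sf square_integrable_polynomial_function[OF s(1)]]
        square_integrable_diff[OF sg square_integrable_polynomial_function[OF t(1)]]] s(2) t(2) by linarith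
  moreover have "(f z - s z) + (g z - t z) = f z + g z - (s z + t z)" for z by simp
  ultimately show "\<exists>t. polynomial_function t \<and> (LINT z|arc_length. (cmod (f z + g z - t z))\<^sup>2) < e"
    using polynomial_function_add[OF s(1) t(1)] by (auto simp only:)
qed

lemma polynomial_function_cmult:
  assumes "polynomial_function t"
  shows "polynomial_function (\<lambda>z. c * t z :: complex)"
  unfolding polynomial_function_def
proof safe
  fix h :: "complex \<Rightarrow> real" assume "bounded_linear h"
  then have "bounded_linear (\<lambda>x. h (c * x))"
    by (rule bounded_linear_compose[OF _ bounded_linear_mult_right])
  then have "real_polynomial_function ((\<lambda>x. h (c * x)) \<circ> t)"
    using assms unfolding polynomial_function_def by blast
  then show "real_polynomial_function (h \<circ> (\<lambda>z. c * t z))" by (simp add: o_def)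
qed

lemma polynomially_approximable_scale:
  assumes "polynomially_approximable f"
  shows "polynomially_approximable (\<lambda>z. c * f z)"
proof (cases "c = 0")
  case True
  then show ?thesis
    by (auto simp: polynomially_approximable_def square_integrable_zero intro: exI[of _ "\<lambda>_. 0"])
next
  case False
  show ?thesis
    unfolding polynomially_approximable_def
  proof safe
    show "square_integrable (\<lambda>z. c * f z)"
      using assms by (simp add: polynomially_approximable_def square_integrable_scale)
    fix e :: real assume e: "e > 0"
    have "e / (cmod c)\<^sup>2 > 0" using e False by simp
    then obtain t where t: "polynomial_function t" "(LINT z|arc_length. (cmod (f z - t z))\<^sup>2) < e / (cmod c)\<^sup>2"
      using assms unfolding polynomially_approximable_def by blast
    have "(LINT z|arc_length. (cmod (c * f z - c * t z))\<^sup>2) = (cmod c)\<^sup>2 * (LINT z|arc_length. (cmod (f z - t z))\<^sup>2)"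
      by (simp add: norm_mult power_mult_distrib flip: right_diff_distrib)
    also have "\<dots> < (cmod c)\<^sup>2 * (e / (cmod c)\<^sup>2)"
      using t(2) False by (intro mult_strict_left_mono) auto
    also have "\<dots> = e" using False by simp
    finally show "\<exists>t. polynomial_function t \<and> (LINT z|arc_length. (cmod (c * f z - t z))\<^sup>2) < e"
      using polynomial_function_cmult[OF t(1)] by blast
  qed
qed

lemma polynomially_approximable_zero: "polynomially_approximable (\<lambda>_. 0)"
  by (auto simp: polynomially_approximable_def square_integrable_zero intro: exI[of _ "\<lambda>_. 0"])

lemma polynomially_approximable_sum:
  "(\<And>i. i \<in> I \<Longrightarrow> polynomially_approximable (f i)) \<Longrightarrow> polynomially_approximable (\<lambda>z. \<Sum>i\<in>I. f i z)"
  by (induction I rule: infinite_finite_induct)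
    (auto intro: polynomially_approximable_zero polynomially_approximable_add)

text \<open>Dominated convergence, with majorant \<open>4 * |h|^2\<close>, makes some
  \<open>s n\<close> close to \<open>f\<close> in L2; a polynomial function close to
  \<open>s n\<close> is then close to \<open>f\<close>.\<close>

lemma polynomially_approximable_limit:
  assumes s: "\<And>n. polynomially_approximable (s n)" and f: "f \<in> borel_measurable borel"
    and lim: "\<And>z. (\<lambda>n. s n z) \<longlonglongrightarrow> f z"
    and h: "square_integrable h" and bd: "\<And>n z. cmod (s n z) \<le> cmod (h z)"
  shows "polynomially_approximable f"
  unfolding polynomially_approximable_def
proof safe
  have le: "cmod (f z) \<le> cmod (h z)" for z
    using lim by (rule LIMSEQ_le_const2[OF tendsto_norm]) (auto intro: bd)
  show sf: "square_integrable f"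
    using h f le by (rule square_integrable_bound)
  have ss: "square_integrable (s n)" for n
    using s by (simp add: polynomially_approximable_def)
  note [measurable] = square_integrable_measurable(1)[OF sf] square_integrable_measurable(1)[OF ss]
  fix e :: real assume e: "e > 0"
  have "(\<lambda>n. LINT z|arc_length. (cmod (f z - s n z))\<^sup>2) \<longlonglongrightarrow> (LINT z|arc_length. 0)"
  proof (rule integral_dominated_convergence[where w = "\<lambda>z. 4 * (cmod (h z))\<^sup>2"])
    show "integrable arc_length (\<lambda>z. 4 * (cmod (h z))\<^sup>2)"
      by (intro integrable_mult_right integrable_arc_length_square h)
    show "AE z in arc_length. (\<lambda>n. (cmod (f z - s n z))\<^sup>2) \<longlonglongrightarrow> 0"
    proof (rule AE_I2)
      fix z
      have "(\<lambda>n. (cmod (f z - s n z))\<^sup>2) \<longlonglongrightarrow> (cmod (f z - f z))\<^sup>2"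
        by (intro tendsto_intros lim)
      then show "(\<lambda>n. (cmod (f z - s n z))\<^sup>2) \<longlonglongrightarrow> 0" by simp
    qed
    show "AE z in arc_length. norm ((cmod (f z - s n z))\<^sup>2) \<le> 4 * (cmod (h z))\<^sup>2" for n
    proof (rule AE_I2)
      fix z
      have "cmod (f z - s n z) \<le> 2 * cmod (h z)"
        using norm_triangle_ineq4[of "f z" "s n z"] le[of z] bd[of n z] by linarith
      then have "(cmod (f z - s n z))\<^sup>2 \<le> (2 * cmod (h z))\<^sup>2" by (rule power_mono) simp
      then show "norm ((cmod (f z - s n z))\<^sup>2) \<le> 4 * (cmod (h z))\<^sup>2" by (simp add: power_mult_distrib)
    qed
  qed measurable
  then have "(\<lambda>n. LINT z|arc_length. (cmod (f z - s n z))\<^sup>2) \<longlonglongrightarrow> 0" by simp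
  then have "\<forall>\<^sub>F n in sequentially. (LINT z|arc_length. (cmod (f z - s n z))\<^sup>2) < e / 4"
    using e by (intro order_tendstoD) auto
  then obtain n where n: "(LINT z|arc_length. (cmod (f z - s n z))\<^sup>2) < e / 4"
    using eventually_happens trivial_limit_sequentially by blast
  obtain t where t: "polynomial_function t" "(LINT z|arc_length. (cmod (s n z - t z))\<^sup>2) < e / 4"
    using s[of n] e unfolding polynomially_approximable_def by (meson divide_pos_pos zero_less_numeral)
  have "(LINT z|arc_length. (cmod ((f z - s n z) + (s n z - t z)))\<^sup>2) < e"
    using integral_cmod_add_square_le[OF square_integrable_diff[OF sf ss]
        square_integrable_diff[OF ss square_integrable_polynomial_function[OF t(1)]], of n n] n t(2) by linarith
  then show "\<exists>t. polynomial_function t \<and> (LINT z|arc_length. (cmod (f z - t z))\<^sup>2) < e"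
    using t(1) by auto
qed

lemma integral_arc_length_le:
  assumes "integrable arc_length f" "\<And>z. cmod z = 1 \<Longrightarrow> f z \<le> (c::real)"
  shows "(LINT z|arc_length. f z) \<le> c"
proof -
  have "(LINT z|arc_length. f z) \<le> (LINT z|arc_length. c)"
    using AE_arc_length assms(2) finite_measure.integrable_const[OF finite_measure_arc_length]
    by (intro integral_mono_AE assms(1)) (auto elim!: eventually_mono)
  also have "\<dots> = c"
    by (simp add: measure_def prob_space_arc_length)
  finally show ?thesis .
qed

lemma polynomially_approximable_continuous:
  assumes "continuous_on UNIV f"
  shows "polynomially_approximable f"
  unfolding polynomially_approximable_def
proof safe
  show sf: "square_integrable f" using assms by (rule square_integrable_continuous)
  fix e :: real assume e: "e > 0"
  \<comment> \<open>A uniform error of \<open>sqrt (e / 2)\<close> gives a squared L2 error of at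
    most \<open>e / 2\<close>, since arc length has total mass 1.\<close>
  define \<delta> where "\<delta> = sqrt (e / 2)"
  have "\<delta> > 0" using e by (simp add: \<delta>_def)
  then obtain t where t: "polynomial_function t" "\<And>z. z \<in> sphere 0 1 \<Longrightarrow> cmod (f z - t z) < \<delta>"
    using Stone_Weierstrass_polynomial_function[OF compact_sphere continuous_on_subset[OF assms], of 0 1 \<delta>]
    by auto
  have "(LINT z|arc_length. (cmod (f z - t z))\<^sup>2) \<le> \<delta>\<^sup>2"
  proof (rule integral_arc_length_le)
    show "integrable arc_length (\<lambda>z. (cmod (f z - t z))\<^sup>2)"
      by (intro integrable_arc_length_square square_integrable_diff sf square_integrable_polynomial_function t)
    show "(cmod (f z - t z))\<^sup>2 \<le> \<delta>\<^sup>2" if "cmod z = 1" for z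
      using t(2)[of z] that by (intro power_mono) auto
  qed
  also have "\<dots> < e" using e by (simp add: \<delta>_def)
  finally show "\<exists>t. polynomial_function t \<and> (LINT z|arc_length. (cmod (f z - t z))\<^sup>2) < e"
    using t(1) by blast
qed

lemma polynomially_approximable_indicator_closed:
  assumes C: "closed C"
  shows "polynomially_approximable (indicator C)"
\<comment> \<open>The distance to the empty set is 0 by convention, so the functions
  \<open>s n\<close> below would be constantly 1 for it.\<close>
proof (cases "C = {}")
  case False
  define s where "s n z = complex_of_real (max 0 (1 - real n * infdist z C))" for n z
  show ?thesis
  proof (rule polynomially_approximable_limit)
    show "polynomially_approximable (s n)" for n
      unfolding s_def by (intro polynomially_approximable_continuous continuous_intros)
    show "indicator C \<in> borel_measurable borel" using C by (intro borel_measurable_indicator borel_closed)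
    show "square_integrable (\<lambda>_. 1)" by (rule square_integrable_const)
    show "cmod (s n z) \<le> cmod 1" for n z
      by (auto simp: s_def infdist_nonneg)
    show "(\<lambda>n. s n z) \<longlonglongrightarrow> indicator C z" for z
    proof (cases "z \<in> C")
      case True
      then show ?thesis by (simp add: s_def)
    next
      case False
      then have pos: "infdist z C > 0"
        using C \<open>C \<noteq> {}\<close> in_closed_iff_infdist_zero infdist_nonneg by (metis less_eq_real_def)
      obtain N where N: "1 < real N * infdist z C"
        using reals_Archimedean3[OF pos] by blast
      have "s n z = 0" if "n \<ge> N" for n
      proof -
        have "real N * infdist z C \<le> real n * infdist z C"
          using that pos by (intro mult_right_mono) auto
        then show ?thesis using N by (simp add: s_def)
      qed
      then have "\<forall>\<^sub>F n in sequentially. s n z = indicator C z"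
        using False by (auto simp: eventually_sequentially)
      then show ?thesis by (rule tendsto_eventually)
    qed
  qed
qed (use polynomially_approximable_zero in \<open>simp add: indicator_def[abs_def]\<close>)

text \<open>Dynkin's argument: the closed sets are stable under intersection and generate the Borel
  sets, and approximability passes to complements and to countable disjoint unions.\<close>

lemma polynomially_approximable_indicator:
  assumes "A \<in> sets borel"
  shows "polynomially_approximable (indicator A)"
proof -
  have borel: "sets borel = sigma_sets UNIV (Collect closed)"
    by (subst borel_eq_closed) auto
  have "Int_stable (Collect closed)" by (auto simp: Int_stable_def)
  moreover have "Collect closed \<subseteq> Pow (UNIV :: complex set)" by simp
  moreover have "A \<in> sigma_sets UNIV (Collect closed)" using assms by (simp add: borel)
  ultimately show ?thesis
  proof (induction A rule: sigma_sets_induct_disjoint)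
    case (basic A)
    then show ?case by (simp add: polynomially_approximable_indicator_closed)
  next
    case (compl A)
    have "polynomially_approximable (\<lambda>z. 1 + (-1) * indicator A z)"
      by (intro polynomially_approximable_add polynomially_approximable_scale compl
          polynomially_approximable_continuous continuous_intros)
    moreover have "indicator (UNIV - A) = (\<lambda>z. 1 + (-1) * indicator A z :: complex)"
      by (auto simp: indicator_def)
    ultimately show ?case by simp
  next
    case (union A)
    \<comment> \<open>Disjointness makes the indicators of the partial unions add up; these unions
      increase to the full union, with majorant 1.\<close>
    have U: "polynomially_approximable (indicator (\<Union>i<n. A i))" for n
    proof (induction n)
      case (Suc n)
      have "indicator (\<Union>i<Suc n. A i) = (\<lambda>z. indicator (\<Union>i<n. A i) z + indicator (A n) z :: complex)"
      proof
        fix z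
        have "A i \<inter> A n = {}" if "i < n" for i
          using disjoint_family_onD[OF union(1), of i n] that by simp
        then have disj: "(\<Union>i<n. A i) \<inter> A n = {}" by blast
        show "indicator (\<Union>i<Suc n. A i) z = (indicator (\<Union>i<n. A i) z + indicator (A n) z :: complex)"
          by (subst indicator_add[OF disj]) (simp add: lessThan_Suc Un_commute)
      qed
      then show ?case
        using polynomially_approximable_add[OF Suc.IH union.IH(1)[of n]] by simp
    qed (use polynomially_approximable_zero in \<open>simp add: indicator_def[abs_def]\<close>)
    have "range A \<subseteq> sets borel" using union by (simp add: borel)
    then have "(\<Union>i. A i) \<in> sets borel" by blast
    then have "(indicator (\<Union>i. A i) :: complex \<Rightarrow> complex) \<in> borel_measurable borel" by measurable
    then show ?case
    proof (rule polynomially_approximable_limit[OF U])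
      show "square_integrable (\<lambda>_. 1)" by (rule square_integrable_const)
    qed (rule LIMSEQ_indicator_UN, simp add: indicator_def)
  qed (use polynomially_approximable_zero in \<open>auto simp: indicator_def[abs_def]\<close>)
qed

text \<open>\<open>f\<close> is a pointwise limit of simple functions dominated by
  \<open>2 * |f|\<close>, and each simple function is a finite combination of Borel
  indicators.\<close>

lemma square_integrable_imp_polynomially_approximable:
  assumes f: "square_integrable f"
  shows "polynomially_approximable f"
proof -
  obtain s where s: "\<And>i. simple_function borel (s i)" "\<And>z. (\<lambda>i. s i z) \<longlonglongrightarrow> f z"
    "\<And>i z. cmod (s i z) \<le> 2 * cmod (f z)"
    using borel_measurable_implies_sequence_metric[OF square_integrable_measurable(2)[OF f], of 0]
    by simp metis
  show ?thesis
  proof (rule polynomially_approximable_limit[OF _ square_integrable_measurable(2)[OF f] s(2)])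
    fix i
    have "s i = (\<lambda>z. \<Sum>y\<in>range (s i). y * indicator (s i -` {y}) z)"
    proof
      fix z
      have "s i z = (\<Sum>y\<in>s i ` space borel. indicator (s i -` {y} \<inter> space borel) z *\<^sub>R y)"
        by (rule simple_function_indicator_representation_banach[OF s(1)]) simp
      also have "\<dots> = (\<Sum>y\<in>range (s i). y * indicator (s i -` {y}) z)"
        by (intro sum.cong) (simp_all add: indicator_def)
      finally show "s i z = (\<Sum>y\<in>range (s i). y * indicator (s i -` {y}) z)" .
    qed
    moreover have "polynomially_approximable (\<lambda>z. \<Sum>y\<in>range (s i). y * indicator (s i -` {y}) z)"
      using simple_functionD(2)[OF s(1), of i]
      by (intro polynomially_approximable_sum polynomially_approximable_scale polynomially_approximable_indicator) simp
    ultimately show "polynomially_approximable (s i)" by (simp only:)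
  next
    show "square_integrable (\<lambda>z. 2 * f z)" using f by (rule square_integrable_scale)
    show "cmod (s n z) \<le> cmod (2 * f z)" for n z using s(3) by (simp add: norm_mult)
  qed
qed

section \<open>Trigonometric polynomials and their analytic parts\<close>

lemma real_polynomial_function_circle:
  fixes h :: "complex \<Rightarrow> real"
  assumes "real_polynomial_function h"
  shows "\<exists>N P. \<forall>z. cmod z = 1 \<longrightarrow> of_real (h z) = cnj z ^ N * poly P z"
  using assms
proof induction
  case (linear h)
  \<comment> \<open>A real-linear \<open>h\<close> has the form \<open>a * z + cnj a * cnj z\<close>
    with this \<open>a\<close>. Taking out \<open>cnj z\<close> on the circle, where
    \<open>cnj z * z = 1\<close>, leaves \<open>cnj a + a * z^2\<close>.\<close>
  define a where "a = (of_real (h 1) - \<i> * of_real (h \<i>)) / 2"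
  have "of_real (h z) = cnj z ^ 1 * poly [:cnj a, 0, a:] z" if z: "cmod z = 1" for z
  proof -
    have zz: "cnj z * z = 1" using z by (metis complex_norm_square mult.commute of_real_1 power_one)
    have "h z = h (Re z *\<^sub>R 1 + Im z *\<^sub>R \<i>)" by (rule arg_cong[of _ _ h]) (simp add: complex_eq_iff)
    also have "\<dots> = Re z * h 1 + Im z * h \<i>"
      using linear by (simp only: linear_simps bounded_linear.linear linear_add linear_scale real_scaleR_def)
    finally have "h z = Re z * h 1 + Im z * h \<i>" .
    then have "of_real (h z) = cnj z * cnj a + a * z"
      by (simp add: a_def complex_eq_iff field_simps)
    also have "\<dots> = cnj z * cnj a + (cnj z * z) * (a * z)" by (simp only: zz mult_1)
    also have "\<dots> = cnj z ^ 1 * poly [:cnj a, 0, a:] z" by (simp add: algebra_simps)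
    finally show ?thesis .
  qed
  then show ?case by blast
next
  case (const c)
  have "of_real c = cnj z ^ 0 * poly [:of_real c:] z" for z by simp
  then show ?case by blast
next
  case (add f g)
  then obtain N P M Q where f: "\<And>z. cmod z = 1 \<Longrightarrow> of_real (f z) = cnj z ^ N * poly P z"
    and g: "\<And>z. cmod z = 1 \<Longrightarrow> of_real (g z) = cnj z ^ M * poly Q z"
    by blast
  \<comment> \<open>The summands are brought to the common power \<open>cnj z ^ (N + M)\<close> by
    means of \<open>cnj z ^ k * z ^ k = 1\<close>.\<close>
  have "of_real (f z + g z) = cnj z ^ (N + M) * poly (monom 1 M * P + monom 1 N * Q) z" if z: "cmod z = 1" for z
  proof -
    have "cnj z * z = 1" using z by (metis complex_norm_square mult.commute of_real_1 power_one)
    then have zz: "cnj z ^ k * z ^ k = 1" for k by (simp flip: power_mult_distrib)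
    have "cnj z ^ (N + M) * poly (monom 1 M * P + monom 1 N * Q) z =
        (cnj z ^ M * z ^ M) * (cnj z ^ N * poly P z) + (cnj z ^ N * z ^ N) * (cnj z ^ M * poly Q z)"
      by (simp add: poly_monom power_add algebra_simps)
    then show ?thesis by (simp only: zz f[OF z] g[OF z] of_real_add mult_1)
  qed
  then show ?case by blast
next
  case (mult f g)
  then obtain N P M Q where f: "\<And>z. cmod z = 1 \<Longrightarrow> of_real (f z) = cnj z ^ N * poly P z"
    and g: "\<And>z. cmod z = 1 \<Longrightarrow> of_real (g z) = cnj z ^ M * poly Q z"
    by blast
  have "of_real (f z * g z) = cnj z ^ (N + M) * poly (P * Q) z" if z: "cmod z = 1" for z
    by (simp add: f[OF z] g[OF z] power_add mult_ac)
  then show ?case by blast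
qed

lemma polynomial_function_circle:
  fixes t :: "complex \<Rightarrow> complex"
  assumes "polynomial_function t"
  shows "\<exists>N P. \<forall>z. cmod z = 1 \<longrightarrow> t z = cnj z ^ N * poly P z"
proof -
  have "real_polynomial_function (Re \<circ> t)" "real_polynomial_function (Im \<circ> t)"
    using assms bounded_linear_Re bounded_linear_Im unfolding polynomial_function_def by blast+
  from this[THEN real_polynomial_function_circle]
  obtain N P M Q where f: "\<And>z. cmod z = 1 \<Longrightarrow> of_real (Re (t z)) = cnj z ^ N * poly P z"
    and g: "\<And>z. cmod z = 1 \<Longrightarrow> of_real (Im (t z)) = cnj z ^ M * poly Q z"
    by auto
  have "t z = cnj z ^ (N + M) * poly (monom 1 M * P + monom \<i> N * Q) z" if z: "cmod z = 1" for z
  proof -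
    have "cnj z * z = 1" using z by (metis complex_norm_square mult.commute of_real_1 power_one)
    then have zz: "cnj z ^ k * z ^ k = 1" for k by (simp flip: power_mult_distrib)
    have "cnj z ^ (N + M) * poly (monom 1 M * P + monom \<i> N * Q) z =
        (cnj z ^ M * z ^ M) * (cnj z ^ N * poly P z) + \<i> * ((cnj z ^ N * z ^ N) * (cnj z ^ M * poly Q z))"
      by (simp add: poly_monom power_add algebra_simps)
    also have "\<dots> = of_real (Re (t z)) + \<i> * of_real (Im (t z))"
      by (simp only: zz f[OF z] g[OF z] mult_1)
    also have "\<dots> = t z" by (rule complex_eq[symmetric])
    finally show ?thesis by simp
  qed
  then show ?thesis by blast
qed

lift_definition trig_l2 :: "nat \<Rightarrow> complex poly \<Rightarrow> l2" is "\<lambda>N P z. cnj z ^ N * poly P z"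
  by (simp add: L2_eq_def square_integrable_continuous continuous_intros)

lemma square_integrable_trig: "square_integrable (\<lambda>z. cnj z ^ N * poly P z)"
  by (intro square_integrable_continuous continuous_intros)

lemma square_integrable_poly: "square_integrable (poly P)"
  using square_integrable_trig[of 0 P] by simp

lemma square_integrable_char: "square_integrable (\<lambda>z. z powi n)"
  using l2_char.rsp unfolding rel_fun_def L2_eq_def by auto

lemma trig_l2_0: "trig_l2 0 P = poly_l2 P"
  by transfer (simp add: L2_eq_def square_integrable_poly)

text \<open>Splits off the lowest frequency: on the circle one factor \<open>cnj z\<close> cancels
  against the \<open>z\<close> in \<open>pCons\<close>, and the constant term is left at frequency
  \<open>- (N + 1)\<close>.\<close>

lemma trig_l2_pCons: "trig_l2 (Suc N) (pCons a P) = trig_l2 N P + a *\<^sub>C l2_char (- int (Suc N))"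
proof -
  have "cnj z ^ Suc N * poly (pCons a P) z = cnj z ^ N * poly P z + a * z powi - int (Suc N)"
    if z: "cmod z = 1" for z
  proof -
    have zz: "cnj z * z = 1" using z by (metis complex_norm_square mult.commute of_real_1 power_one)
    then have "cnj z = inverse z" by (metis inverse_unique mult.commute)
    then have "z powi - int (Suc N) = cnj z ^ Suc N" by (simp add: power_int_minus power_inverse del: of_nat_Suc power_Suc)
    moreover have "cnj z ^ Suc N * poly (pCons a P) z = (cnj z * z) * (cnj z ^ N * poly P z) + a * cnj z ^ Suc N"
      by (simp add: algebra_simps)
    ultimately show ?thesis by (simp only: zz mult_1)
  qed
  then have "AE z in arc_length. cnj z ^ Suc N * poly (pCons a P) z = cnj z ^ N * poly P z + a * z powi - int (Suc N)"
    using AE_arc_length by (auto elim!: eventually_mono)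
  then have "L2_eq (\<lambda>z. cnj z ^ Suc N * poly (pCons a P) z)
      (\<lambda>z. cnj z ^ N * poly P z + a * z powi - int (Suc N))"
    by (simp only: L2_eq_def square_integrable_trig square_integrable_add square_integrable_scale
        square_integrable_char simp_thms)
  moreover have refl: "L2_eq (\<lambda>z. cnj z ^ N * poly P z) (\<lambda>z. cnj z ^ N * poly P z)"
    "L2_eq (\<lambda>z. z powi - int (Suc N)) (\<lambda>z. z powi - int (Suc N))"
    "L2_eq (\<lambda>z. a * z powi - int (Suc N)) (\<lambda>z. a * z powi - int (Suc N))"
    by (simp_all only: L2_eq_def square_integrable_trig square_integrable_scale
        square_integrable_char simp_thms eventually_True)
  ultimately show ?thesis
    unfolding trig_l2.abs_eq l2_char.abs_eq scaleC_l2.abs_eq[OF refl(2)] plus_l2.abs_eq[OF refl(1,3)]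
    by (intro Quotient3_rel_abs[OF Quotient3_l2])
qed

lemma cinner_add_right: "cinner x (y + z) = cinner x y + cinner x (z :: 'a :: complex_inner)"
  by (metis cinner_add_left cinner_commute complex_cnj_add)

lemma cinner_scaleC_right: "cinner x (c *\<^sub>C y) = cnj c * cinner x (y :: 'a :: complex_inner)"
  by (metis cinner_scaleC_left cinner_commute complex_cnj_mult)

text \<open>The negative frequencies are removed one at a time by \<open>trig_l2_pCons\<close>; each
  is orthogonal to \<open>hardy\<close> by definition.\<close>

lemma trig_l2_decompose:
  "\<exists>p b. trig_l2 N P = poly_l2 p + b \<and> (\<forall>g\<in>hardy. cinner g b = 0)"
proof (induction N arbitrary: P)
  case 0
  have "cinner g (0 :: l2) = 0" for g
    using cinner_add_right[of g 0 0] by simp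
  then show ?case by (metis add_0_right trig_l2_0)
next
  case (Suc N)
  obtain a Q where P: "P = pCons a Q" by (cases P)
  obtain p b where pb: "trig_l2 N Q = poly_l2 p + b" "\<And>g. g \<in> hardy \<Longrightarrow> cinner g b = 0"
    using Suc by blast
  have "cinner g (b + a *\<^sub>C l2_char (- int (Suc N))) = 0" if "g \<in> hardy" for g
    using that pb(2)[OF that] by (simp add: cinner_add_right cinner_scaleC_right hardy_def)
  then show ?case unfolding P trig_l2_pCons pb(1) by (metis add.assoc)
qed

lemma norm_diff_abs_l2:
  assumes f: "square_integrable f" and g: "square_integrable g"
  shows "(norm (abs_l2 f - abs_l2 g))\<^sup>2 = (LINT z|arc_length. (cmod (f z - g z))\<^sup>2)"
proof -
  have fg: "L2_eq f f" "L2_eq g g" "L2_eq (\<lambda>z. f z + (-1) * g z) (\<lambda>z. f z + (-1) * g z)"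
    "L2_eq (\<lambda>z. (-1) * g z) (\<lambda>z. (-1) * g z)"
    unfolding L2_eq_def
    by (simp_all only: f g square_integrable_add square_integrable_scale simp_thms eventually_True)
  have "abs_l2 f - abs_l2 g = abs_l2 (\<lambda>z. f z + (-1) * g z)"
    unfolding minus_l2_def uminus_l2_def scaleC_l2.abs_eq[OF fg(2)] plus_l2.abs_eq[OF fg(1) fg(4)] ..
  then have "of_real ((norm (abs_l2 f - abs_l2 g))\<^sup>2) =
      (LINT z|arc_length. (f z + (-1) * g z) * cnj (f z + (-1) * g z))"
    by (simp only: cinner_self[symmetric] cinner_l2.abs_eq[OF fg(3) fg(3)])
  also have "\<dots> = (LINT z|arc_length. complex_of_real ((cmod (f z - g z))\<^sup>2))"
    by (simp only: complex_norm_square) simp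
  also have "\<dots> = of_real (LINT z|arc_length. (cmod (f z - g z))\<^sup>2)"
    by (rule integral_complex_of_real)
  finally show ?thesis by (simp only: of_real_eq_iff)
qed

lemma trig_l2_dense:
  assumes "e > 0"
  shows "\<exists>N P. norm (f - trig_l2 N P) < e"
proof -
  have f: "square_integrable (rep_l2 f)" "abs_l2 (rep_l2 f) = f"
    using Quotient3_rep_reflp[OF Quotient3_l2, of f] Quotient3_abs_rep[OF Quotient3_l2]
    by (auto simp: L2_eq_def)
  have "e\<^sup>2 > 0" using assms by simp
  then obtain t where t: "polynomial_function t" "(LINT z|arc_length. (cmod (rep_l2 f z - t z))\<^sup>2) < e\<^sup>2"
    using square_integrable_imp_polynomially_approximable[OF f(1)]
    unfolding polynomially_approximable_def by blast
  obtain N P where NP: "\<And>z. cmod z = 1 \<Longrightarrow> t z = cnj z ^ N * poly P z"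
    using polynomial_function_circle[OF t(1)] by blast
  have "L2_eq t (\<lambda>z. cnj z ^ N * poly P z)"
    unfolding L2_eq_def using AE_arc_length
    by (auto elim!: eventually_mono intro: square_integrable_polynomial_function t square_integrable_trig NP)
  then have "trig_l2 N P = abs_l2 t"
    unfolding trig_l2.abs_eq by (rule Quotient3_rel_abs[OF Quotient3_l2, symmetric])
  then have "(norm (f - trig_l2 N P))\<^sup>2 < e\<^sup>2"
    using norm_diff_abs_l2[OF f(1) square_integrable_polynomial_function[OF t(1)]] t(2) f(2) by simp
  then show ?thesis using assms power2_less_imp_less by fastforce
qed

lemma norm_le_norm_diff_orthogonal:
  fixes x y :: "'a :: real_inner"
  assumes "inner x y = 0"
  shows "norm x \<le> norm (x - y)"
proof (rule power2_le_imp_le)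
  have "(norm (x - y))\<^sup>2 = (norm x)\<^sup>2 + (norm y)\<^sup>2"
    using assms by (simp add: power2_norm_eq_inner inner_diff_left inner_diff_right inner_commute)
  then show "(norm x)\<^sup>2 \<le> (norm (x - y))\<^sup>2" by simp
qed simp

text \<open>Approximate \<open>f\<close> by a trigonometric polynomial and drop its part
  \<open>b\<close> of negative frequencies. The remaining error lies in \<open>hardy\<close>, hence
  is orthogonal to \<open>b\<close>, so by Pythagoras it does not grow.\<close>

lemma poly_l2_dense_hardy:
  assumes f: "f \<in> hardy" and e: "e > 0"
  shows "\<exists>p. norm (f - poly_l2 p) < e"
proof -
  obtain N P where NP: "norm (f - trig_l2 N P) < e" using trig_l2_dense[OF e] by blast
  obtain p b where pb: "trig_l2 N P = poly_l2 p + b" "\<And>g. g \<in> hardy \<Longrightarrow> cinner g b = 0"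
    using trig_l2_decompose by blast
  have "f - poly_l2 p \<in> hardy"
    using f poly_h2.rsp hardy_add hardy_scaleC
    unfolding minus_l2_def uminus_l2_def by (metis Rep_h2 poly_h2.rep_eq)
  then have "inner (f - poly_l2 p) b = 0"
    using pb(2) by (simp flip: Re_cinner)
  then have "norm (f - poly_l2 p) \<le> norm (f - poly_l2 p - b)"
    by (rule norm_le_norm_diff_orthogonal)
  also have "f - poly_l2 p - b = f - trig_l2 N P" by (simp add: pb)
  finally show ?thesis using NP by (meson le_less_trans)
qed

lemma poly_h2_dense: "e > 0 \<Longrightarrow> \<exists>p. norm (f - poly_h2 p) < e"
  using poly_l2_dense_hardy[of "Rep_h2 f" e] Rep_h2[of f]
  by (simp add: norm_h2.rep_eq minus_h2.rep_eq poly_h2.rep_eq)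

lemma h2_cnj_surj: "\<exists>f. x = h2_cnj f"
proof -
  obtain g where g: "g \<in> hardy" "Rep_ch2 x = l2_cnj g"
    using Rep_ch2[of x] by (auto simp: conj_hardy_def)
  then have "Rep_ch2 x = Rep_ch2 (h2_cnj (Abs_h2 g))"
    by (simp add: h2_cnj.rep_eq Abs_h2_inverse)
  then show ?thesis by (auto simp: Rep_ch2_inject)
qed

lemma h2_cnj_add: "h2_cnj (f + g) = h2_cnj f + h2_cnj g"
  by transfer (rule l2_cnj_add)

lemma h2_cnj_scaleC: "h2_cnj (c *\<^sub>C f) = cnj c *\<^sub>C h2_cnj f"
  by transfer (rule l2_cnj_scaleC)

lemma scaleC_minus1: "(-1) *\<^sub>C x = - (x :: 'a :: complex_inner)"
  using scaleC_of_real[of "-1" x] by simp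

lemma h2_cnj_diff: "h2_cnj (f - g) = h2_cnj f - h2_cnj g"
  using h2_cnj_add[of f "(-1) *\<^sub>C g"] h2_cnj_scaleC[of "-1" g] by (simp add: scaleC_minus1)

lemma cinner_h2_cnj: "cinner (h2_cnj f) (h2_cnj g) = cinner g f"
  by transfer (rule cinner_l2_cnj)

lemma norm_h2_cnj: "norm (h2_cnj f) = norm f"
  by transfer (rule norm_l2_cnj)

lemma h2_cnj_poly_dense: "e > 0 \<Longrightarrow> \<exists>p. norm (x - h2_cnj (poly_h2 p)) < e"
  using h2_cnj_surj[of x] poly_h2_dense[of e] by (metis h2_cnj_diff norm_h2_cnj)

section \<open>Shifts and Hankel operators on polynomials\<close>

lemma cinner_minus_left: "cinner (- x) y = - cinner x (y :: 'a :: complex_inner)"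
  using cinner_scaleC_left[of "-1" x y] by (simp add: scaleC_minus1)

lemma cinner_diff_left: "cinner (x - y) z = cinner x z - cinner y (z :: 'a :: complex_inner)"
  using cinner_add_left[of x "- y" z] by (simp add: cinner_minus_left)

lemma cinner_zero_left [simp]: "cinner 0 (x :: 'a :: complex_inner) = 0"
  using cinner_diff_left[of x x x] by simp

lemma cinner_diff_right: "cinner x (y - z) = cinner x y - cinner x (z :: 'a :: complex_inner)"
  by (metis cinner_diff_left cinner_commute complex_cnj_diff)

lemma cinner_scaleR_left: "cinner (a *\<^sub>R x) y = of_real a * cinner x (y :: 'a :: complex_inner)"
  by (simp add: cinner_scaleC_left flip: scaleC_of_real)

lemma cinner_scaleR_right: "cinner x (a *\<^sub>R y) = of_real a * cinner x (y :: 'a :: complex_inner)"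
  by (simp add: cinner_scaleC_right flip: scaleC_of_real)

lemma complex_Cauchy_Schwarz: "cmod (cinner x y) \<le> norm x * norm (y :: 'a :: complex_inner)"
proof (cases "cinner x y = 0")
  case False
  \<comment> \<open>The phase that makes the inner product real and nonnegative reduces the claim to
    the real inequality.\<close>
  define c where "c = cnj (cinner x y) / of_real (cmod (cinner x y))"
  have c: "cmod c = 1" using False by (simp add: c_def norm_divide)
  have "c * cinner x y = of_real ((cmod (cinner x y))\<^sup>2) / of_real (cmod (cinner x y))"
    unfolding c_def complex_norm_square by (simp add: mult.commute)
  also have "\<dots> = of_real (cmod (cinner x y))"
    using False by (simp add: power2_eq_square)
  finally have "cmod (cinner x y) = inner (c *\<^sub>C x) y"
    by (simp add: cinner_scaleC_left flip: Re_cinner)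
  also have "\<dots> \<le> norm (c *\<^sub>C x) * norm y" by (rule norm_cauchy_schwarz)
  finally show ?thesis by (simp add: norm_scaleC c)
qed simp

lemma cinner_ext:
  assumes "\<And>x. cinner x y = cinner x (z :: 'a :: complex_inner)"
  shows "y = z"
proof -
  have "inner (y - z) (y - z) = Re (cinner (y - z) y - cinner (y - z) z)"
    by (simp add: Re_cinner inner_diff_right)
  then show ?thesis using assms by simp
qed

text \<open>The description in \<open>hadjoint\<close> is proper once an adjoint exists.
  \<open>complex_inner\<close> does not include completeness, so representing vectors are assumed;
  uniqueness makes them depend linearly on \<open>y\<close>, and Cauchy-Schwarz bounds them.\<close>

lemma cinner_hadjoint:
  fixes A :: "'a::complex_inner \<Rightarrow>\<^sub>L 'b::complex_inner"
  assumes "\<And>y. \<exists>w. \<forall>x. cinner (A x) y = cinner x w"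
  shows "cinner (A x) y = cinner x (hadjoint A y)"
proof -
  obtain f where f: "\<And>x y. cinner (A x) y = cinner x (f y)" using assms by metis
  have "bounded_linear f"
  proof (rule bounded_linear_intro[where K = "norm A"])
    show "f (y + z) = f y + f z" for y z
      by (rule cinner_ext) (simp only: f[symmetric] cinner_add_right)
    show "f (a *\<^sub>R y) = a *\<^sub>R f y" for a y
      by (rule cinner_ext) (simp only: f[symmetric] cinner_scaleR_right)
    show "norm (f y) \<le> norm y * norm A" for y
    proof (cases "f y = 0")
      case False
      \<comment> \<open>The representing relation is tested at the vector \<open>f y\<close>
        itself.\<close>
      have "norm (f y) * norm (f y) = cmod (cinner (f y) (f y))"
        by (simp add: cinner_self power2_eq_square norm_mult)
      also have "\<dots> = cmod (cinner (A (f y)) y)" by (simp only: f)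
      also have "\<dots> \<le> norm (A (f y)) * norm y" by (rule complex_Cauchy_Schwarz)
      also have "\<dots> \<le> (norm A * norm (f y)) * norm y" by (intro mult_right_mono norm_blinfun) simp
      finally have "norm (f y) * norm (f y) \<le> norm (f y) * (norm y * norm A)" by (simp add: mult_ac)
      then show ?thesis using False by simp
    qed simp
  qed
  then have *: "\<forall>x y. cinner (A x) y = cinner x (Blinfun f y)"
    by (simp add: bounded_linear_Blinfun_apply f)
  have "\<forall>x y. cinner (A x) y = cinner x (hadjoint A y)"
    unfolding hadjoint_def
  proof (rule theI, rule *)
    fix B assume B: "\<forall>x y. cinner (A x) y = cinner x (blinfun_apply B y)"
    show "B = Blinfun f"
    proof (rule blinfun_eqI)
      fix y
      show "blinfun_apply B y = Blinfun f y"
        by (rule cinner_ext) (use B * in metis)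
    qed
  qed
  then show ?thesis by blast
qed

section \<open>The shifts and the adjoint of the conjugate shift\<close>

lemma l2_mult_zeta_mult_cnj_zeta: "l2_mult_zeta (l2_mult_cnj_zeta f) = f"
proof transfer
  fix f assume f: "L2_eq f f"
  have "AE z in arc_length. z * (cnj z * f z) = f z"
    using AE_arc_length
  proof eventually_elim
    case (elim z)
    then have "z * cnj z = 1" by (simp flip: complex_norm_square)
    then show ?case by (simp flip: mult.assoc)
  qed
  then show "L2_eq (\<lambda>z. z * (cnj z * f z)) f"
    using f by (auto simp: L2_eq_def cnj_borel_measurable
        intro!: square_integrable_bounded_mult[where B = 1])
qed

lemma cinner_l2_mult_cnj_zeta: "cinner (l2_mult_cnj_zeta f) g = cinner f (l2_mult_zeta g)"
  by (metis cinner_l2_mult_zeta l2_mult_zeta_mult_cnj_zeta)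

lemma M_cnj_zeta_h2_cnj: "M_cnj_zeta (h2_cnj f) = h2_cnj (M_zeta f)"
  unfolding M_cnj_zeta.rep_eq M_zeta.rep_eq by transfer (rule l2_mult_cnj_zeta_cnj)

lemma cinner_M_zeta: "cinner (M_zeta f) (M_zeta g) = cinner f g"
  unfolding M_zeta.rep_eq by transfer (rule cinner_l2_mult_zeta)

lemma backward_shift_exists: "\<exists>g'. \<forall>f. cinner g (M_zeta f) = cinner g' f"
proof -
  \<comment> \<open>Multiplication by \<open>cnj z\<close> moves just one frequency of
    \<open>g\<close>, the constant term, to a negative place. Subtracting it gives the backward
    shift of \<open>g\<close>, and pairings with \<open>hardy\<close> do not notice the
    correction.\<close>
  define h where "h = l2_mult_cnj_zeta (Rep_h2 g) - cinner (Rep_h2 g) (l2_char 0) *\<^sub>C l2_char (- 1)"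
  have "h \<in> hardy"
    unfolding hardy_def
  proof safe
    fix n :: int assume n: "n < 0"
    have "cinner h (l2_char n) = cinner (Rep_h2 g) (l2_char (n + 1)) -
        cinner (Rep_h2 g) (l2_char 0) * (if n = - 1 then 1 else 0)"
      by (simp add: h_def cinner_diff_left cinner_scaleC_left cinner_l2_char cinner_l2_mult_cnj_zeta
          l2_mult_zeta_char)
    also have "\<dots> = 0"
    proof (cases "n = - 1")
      case False
      then show ?thesis using n Rep_h2[of g] by (simp add: hardy_def)
    qed simp
    finally show "cinner h (l2_char n) = 0" .
  qed
  moreover have "cinner (Rep_h2 g) (l2_mult_zeta (Rep_h2 f)) = cinner h (Rep_h2 f)" for f
  proof -
    have "cinner (l2_char (- 1)) (Rep_h2 f) = 0"
      using Rep_h2[of f] by (subst cinner_commute) (simp add: hardy_def)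
    then show ?thesis by (simp add: h_def cinner_diff_left cinner_scaleC_left cinner_l2_mult_cnj_zeta)
  qed
  ultimately show ?thesis
    by (intro exI[of _ "Abs_h2 h"])
      (simp add: cinner_h2.rep_eq M_zeta.rep_eq h2_mult_zeta.rep_eq Abs_h2_inverse)
qed

text \<open>Conjugation carries \<open>M_cnj_zeta\<close> to \<open>M_zeta\<close>, so the backward
  shift supplies the representing vectors that \<open>cinner_hadjoint\<close> asks for.\<close>

lemma cinner_hadjoint_M_cnj_zeta: "cinner (hadjoint M_cnj_zeta x) y = cinner x (M_cnj_zeta y)"
proof -
  have "\<exists>w. \<forall>x. cinner (M_cnj_zeta x) y = cinner x w" for y
  proof -
    obtain g where g: "y = h2_cnj g" using h2_cnj_surj by blast
    obtain g' where g': "\<And>f. cinner g (M_zeta f) = cinner g' f"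
      using backward_shift_exists by blast
    have "cinner (M_cnj_zeta (h2_cnj f)) y = cinner (h2_cnj f) (h2_cnj g')" for f
      by (simp add: g M_cnj_zeta_h2_cnj cinner_h2_cnj g')
    then show ?thesis using h2_cnj_surj by metis
  qed
  from cinner_hadjoint[of M_cnj_zeta, OF this] show ?thesis
    by (metis cinner_commute)
qed

lemma cinner_M_cnj_zeta: "cinner (M_cnj_zeta x) (M_cnj_zeta y) = cinner x y"
  using h2_cnj_surj[of x] h2_cnj_surj[of y]
  by (auto simp: M_cnj_zeta_h2_cnj cinner_h2_cnj cinner_M_zeta)

lemma hadjoint_M_cnj_zeta_M_cnj_zeta: "hadjoint M_cnj_zeta (M_cnj_zeta x) = x"
proof (rule cinner_ext)
  fix y
  show "cinner y (hadjoint M_cnj_zeta (M_cnj_zeta x)) = cinner y x"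
    by (metis cinner_M_cnj_zeta cinner_commute cinner_hadjoint_M_cnj_zeta)
qed

lemma poly_l2_add: "poly_l2 (p + q) = poly_l2 p + poly_l2 q"
  by transfer (simp add: L2_eq_def square_integrable_poly square_integrable_add)

lemma poly_l2_smult: "poly_l2 (smult c p) = c *\<^sub>C poly_l2 p"
  by transfer (simp add: L2_eq_def square_integrable_poly square_integrable_scale)

lemma poly_h2_add: "poly_h2 (p + q) = poly_h2 p + poly_h2 q"
  by transfer (rule poly_l2_add)

lemma poly_h2_smult: "poly_h2 (smult c p) = c *\<^sub>C poly_h2 p"
  by transfer (rule poly_l2_smult)

lemma poly_h2_0: "poly_h2 0 = 0"
  by transfer (rule poly_l2_0)

lemma scaleC_zero_left [simp]: "0 *\<^sub>C x = (0 :: 'a :: complex_inner)"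
  using scaleC_of_real[of 0 x] by simp

lemma M_zeta_poly_h2: "M_zeta (poly_h2 p) = poly_h2 (pCons 0 p)"
  unfolding M_zeta.rep_eq by transfer (simp add: poly_l2_pCons)

lemma norm_poly_h2: "(norm (poly_h2 p))\<^sup>2 = (LINT z|arc_length. (cmod (poly p z))\<^sup>2)"
proof -
  have *: "poly_l2 p = abs_l2 (poly p)" "(0 :: l2) = abs_l2 (\<lambda>_. 0)"
    by (simp_all add: poly_l2.abs_eq zero_l2_def)
  have "(norm (poly_h2 p))\<^sup>2 = (norm (poly_l2 p - 0))\<^sup>2"
    by (simp add: norm_h2.rep_eq poly_h2.rep_eq)
  also have "\<dots> = (LINT z|arc_length. (cmod (poly p z))\<^sup>2)"
    unfolding * by (subst norm_diff_abs_l2) (simp_all add: square_integrable_poly square_integrable_zero)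
  finally show ?thesis .
qed

section \<open>Identities and norm bounds on dense sets\<close>

lemma closure_eq_UNIV_I:
  fixes D :: "'a::real_normed_vector set"
  assumes "\<And>x e. e > 0 \<Longrightarrow> \<exists>y\<in>D. norm (x - y) < e"
  shows "closure D = UNIV"
  using assms unfolding closure_approachable set_eq_iff
  by (simp add: dist_norm norm_minus_commute)

lemma closure_range_poly_h2: "closure (range poly_h2) = UNIV"
  using poly_h2_dense by (intro closure_eq_UNIV_I) auto

lemma closure_range_h2_cnj_poly_h2: "closure (range (\<lambda>p. h2_cnj (poly_h2 p))) = UNIV"
  using h2_cnj_poly_dense by (intro closure_eq_UNIV_I) auto

lemma cinner_ext_dense:
  fixes x y :: "'a :: complex_inner"
  assumes D: "closure D = UNIV" and eq: "\<And>w. w \<in> D \<Longrightarrow> cinner x w = cinner y w"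
  shows "x = y"
proof -
  obtain X where X: "\<And>n. X n \<in> D" "X \<longlonglongrightarrow> x - y"
    using D closure_sequential[of "x - y" D] by auto
  have "inner (x - y) (X n) = 0" for n
    using eq[OF X(1), of n] by (simp add: cinner_diff_left flip: Re_cinner)
  moreover have "(\<lambda>n. inner (x - y) (X n)) \<longlonglongrightarrow> inner (x - y) (x - y)"
    by (intro tendsto_intros X)
  ultimately have "inner (x - y) (x - y) = 0"
    using LIMSEQ_unique tendsto_const by fastforce
  then show ?thesis by simp
qed

lemma blinfun_ext_dense:
  fixes A B :: "'a::real_normed_vector \<Rightarrow>\<^sub>L 'b::real_normed_vector"
  assumes D: "closure D = UNIV" and eq: "\<And>w. w \<in> D \<Longrightarrow> A w = B w"
  shows "A = B"
proof (rule blinfun_eqI)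
  fix x
  obtain X where X: "\<And>n. X n \<in> D" "X \<longlonglongrightarrow> x"
    using D closure_sequential[of x D] by auto
  have "(\<lambda>n. A (X n)) \<longlonglongrightarrow> A x" "(\<lambda>n. B (X n)) \<longlonglongrightarrow> B x"
    by (intro tendsto_intros X)+
  then show "A x = B x" using eq[OF X(1)] LIMSEQ_unique by simp
qed

text \<open>The form estimate extends to all vectors by continuity; taking \<open>y = A x\<close>
  then gives the norm bound.\<close>

lemma norm_blinfun_le_dense:
  fixes A :: "'a::real_normed_vector \<Rightarrow>\<^sub>L 'b::real_inner"
  assumes D: "closure D = UNIV" and E: "closure E = UNIV" and M: "M \<ge> 0"
    and le: "\<And>x y. x \<in> D \<Longrightarrow> y \<in> E \<Longrightarrow> inner (A x) y \<le> M * norm x * norm y"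
  shows "norm A \<le> M"
proof (rule norm_blinfun_bound[OF M])
  fix x
  obtain X where X: "\<And>n. X n \<in> D" "X \<longlonglongrightarrow> x"
    using D closure_sequential[of x D] by auto
  obtain Y where Y: "\<And>n. Y n \<in> E" "Y \<longlonglongrightarrow> A x"
    using E closure_sequential[of "A x" E] by auto
  have "inner (A x) (A x) \<le> M * norm x * norm (A x)"
  proof (rule LIMSEQ_le)
    show "(\<lambda>n. inner (A (X n)) (Y n)) \<longlonglongrightarrow> inner (A x) (A x)"
      "(\<lambda>n. M * norm (X n) * norm (Y n)) \<longlonglongrightarrow> M * norm x * norm (A x)"
      by (intro tendsto_intros X Y)+
    show "\<exists>N. \<forall>n\<ge>N. inner (A (X n)) (Y n) \<le> M * norm (X n) * norm (Y n)"
      using le X(1) Y(1) by blast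
  qed
  then have "norm (A x) * norm (A x) \<le> (M * norm x) * norm (A x)"
    by (simp add: power2_norm_eq_inner[symmetric] power2_eq_square)
  then show "norm (A x) \<le> M * norm x"
    using M by (cases "A x = 0") simp_all
qed

section \<open>Hankel operators and the effect of contractivity\<close>

lemma hankel_unique:
  assumes "is_hankel_op q H" "is_hankel_op q H'"
  shows "H = H'"
proof (rule blinfun_ext_dense[OF closure_range_poly_h2], elim rangeE, hypsubst)
  fix f
  show "H (poly_h2 f) = H' (poly_h2 f)"
  proof (rule cinner_ext_dense[OF closure_range_h2_cnj_poly_h2], elim rangeE, hypsubst)
    show "cinner (H (poly_h2 f)) (h2_cnj (poly_h2 g)) = cinner (H' (poly_h2 f)) (h2_cnj (poly_h2 g))" for g
      using assms unfolding is_hankel_op_def by simp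
  qed
qed

lemma is_hankel_op_hankel: "q \<in> Han \<Longrightarrow> is_hankel_op q (hankel q)"
  unfolding Han_def hankel_def by (auto intro: theI hankel_unique)

lemma cinner_hankel:
  "q \<in> Han \<Longrightarrow> cinner (hankel q (poly_h2 f)) (h2_cnj (poly_h2 g)) = cinner (poly_h2 (f * g)) q"
  using is_hankel_op_hankel unfolding is_hankel_op_def by blast

text \<open>The test vector feeds a multiple of the shifted \<open>H f\<close> into the second
  entry. The adjoint undoes the shift, so this entry reinforces \<open>H f\<close> in the image and
  makes contractivity a condition on \<open>norm (H f)\<close>.\<close>

lemma norm_hankel_le:
  assumes r: "r \<in> {0..1}"
    and T: "norm (block_op (r *\<^sub>R M_zeta) 0 H (r *\<^sub>R hadjoint M_cnj_zeta)) \<le> 1"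
  shows "norm H \<le> 1 - r\<^sup>2"
proof (rule norm_blinfun_bound)
  have r2: "r\<^sup>2 \<le> 1" using r by (simp add: power_le_one)
  then show "0 \<le> 1 - r\<^sup>2" by simp
  fix f
  \<comment> \<open>Contractivity gives
    \<open>((1 + r * c)^2 - c^2) * |H f|^2 \<le> (1 - r^2) * |f|^2\<close>. For \<open>r < 1\<close>
    this \<open>c\<close> maximizes the coefficient on the left, with maximum
    \<open>1 / (1 - r^2)\<close>. For \<open>r = 1\<close> already \<open>c = 0\<close> forces
    \<open>H f = 0\<close>.\<close>
  define c where "c = (if r = 1 then 0 else r / (1 - r\<^sup>2))"
  define x where "x = (f, c *\<^sub>R M_cnj_zeta (H f))"
  let ?T = "block_op (r *\<^sub>R M_zeta) 0 H (r *\<^sub>R hadjoint M_cnj_zeta)"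
  have norms: "norm (M_zeta f) = norm f" "norm (M_cnj_zeta y) = norm y" for y
    by (simp_all add: norm_eq_sqrt_inner cinner_M_zeta cinner_M_cnj_zeta flip: Re_cinner)
  have "?T x = (r *\<^sub>R M_zeta f, (1 + r * c) *\<^sub>R H f)"
    by (simp add: x_def block_op.rep_eq blinfun.scaleR_left blinfun.scaleR_right
        hadjoint_M_cnj_zeta_M_cnj_zeta scaleR_add_left)
  moreover have "norm (?T x) \<le> norm x"
    using norm_blinfun[of ?T x] mult_right_mono[OF T norm_ge_zero[of x]] by simp
  then have "(norm (?T x))\<^sup>2 \<le> (norm x)\<^sup>2" by (intro power_mono) simp_all
  ultimately have ineq: "r\<^sup>2 * (norm f)\<^sup>2 + (1 + r * c)\<^sup>2 * (norm (H f))\<^sup>2 \<le> (norm f)\<^sup>2 + c\<^sup>2 * (norm (H f))\<^sup>2"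
    by (simp add: x_def norm_Pair norms power_mult_distrib)
  have "(norm (H f))\<^sup>2 \<le> ((1 - r\<^sup>2) * norm f)\<^sup>2"
  proof (cases "r = 1")
    case True
    then show ?thesis using ineq by (simp add: c_def)
  next
    case False
    then have pos: "1 - r\<^sup>2 > 0" using r by (simp add: abs_square_less_1)
    have "(1 + r * c) * (1 - r\<^sup>2) = 1" "c * (1 - r\<^sup>2) = r"
      using False pos by (simp_all add: c_def field_simps power2_eq_square)
    then have "((1 + r * c)\<^sup>2 - c\<^sup>2) * (1 - r\<^sup>2)\<^sup>2 = 1 - r\<^sup>2"
      by (simp add: left_diff_distrib flip: power_mult_distrib)
    then have k: "((1 + r * c)\<^sup>2 - c\<^sup>2) * (1 - r\<^sup>2) = 1"
      using pos by (simp add: power2_eq_square[of "1 - r\<^sup>2"])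
    have "(norm (H f))\<^sup>2 = (((1 + r * c)\<^sup>2 - c\<^sup>2) * (1 - r\<^sup>2)) * (norm (H f))\<^sup>2" by (simp only: k)
    also have "\<dots> = (1 - r\<^sup>2) * (((1 + r * c)\<^sup>2 - c\<^sup>2) * (norm (H f))\<^sup>2)" by (simp only: mult_ac)
    also have "\<dots> \<le> (1 - r\<^sup>2) * ((1 - r\<^sup>2) * (norm f)\<^sup>2)"
      using ineq pos by (intro mult_left_mono) (simp_all add: left_diff_distrib)
    finally show ?thesis by (simp add: power_mult_distrib power2_eq_square mult_ac)
  qed
  then show "norm (H f) \<le> (1 - r\<^sup>2) * norm f"
    by (rule power2_le_imp_le) (use r2 in simp)
qed

section \<open>Norm bounds for block operators\<close>

lemma integrable_cmod_poly_mult: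
  "integrable arc_length (\<lambda>z. cmod (poly b z) * (cmod (poly f z))\<^sup>2)"
proof -
  have "square_integrable (\<lambda>z. complex_of_real (sqrt (cmod (poly b z)) * cmod (poly f z)))"
    by (intro square_integrable_continuous continuous_intros)
  from integrable_arc_length_square[OF this] show ?thesis
    by (simp add: norm_mult power_mult_distrib)
qed

text \<open>For an exact balanced factor \<open>u\<close> of \<open>b\<close> this is the squared
  norm of \<open>u * f\<close>.\<close>

definition weighted_norm2 :: "complex poly \<Rightarrow> complex poly \<Rightarrow> real"
  where "weighted_norm2 b f = (LINT z|arc_length. cmod (poly b z) * (cmod (poly f z))\<^sup>2)"

lemma weighted_norm2_nonneg: "weighted_norm2 b f \<ge> 0"
  unfolding weighted_norm2_def by (intro integral_nonneg_AE) simp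

lemma norm_poly_h2_mult_le:
  assumes "\<And>z. cmod z = 1 \<Longrightarrow> (cmod (poly u z))\<^sup>2 \<le> cmod (poly b z) + e"
  shows "(norm (poly_h2 (u * f)))\<^sup>2 \<le> weighted_norm2 b f + e * (norm (poly_h2 f))\<^sup>2"
proof -
  have f: "integrable arc_length (\<lambda>z. (cmod (poly p z))\<^sup>2)" for p
    by (intro integrable_arc_length_square square_integrable_poly)
  have "(norm (poly_h2 (u * f)))\<^sup>2 \<le>
      (LINT z|arc_length. cmod (poly b z) * (cmod (poly f z))\<^sup>2 + e * (cmod (poly f z))\<^sup>2)"
    unfolding norm_poly_h2
  proof (rule integral_mono_AE)
    show "AE z in arc_length. (cmod (poly (u * f) z))\<^sup>2 \<le> cmod (poly b z) * (cmod (poly f z))\<^sup>2 + e * (cmod (poly f z))\<^sup>2"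
      using AE_arc_length
    proof eventually_elim
      case (elim z)
      from mult_right_mono[OF assms[OF this], of "(cmod (poly f z))\<^sup>2"] show ?case
        by (simp add: norm_mult power_mult_distrib distrib_right)
    qed
  qed (intro f integrable_cmod_poly_mult Bochner_Integration.integrable_add integrable_mult_right)+
  also have "\<dots> = weighted_norm2 b f + e * (norm (poly_h2 f))\<^sup>2"
    unfolding weighted_norm2_def norm_poly_h2 by (simp add: f integrable_cmod_poly_mult)
  finally show ?thesis .
qed

text \<open>The bound by \<open>\<parallel>H\<parallel>\<close> times the \<open>L\<^sup>1\<close> norm that Nehari's theorem would give is only needed for
  products \<open>b f g\<close>, where it follows by distributing balanced factors of \<open>b\<close> over \<open>f\<close> and \<open>g\<close>.\<close>

lemma hankel_weighted_bound:
  assumes H: "is_hankel_op q H"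
  shows "cmod (cinner (poly_h2 (b * f * g)) q) \<le> norm H * (sqrt (weighted_norm2 b f) * sqrt (weighted_norm2 b g))"
proof -
  have pair: "cmod (cinner (poly_h2 (h * k)) q) \<le> norm H * (norm (poly_h2 h) * norm (poly_h2 k))" for h k
  proof -
    have "cmod (cinner (poly_h2 (h * k)) q) = cmod (cinner (H (poly_h2 h)) (h2_cnj (poly_h2 k)))"
      using H by (simp add: is_hankel_op_def)
    also have "\<dots> \<le> norm (H (poly_h2 h)) * norm (h2_cnj (poly_h2 k))" by (rule complex_Cauchy_Schwarz)
    also have "\<dots> \<le> (norm H * norm (poly_h2 h)) * norm (h2_cnj (poly_h2 k))"
      by (intro mult_right_mono norm_blinfun) simp
    finally show ?thesis by (simp add: norm_h2_cnj mult.assoc)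
  qed
  let ?F = "norm (poly_h2 f)" and ?G = "norm (poly_h2 g)"
  \<comment> \<open>Bound for tolerance \<open>e\<close>: the first term accounts for the defect
    \<open>b - u * v\<close>, the second for the product \<open>(u * f) * (v * g)\<close>.\<close>
  define R where "R e = norm H * (e * ?F * ?G) +
    norm H * (sqrt (weighted_norm2 b f + e * ?F\<^sup>2) * sqrt (weighted_norm2 b g + e * ?G\<^sup>2))" for e
  have le: "cmod (cinner (poly_h2 (b * f * g)) q) \<le> R e" if e: "e > 0" for e
  proof -
    obtain u v where uv: "balanced_factors e (poly b) u v"
      using has_balanced_factors_poly e unfolding has_balanced_factors_def by blast
    have u: "(norm (poly_h2 (u * f)))\<^sup>2 \<le> weighted_norm2 b f + e * ?F\<^sup>2"
      and v: "(norm (poly_h2 (v * g)))\<^sup>2 \<le> weighted_norm2 b g + e * ?G\<^sup>2"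
      using uv by (intro norm_poly_h2_mult_le; force simp: balanced_factors_def)+
    \<comment> \<open>With weight 0 and error \<open>e^2\<close> the multiplication bound reads
      \<open>|(b - u * v) f| \<le> e * |f|\<close> in norm.\<close>
    have "(norm (poly_h2 ((b - u * v) * f)))\<^sup>2 \<le> weighted_norm2 0 f + e\<^sup>2 * ?F\<^sup>2"
    proof (rule norm_poly_h2_mult_le)
      fix z :: complex assume "cmod z = 1"
      then have "cmod (poly (b - u * v) z) \<le> e"
        using uv by (simp add: balanced_factors_def norm_minus_commute)
      then show "(cmod (poly (b - u * v) z))\<^sup>2 \<le> cmod (poly 0 z) + e\<^sup>2"
        by (simp add: power_mono)
    qed
    then have "(norm (poly_h2 ((b - u * v) * f)))\<^sup>2 \<le> (e * ?F)\<^sup>2"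
      by (simp add: weighted_norm2_def power_mult_distrib)
    then have "norm (poly_h2 ((b - u * v) * f)) \<le> e * ?F"
      by (rule power2_le_imp_le) (use e in simp)
    then have 1: "cmod (cinner (poly_h2 ((b - u * v) * f * g)) q) \<le> norm H * (e * ?F * ?G)"
      by (intro order_trans[OF pair] mult_left_mono mult_right_mono) simp_all
    have 2: "cmod (cinner (poly_h2 ((u * f) * (v * g))) q) \<le>
        norm H * (sqrt (weighted_norm2 b f + e * ?F\<^sup>2) * sqrt (weighted_norm2 b g + e * ?G\<^sup>2))"
      using u v by (intro order_trans[OF pair] mult_left_mono mult_mono real_le_rsqrt)
        (auto simp: weighted_norm2_nonneg e less_imp_le)
    have "b * f * g = (b - u * v) * f * g + (u * f) * (v * g)"
      by (simp add: algebra_simps)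
    then have "cinner (poly_h2 (b * f * g)) q =
        cinner (poly_h2 ((b - u * v) * f * g)) q + cinner (poly_h2 ((u * f) * (v * g))) q"
      by (simp only: poly_h2_add cinner_add_left)
    then show ?thesis
      unfolding R_def using norm_triangle_mono[OF 1 2] by (simp only:)
  qed
  \<comment> \<open>The factors \<open>u\<close> and \<open>v\<close> vary with \<open>e\<close>,
    but \<open>R\<close> does not contain them, so the tolerance can tend to 0; \<open>R 0\<close>
    is the claimed bound.\<close>
  have "(R \<longlongrightarrow> R 0) (at_right 0)"
    unfolding R_def by (intro tendsto_intros)
  then have "cmod (cinner (poly_h2 (b * f * g)) q) \<le> R 0"
    by (rule tendsto_lowerbound) (auto simp: eventually_at_filter le)
  then show ?thesis by (simp add: R_def)
qed

text \<open>\<open>A\<close> has the rows \<open>(a(S), 0)\<close> and \<open>(\<Sum>\<^sub>j H\<^sub>j b\<^sub>j(S), a(B))\<close>. The second row is tested against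
  conjugate polynomials, so that neither \<open>H\<^sub>j\<close> nor the polynomial calculus of \<open>B\<close> appears.\<close>

definition has_symbol :: "nat \<Rightarrow> (nat \<Rightarrow> h2) \<Rightarrow> ((h2 \<times> ch2) \<Rightarrow>\<^sub>L (h2 \<times> ch2)) \<Rightarrow>
    complex poly \<Rightarrow> (nat \<Rightarrow> complex poly) \<Rightarrow> bool"
  where "has_symbol d q A a b \<longleftrightarrow> (\<forall>f x. fst (A (poly_h2 f, x)) = poly_h2 (a * f) \<and>
    (\<forall>g. cinner (snd (A (poly_h2 f, x))) (h2_cnj (poly_h2 g)) =
      (\<Sum>j\<in>{1..d}. cinner (poly_h2 (b j * f * g)) (q j)) + cinner x (h2_cnj (poly_h2 (a * g)))))"

lemma closure_poly_pairs:
  "closure (range poly_h2 \<times> range (\<lambda>p. h2_cnj (poly_h2 p))) = UNIV"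
  by (simp add: closure_Times closure_range_poly_h2 closure_range_h2_cnj_poly_h2)

text \<open>Polynomials are dense in both components, so the symbol determines the operator;
  commutation thereby becomes an equality of symbols.\<close>

lemma has_symbol_unique:
  assumes "has_symbol d q A a b" "has_symbol d q A' a b"
  shows "A = A'"
proof (rule blinfun_ext_dense[OF closure_poly_pairs])
  fix w :: "h2 \<times> ch2"
  assume "w \<in> range poly_h2 \<times> range (\<lambda>p. h2_cnj (poly_h2 p))"
  then obtain f x where w: "w = (poly_h2 f, x)" by auto
  have "snd (A w) = snd (A' w)"
    by (rule cinner_ext_dense[OF closure_range_h2_cnj_poly_h2])
      (use assms in \<open>auto simp: has_symbol_def w\<close>)
  moreover have "fst (A w) = fst (A' w)" using assms by (simp add: has_symbol_def w)
  ultimately show "A w = A' w" by (simp add: prod_eq_iff)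
qed

text \<open>The diagonal symbols multiply and the others obey the product rule. The Hankel form
  depends only on the product of its two arguments, so \<open>a\<close> may pass from
  \<open>g\<close> to \<open>f\<close>; this is the weak form of the intertwining relation.\<close>

lemma has_symbol_compose:
  assumes A: "has_symbol d q A a b" and A': "has_symbol d q A' a' b'"
  shows "has_symbol d q (A o\<^sub>L A') (a * a') (\<lambda>j. b j * a' + a * b' j)"
  unfolding has_symbol_def
proof (intro allI conjI)
  fix f x
  define y where "y = snd (A' (poly_h2 f, x))"
  \<comment> \<open>The first entry of the image is again a polynomial, whereas the second is an
    arbitrary vector; \<open>has_symbol\<close> admits just such pairs.\<close>
  have y: "A' (poly_h2 f, x) = (poly_h2 (a' * f), y)"
    using A' by (simp add: has_symbol_def y_def prod_eq_iff)
  show "fst ((A o\<^sub>L A') (poly_h2 f, x)) = poly_h2 (a * a' * f)"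
    using A by (simp add: has_symbol_def y mult.assoc)
  fix g
  have "cinner (snd ((A o\<^sub>L A') (poly_h2 f, x))) (h2_cnj (poly_h2 g)) =
      (\<Sum>j\<in>{1..d}. cinner (poly_h2 (b j * (a' * f) * g)) (q j)) + cinner y (h2_cnj (poly_h2 (a * g)))"
    using A by (simp add: has_symbol_def y)
  also have "cinner y (h2_cnj (poly_h2 (a * g))) =
      (\<Sum>j\<in>{1..d}. cinner (poly_h2 (b' j * f * (a * g))) (q j)) + cinner x (h2_cnj (poly_h2 (a' * (a * g))))"
    using A' by (simp add: has_symbol_def y_def)
  finally have "cinner (snd ((A o\<^sub>L A') (poly_h2 f, x))) (h2_cnj (poly_h2 g)) =
      (\<Sum>j\<in>{1..d}. cinner (poly_h2 (b j * (a' * f) * g)) (q j)) +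
      (\<Sum>j\<in>{1..d}. cinner (poly_h2 (b' j * f * (a * g))) (q j)) + cinner x (h2_cnj (poly_h2 (a' * (a * g))))"
    by (simp only: add.assoc)
  moreover have "(b j * a' + a * b' j) * f * g = b j * (a' * f) * g + b' j * f * (a * g)" for j
    by (simp add: algebra_simps)
  then have "(\<Sum>j\<in>{1..d}. cinner (poly_h2 ((b j * a' + a * b' j) * f * g)) (q j)) =
      (\<Sum>j\<in>{1..d}. cinner (poly_h2 (b j * (a' * f) * g)) (q j)) +
      (\<Sum>j\<in>{1..d}. cinner (poly_h2 (b' j * f * (a * g))) (q j))"
    by (simp only: poly_h2_add cinner_add_left sum.distrib)
  moreover have "a' * (a * g) = a * a' * g" by (simp add: mult_ac)
  ultimately show "cinner (snd ((A o\<^sub>L A') (poly_h2 f, x))) (h2_cnj (poly_h2 g)) =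
      (\<Sum>j\<in>{1..d}. cinner (poly_h2 ((b j * a' + a * b' j) * f * g)) (q j)) + cinner x (h2_cnj (poly_h2 (a * a' * g)))"
    by (simp only:)
qed

lemma has_symbol_id: "has_symbol d q id_blinfun 1 (\<lambda>_. 0)"
  by (simp add: has_symbol_def poly_h2_0)

lemma has_symbol_zero: "has_symbol d q 0 0 (\<lambda>_. 0)"
proof -
  have "h2_cnj 0 = 0" using h2_cnj_diff[of 0 0] by simp
  moreover have "cinner x (0 :: ch2) = 0" for x using cinner_diff_right[of x 0 0] by simp
  ultimately show ?thesis by (simp add: has_symbol_def poly_h2_0)
qed

lemma has_symbol_add:
  "has_symbol d q A a b \<Longrightarrow> has_symbol d q A' a' b' \<Longrightarrow>
    has_symbol d q (A + A') (a + a') (\<lambda>j. b j + b' j)"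
  by (simp add: has_symbol_def blinfun.add_left distrib_right poly_h2_add cinner_add_left sum.distrib
      h2_cnj_add cinner_add_right)

lemma has_symbol_scaleC:
  "has_symbol d q A a b \<Longrightarrow> has_symbol d q (scaleC_op c A) (smult c a) (\<lambda>j. smult c (b j))"
  by (simp add: has_symbol_def scaleC_op.rep_eq scaleC_prod_def poly_h2_smult cinner_scaleC_left
      h2_cnj_scaleC cinner_scaleC_right sum_distrib_left distrib_left)

text \<open>The symbol is that of the coordinate function with index \<open>j\<close>: its value
  \<open>r * z\<close> on the diagonal and Kronecker deltas as partial derivatives. In the second
  row the adjoint is moved onto the test polynomial.\<close>

lemma has_symbol_block_op:
  assumes j: "j \<in> {1..d}" and q: "q j \<in> Han"
  shows "has_symbol d q (block_op (r *\<^sub>R M_zeta) 0 (hankel (q j)) (r *\<^sub>R hadjoint M_cnj_zeta))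
    [:0, of_real r:] (\<lambda>i. if i = j then 1 else 0)"
  unfolding has_symbol_def
proof (intro allI conjI)
  have shift: "[:0, of_real r:] * f = smult (of_real r) (pCons 0 f)" for f :: "complex poly" by simp
  fix f x
  let ?T = "block_op (r *\<^sub>R M_zeta) 0 (hankel (q j)) (r *\<^sub>R hadjoint M_cnj_zeta)"
  show "fst (?T (poly_h2 f, x)) = poly_h2 ([:0, of_real r:] * f)"
    unfolding shift poly_h2_smult M_zeta_poly_h2[symmetric] scaleC_of_real
    by (simp add: block_op.rep_eq blinfun.scaleR_left)
  fix g
  have "(\<Sum>i\<in>{1..d}. cinner (poly_h2 ((if i = j then 1 else 0) * f * g)) (q i)) =
      (\<Sum>i\<in>{1..d}. if i = j then cinner (poly_h2 (f * g)) (q i) else 0)"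
    by (intro sum.cong) (auto simp: poly_h2_0)
  also have "\<dots> = cinner (poly_h2 (f * g)) (q j)" using j by (simp add: sum.delta)
  finally show "cinner (snd (?T (poly_h2 f, x))) (h2_cnj (poly_h2 g)) =
      (\<Sum>i\<in>{1..d}. cinner (poly_h2 ((if i = j then 1 else 0) * f * g)) (q i)) +
      cinner x (h2_cnj (poly_h2 ([:0, of_real r:] * g)))"
    unfolding shift poly_h2_smult M_zeta_poly_h2[symmetric] h2_cnj_scaleC M_cnj_zeta_h2_cnj[symmetric]
    by (simp add: block_op.rep_eq blinfun.scaleR_left cinner_add_left cinner_hankel[OF q]
        cinner_scaleR_left cinner_scaleC_right cinner_hadjoint_M_cnj_zeta)
qed

section \<open>The norm estimate for operators with a symbol\<close>

lemma Cauchy_Schwarz3: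
  fixes x1 x2 x3 y1 y2 y3 :: real
  assumes "x1\<^sup>2 + x2\<^sup>2 + x3\<^sup>2 \<le> X\<^sup>2" "y1\<^sup>2 + y2\<^sup>2 + y3\<^sup>2 \<le> Y\<^sup>2" "X \<ge> 0" "Y \<ge> 0"
  shows "x1 * y1 + x2 * y2 + x3 * y3 \<le> X * Y"
proof -
  have "inner (x1, x2, x3) (y1, y2, y3) \<le> norm (x1, x2, x3) * norm (y1, y2, y3)"
    by (rule norm_cauchy_schwarz)
  also have "\<dots> \<le> X * Y"
    using assms by (intro mult_mono) (auto simp: norm_Pair add.assoc intro!: real_le_lsqrt)
  finally show ?thesis by (simp add: inner_prod_def)
qed

text \<open>The pointwise inequality is multiplied by \<open>|f|^2\<close> and integrated over the
  circle.\<close>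

lemma weighted_sum_le:
  assumes "\<And>z. cmod z = 1 \<Longrightarrow> M * (\<Sum>j\<in>J. k j * cmod (poly (b j) z)) \<le> M\<^sup>2 - (cmod (poly a z))\<^sup>2"
  shows "M * (\<Sum>j\<in>J. k j * weighted_norm2 (b j) f) + (norm (poly_h2 (a * f)))\<^sup>2 \<le> (M * norm (poly_h2 f))\<^sup>2"
proof -
  have int: "integrable arc_length (\<lambda>z. (cmod (poly p z))\<^sup>2)" for p
    by (intro integrable_arc_length_square square_integrable_poly)
  have "M * (\<Sum>j\<in>J. k j * weighted_norm2 (b j) f) + (norm (poly_h2 (a * f)))\<^sup>2 =
      (LINT z|arc_length. M * (\<Sum>j\<in>J. k j * (cmod (poly (b j) z) * (cmod (poly f z))\<^sup>2)) + (cmod (poly (a * f) z))\<^sup>2)"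
    unfolding weighted_norm2_def norm_poly_h2
    by (simp add: int[of "a * f"] integrable_cmod_poly_mult del: poly_mult)
  also have "\<dots> \<le> (LINT z|arc_length. M\<^sup>2 * (cmod (poly f z))\<^sup>2)"
  proof (rule integral_mono_AE)
    show "AE z in arc_length. M * (\<Sum>j\<in>J. k j * (cmod (poly (b j) z) * (cmod (poly f z))\<^sup>2)) + (cmod (poly (a * f) z))\<^sup>2
        \<le> M\<^sup>2 * (cmod (poly f z))\<^sup>2"
      using AE_arc_length
    proof eventually_elim
      case (elim z)
      from mult_right_mono[OF assms[OF this], of "(cmod (poly f z))\<^sup>2"] show ?case
        by (simp add: norm_mult power_mult_distrib left_diff_distrib sum_distrib_right mult.assoc)
    qed
  qed (intro int integrable_cmod_poly_mult Bochner_Integration.integrable_add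
      integrable_mult_right Bochner_Integration.integrable_sum)+
  also have "\<dots> = (M * norm (poly_h2 f))\<^sup>2"
    by (simp add: norm_poly_h2 power_mult_distrib)
  finally show ?thesis .
qed

text \<open>The form of \<open>A\<close> has two diagonal terms and one Hankel term. After scaling
  by \<open>M\<close> it is at most the inner product of two vectors in three-dimensional space,
  whose lengths \<open>weighted_sum_le\<close> bounds by \<open>M * norm x\<close> and
  \<open>M * norm y\<close>.\<close>

lemma norm_le_has_symbol:
  assumes A: "has_symbol d q A a b" and M: "M > 0"
    and q: "\<And>j. j \<in> {1..d} \<Longrightarrow> q j \<in> Han"
    and H: "\<And>j. j \<in> {1..d} \<Longrightarrow> norm (hankel (q j)) \<le> k j"
    and ab: "\<And>z. cmod z = 1 \<Longrightarrow> M * (\<Sum>j\<in>{1..d}. k j * cmod (poly (b j) z)) \<le> M\<^sup>2 - (cmod (poly a z))\<^sup>2"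
  shows "norm A \<le> M"
proof (rule norm_blinfun_le_dense[OF closure_poly_pairs closure_poly_pairs])
  show "M \<ge> 0" using M by simp
  fix x y :: "h2 \<times> ch2"
  assume "x \<in> range poly_h2 \<times> range (\<lambda>p. h2_cnj (poly_h2 p))"
    and "y \<in> range poly_h2 \<times> range (\<lambda>p. h2_cnj (poly_h2 p))"
  then obtain f g f' g' where x: "x = (poly_h2 f, h2_cnj (poly_h2 g))"
    and y: "y = (poly_h2 f', h2_cnj (poly_h2 g'))" by auto
  have k: "k j \<ge> 0" if "j \<in> {1..d}" for j using H[OF that] norm_ge_zero order_trans by blast
  let ?n = "\<lambda>p. norm (poly_h2 p)"
  \<comment> \<open>\<open>D p\<close> is the length that the weighted norms contribute in
    \<open>weighted_sum_le\<close>; the Hankel term, scaled by \<open>M\<close>, is at most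
    \<open>D f * D g'\<close>.\<close>
  define D where "D p = sqrt (M * (\<Sum>j\<in>{1..d}. k j * weighted_norm2 (b j) p))" for p
  have D2: "(D p)\<^sup>2 = M * (\<Sum>j\<in>{1..d}. k j * weighted_norm2 (b j) p)" for p
    unfolding D_def using M k weighted_norm2_nonneg
    by (intro real_sqrt_pow2 mult_nonneg_nonneg sum_nonneg) auto
  have wle: "(D p)\<^sup>2 + (?n (a * p))\<^sup>2 \<le> (M * ?n p)\<^sup>2" for p
    unfolding D2 by (rule weighted_sum_le[OF ab])
  have mid: "M * cmod (\<Sum>j\<in>{1..d}. cinner (poly_h2 (b j * f * g')) (q j)) \<le> D f * D g'"
  proof -
    have "cmod (\<Sum>j\<in>{1..d}. cinner (poly_h2 (b j * f * g')) (q j)) \<le>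
        (\<Sum>j\<in>{1..d}. \<bar>sqrt (k j * weighted_norm2 (b j) f)\<bar> * \<bar>sqrt (k j * weighted_norm2 (b j) g')\<bar>)"
    proof (rule sum_norm_le)
      fix j assume j: "j \<in> {1..d}"
      have "cmod (cinner (poly_h2 (b j * f * g')) (q j)) \<le>
          norm (hankel (q j)) * (sqrt (weighted_norm2 (b j) f) * sqrt (weighted_norm2 (b j) g'))"
        by (rule hankel_weighted_bound[OF is_hankel_op_hankel[OF q[OF j]]])
      also have "\<dots> \<le> k j * (sqrt (weighted_norm2 (b j) f) * sqrt (weighted_norm2 (b j) g'))"
        by (intro mult_right_mono H[OF j] mult_nonneg_nonneg real_sqrt_ge_zero weighted_norm2_nonneg)
      also have "\<dots> = sqrt (k j * weighted_norm2 (b j) f) * sqrt (k j * weighted_norm2 (b j) g')"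
        using k[OF j] by (simp add: real_sqrt_mult)
      also have "\<dots> = \<bar>sqrt (k j * weighted_norm2 (b j) f)\<bar> * \<bar>sqrt (k j * weighted_norm2 (b j) g')\<bar>"
        using k[OF j] weighted_norm2_nonneg by simp
      finally show "cmod (cinner (poly_h2 (b j * f * g')) (q j)) \<le> \<dots>" .
    qed
    also have "\<dots> \<le> L2_set (\<lambda>j. sqrt (k j * weighted_norm2 (b j) f)) {1..d} *
        L2_set (\<lambda>j. sqrt (k j * weighted_norm2 (b j) g')) {1..d}"
      by (rule L2_set_mult_ineq)
    also have "\<dots> = sqrt (\<Sum>j\<in>{1..d}. k j * weighted_norm2 (b j) f) * sqrt (\<Sum>j\<in>{1..d}. k j * weighted_norm2 (b j) g')"
      unfolding L2_set_def using k weighted_norm2_nonneg by simp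
    finally have "M * cmod (\<Sum>j\<in>{1..d}. cinner (poly_h2 (b j * f * g')) (q j)) \<le>
        M * (sqrt (\<Sum>j\<in>{1..d}. k j * weighted_norm2 (b j) f) * sqrt (\<Sum>j\<in>{1..d}. k j * weighted_norm2 (b j) g'))"
      using M by (intro mult_left_mono) simp_all
    also have "\<dots> = D f * D g'"
      using M by (simp add: D_def real_sqrt_mult)
    finally show ?thesis .
  qed
  have "cinner (A x) y = cinner (poly_h2 (a * f)) (poly_h2 f') +
      ((\<Sum>j\<in>{1..d}. cinner (poly_h2 (b j * f * g')) (q j)) + cinner (poly_h2 (a * g')) (poly_h2 g))"
    using A by (simp add: cinner_prod_def x y has_symbol_def cinner_h2_cnj)
  then have "cmod (cinner (A x) y) \<le> cmod (cinner (poly_h2 (a * f)) (poly_h2 f')) +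
      (cmod (\<Sum>j\<in>{1..d}. cinner (poly_h2 (b j * f * g')) (q j)) + cmod (cinner (poly_h2 (a * g')) (poly_h2 g)))"
    by (simp only:) (intro order_trans[OF norm_triangle_ineq] add_left_mono norm_triangle_ineq)
  also have "\<dots> \<le> ?n (a * f) * ?n f' +
      (cmod (\<Sum>j\<in>{1..d}. cinner (poly_h2 (b j * f * g')) (q j)) + ?n (a * g') * ?n g)"
    by (intro add_mono complex_Cauchy_Schwarz order_refl)
  finally have "M * cmod (cinner (A x) y) \<le> M * (?n (a * f) * ?n f' +
      (cmod (\<Sum>j\<in>{1..d}. cinner (poly_h2 (b j * f * g')) (q j)) + ?n (a * g') * ?n g))"
    using M by (intro mult_left_mono) simp_all
  also have "\<dots> \<le> ?n (a * f) * (M * ?n f') + D f * D g' + (M * ?n g) * ?n (a * g')"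
    using mid by (simp add: distrib_left mult_ac)
  \<comment> \<open>The vectors are \<open>(|a f|, D f, M |g|)\<close> and
    \<open>(M |f'|, D g', |a g'|)\<close>. In the last entries the roles are exchanged, because the
    lower diagonal block acts on the test polynomial \<open>g'\<close>.\<close>
  also have "\<dots> \<le> (M * norm x) * (M * norm y)"
  proof (rule Cauchy_Schwarz3)
    show "(?n (a * f))\<^sup>2 + (D f)\<^sup>2 + (M * ?n g)\<^sup>2 \<le> (M * norm x)\<^sup>2"
      using wle[of f] by (simp add: x norm_Pair norm_h2_cnj power_mult_distrib distrib_left)
    show "(M * ?n f')\<^sup>2 + (D g')\<^sup>2 + (?n (a * g'))\<^sup>2 \<le> (M * norm y)\<^sup>2"
      using wle[of g'] by (simp add: y norm_Pair norm_h2_cnj power_mult_distrib distrib_left)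
  qed (use M in simp_all)
  finally have "M * cmod (cinner (A x) y) \<le> M * (M * norm x * norm y)" by (simp add: mult_ac)
  then have "cmod (cinner (A x) y) \<le> M * norm x * norm y" using M by simp
  then show "inner (A x) y \<le> M * norm x * norm y"
    using complex_Re_le_cmod[of "cinner (A x) y"] by (simp add: Re_cinner)
qed

section \<open>The functional calculus\<close>

text \<open>\<open>a\<close> and \<open>b\<^sub>j\<close> are \<open>F\<close> and its partial derivatives at \<open>(r\<^sub>1 z, \<dots>, r\<^sub>d z)\<close>. The derivatives are
  expressed along arbitrary curves: this form follows the construction of \<open>F\<close> by the product rule
  and applies directly to curves of Moebius maps.\<close>

definition realizes :: "nat \<Rightarrow> (nat \<Rightarrow> h2) \<Rightarrow> (nat \<Rightarrow> real) \<Rightarrow> ((h2 \<times> ch2) \<Rightarrow>\<^sub>L (h2 \<times> ch2)) \<Rightarrow>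
    ((nat \<Rightarrow> complex) \<Rightarrow> complex) \<Rightarrow> complex poly \<Rightarrow> (nat \<Rightarrow> complex poly) \<Rightarrow> bool"
  where "realizes d q r A F a b \<longleftrightarrow> has_symbol d q A a b \<and>
    (\<forall>z. poly a z = F (\<lambda>j. of_real (r j) * z)) \<and>
    (\<forall>\<phi> v z. (\<forall>j. \<phi> j 0 = of_real (r j) * z) \<longrightarrow> (\<forall>j. (\<phi> j has_field_derivative v j) (at 0)) \<longrightarrow>
      ((\<lambda>t. F (\<lambda>j. \<phi> j t)) has_field_derivative (\<Sum>j\<in>{1..d}. v j * poly (b j) z)) (at 0))"

lemma realizesD:
  assumes "realizes d q r A F a b"
  shows "has_symbol d q A a b" "poly a z = F (\<lambda>j. of_real (r j) * z)"
    "(\<And>j. \<phi> j 0 = of_real (r j) * z) \<Longrightarrow> (\<And>j. (\<phi> j has_field_derivative v j) (at 0)) \<Longrightarrow>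
      ((\<lambda>t. F (\<lambda>j. \<phi> j t)) has_field_derivative (\<Sum>j\<in>{1..d}. v j * poly (b j) z)) (at 0)"
  using assms unfolding realizes_def by blast+

lemma realizesI:
  assumes "has_symbol d q A a b" "\<And>z. poly a z = F (\<lambda>j. of_real (r j) * z)"
    and "\<And>\<phi> v z. (\<And>j. \<phi> j 0 = of_real (r j) * z) \<Longrightarrow> (\<And>j. (\<phi> j has_field_derivative v j) (at 0)) \<Longrightarrow>
      ((\<lambda>t. F (\<lambda>j. \<phi> j t)) has_field_derivative (\<Sum>j\<in>{1..d}. v j * poly (b j) z)) (at 0)"
  shows "realizes d q r A F a b"
  using assms unfolding realizes_def by blast

lemma realizes_compose:
  assumes A: "realizes d q r A F a b" and A': "realizes d q r A' F' a' b'"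
  shows "realizes d q r (A o\<^sub>L A') (\<lambda>w. F w * F' w) (a * a') (\<lambda>j. b j * a' + a * b' j)"
proof (rule realizesI)
  show "has_symbol d q (A o\<^sub>L A') (a * a') (\<lambda>j. b j * a' + a * b' j)"
    by (intro has_symbol_compose realizesD(1)[OF A] realizesD(1)[OF A'])
  show "poly (a * a') z = F (\<lambda>j. of_real (r j) * z) * F' (\<lambda>j. of_real (r j) * z)" for z
    by (simp add: realizesD(2)[OF A] realizesD(2)[OF A'])
  fix \<phi> :: "nat \<Rightarrow> complex \<Rightarrow> complex" and v and z :: complex
  assume \<phi>: "\<And>j. \<phi> j 0 = of_real (r j) * z" "\<And>j. (\<phi> j has_field_derivative v j) (at 0)"
  have 0: "F (\<lambda>j. \<phi> j 0) = poly a z" "F' (\<lambda>j. \<phi> j 0) = poly a' z"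
    by (simp_all add: \<phi>(1) realizesD(2)[OF A] realizesD(2)[OF A'])
  have "(\<Sum>j\<in>{1..d}. v j * poly (b j * a' + a * b' j) z) =
      (\<Sum>j\<in>{1..d}. v j * poly (b j) z) * F' (\<lambda>j. \<phi> j 0) + (\<Sum>j\<in>{1..d}. v j * poly (b' j) z) * F (\<lambda>j. \<phi> j 0)"
    unfolding 0 sum_distrib_right sum.distrib[symmetric]
    by (intro sum.cong) (simp_all add: algebra_simps)
  with DERIV_mult[OF realizesD(3)[OF A \<phi>] realizesD(3)[OF A' \<phi>]]
  show "((\<lambda>t. F (\<lambda>j. \<phi> j t) * F' (\<lambda>j. \<phi> j t)) has_field_derivative
      (\<Sum>j\<in>{1..d}. v j * poly (b j * a' + a * b' j) z)) (at 0)"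
    by (simp only:)
qed

lemma realizes_id: "realizes d q r id_blinfun (\<lambda>_. 1) 1 (\<lambda>_. 0)"
  by (rule realizesI) (simp_all add: has_symbol_id)

lemma realizes_zero: "realizes d q r 0 (\<lambda>_. 0) 0 (\<lambda>_. 0)"
  by (rule realizesI) (simp_all add: has_symbol_zero)

lemma realizes_add:
  assumes A: "realizes d q r A F a b" and A': "realizes d q r A' F' a' b'"
  shows "realizes d q r (A + A') (\<lambda>w. F w + F' w) (a + a') (\<lambda>j. b j + b' j)"
proof (rule realizesI)
  show "has_symbol d q (A + A') (a + a') (\<lambda>j. b j + b' j)"
    by (intro has_symbol_add realizesD(1)[OF A] realizesD(1)[OF A'])
  show "poly (a + a') z = F (\<lambda>j. of_real (r j) * z) + F' (\<lambda>j. of_real (r j) * z)" for z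
    by (simp add: realizesD(2)[OF A] realizesD(2)[OF A'])
  fix \<phi> :: "nat \<Rightarrow> complex \<Rightarrow> complex" and v and z :: complex
  assume \<phi>: "\<And>j. \<phi> j 0 = of_real (r j) * z" "\<And>j. (\<phi> j has_field_derivative v j) (at 0)"
  from DERIV_add[OF realizesD(3)[OF A \<phi>] realizesD(3)[OF A' \<phi>]]
  show "((\<lambda>t. F (\<lambda>j. \<phi> j t) + F' (\<lambda>j. \<phi> j t)) has_field_derivative
      (\<Sum>j\<in>{1..d}. v j * poly (b j + b' j) z)) (at 0)"
    by (simp add: distrib_left sum.distrib)
qed

lemma realizes_scaleC:
  assumes A: "realizes d q r A F a b"
  shows "realizes d q r (scaleC_op c A) (\<lambda>w. c * F w) (smult c a) (\<lambda>j. smult c (b j))"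
proof (rule realizesI)
  show "has_symbol d q (scaleC_op c A) (smult c a) (\<lambda>j. smult c (b j))"
    by (intro has_symbol_scaleC realizesD(1)[OF A])
  show "poly (smult c a) z = c * F (\<lambda>j. of_real (r j) * z)" for z
    by (simp add: realizesD(2)[OF A])
  fix \<phi> :: "nat \<Rightarrow> complex \<Rightarrow> complex" and v and z :: complex
  assume \<phi>: "\<And>j. \<phi> j 0 = of_real (r j) * z" "\<And>j. (\<phi> j has_field_derivative v j) (at 0)"
  from DERIV_cmult[OF realizesD(3)[OF A \<phi>], of c]
  show "((\<lambda>t. c * F (\<lambda>j. \<phi> j t)) has_field_derivative
      (\<Sum>j\<in>{1..d}. v j * poly (smult c (b j)) z)) (at 0)"
    by (simp add: sum_distrib_left mult.left_commute)
qed

lemma realizes_block_op: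
  assumes j: "j \<in> {1..d}" and q: "q j \<in> Han"
  shows "realizes d q r (block_op (r j *\<^sub>R M_zeta) 0 (hankel (q j)) (r j *\<^sub>R hadjoint M_cnj_zeta))
    (\<lambda>w. w j) [:0, of_real (r j):] (\<lambda>i. if i = j then 1 else 0)"
proof (rule realizesI)
  fix \<phi> :: "nat \<Rightarrow> complex \<Rightarrow> complex" and v and z :: complex
  assume \<phi>: "\<And>j. (\<phi> j has_field_derivative v j) (at (0 :: complex))"
  have "(\<Sum>i\<in>{1..d}. v i * poly (if i = j then 1 else 0) z) = (\<Sum>i\<in>{1..d}. if i = j then v i else 0)"
    by (intro sum.cong) auto
  also have "\<dots> = v j" using j by (simp add: sum.delta)
  finally show "(\<phi> j has_field_derivative (\<Sum>i\<in>{1..d}. v i * poly (if i = j then 1 else 0) z)) (at 0)"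
    using \<phi>[of j] by (simp only:)
qed (simp_all add: has_symbol_block_op[of j d q, OF assms] mult.commute del: One_nat_def)

lemma realizes_power:
  assumes "realizes d q r A F a b"
  shows "\<exists>a b. realizes d q r (blinfun_power A n) (\<lambda>w. F w ^ n) a b"
proof (induction n)
  case 0
  show ?case using realizes_id by simp blast
next
  case (Suc n)
  then obtain a' b' where "realizes d q r (blinfun_power A n) (\<lambda>w. F w ^ n) a' b'" by blast
  from realizes_compose[OF assms this] show ?case by auto
qed

lemma realizes_monomial:
  assumes T: "\<And>j. j \<in> {1..d} \<Longrightarrow> \<exists>a b. realizes d q r (T j) (\<lambda>w. w j) a b"
  shows "\<exists>a b. realizes d q r (op_monomial d T m) (\<lambda>w. \<Prod>j\<in>{1..d}. w j ^ Poly_Mapping.lookup m j) a b"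
proof -
  \<comment> \<open>Generalized to duplicate-free lists of indices: distinctness turns the product
    along the list into the product over its set.\<close>
  have "\<exists>a b. realizes d q r
      (foldr (\<lambda>j A. blinfun_power (T j) (Poly_Mapping.lookup m j) o\<^sub>L A) xs id_blinfun)
      (\<lambda>w. \<Prod>j\<in>set xs. w j ^ Poly_Mapping.lookup m j) a b"
    if "set xs \<subseteq> {1..d}" "distinct xs" for xs
    using that
  proof (induction xs)
    case Nil
    then show ?case using realizes_id by simp blast
  next
    case (Cons j xs)
    obtain a b where "realizes d q r
        (foldr (\<lambda>j A. blinfun_power (T j) (Poly_Mapping.lookup m j) o\<^sub>L A) xs id_blinfun)
        (\<lambda>w. \<Prod>j\<in>set xs. w j ^ Poly_Mapping.lookup m j) a b"
      using Cons by auto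
    moreover obtain a' b' where "realizes d q r (blinfun_power (T j) (Poly_Mapping.lookup m j))
        (\<lambda>w. w j ^ Poly_Mapping.lookup m j) a' b'"
      using T[of j] realizes_power Cons.prems(1) by (metis list.set_intros(1) subsetD)
    ultimately show ?case
      using realizes_compose Cons.prems(2) by fastforce
  qed
  from this[of "[1..<Suc d]"] show ?thesis
    by (simp add: op_monomial_def atLeastLessThanSuc_atLeastAtMost del: upt_Suc)
qed

lemma realizes_mpoly:
  assumes T: "\<And>j. j \<in> {1..d} \<Longrightarrow> \<exists>a b. realizes d q r (T j) (\<lambda>w. w j) a b"
  shows "\<exists>a b. realizes d q r (op_mpoly d p T) (mpoly_eval d p) a b"
proof -
  have "\<exists>a b. realizes d q r
      (\<Sum>m\<in>I. scaleC_op (Poly_Mapping.lookup p m) (op_monomial d T m))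
      (\<lambda>w. \<Sum>m\<in>I. Poly_Mapping.lookup p m * (\<Prod>j\<in>{1..d}. w j ^ Poly_Mapping.lookup m j)) a b"
    if "finite I" for I
    using that
  proof induction
    case empty
    show ?case using realizes_zero by simp blast
  next
    case (insert m I)
    obtain a b where "realizes d q r
        (\<Sum>m\<in>I. scaleC_op (Poly_Mapping.lookup p m) (op_monomial d T m))
        (\<lambda>w. \<Sum>m\<in>I. Poly_Mapping.lookup p m * (\<Prod>j\<in>{1..d}. w j ^ Poly_Mapping.lookup m j)) a b"
      using insert.IH by blast
    moreover obtain a' b' where
      "realizes d q r (op_monomial d T m) (\<lambda>w. \<Prod>j\<in>{1..d}. w j ^ Poly_Mapping.lookup m j) a' b'"
      using realizes_monomial[OF T] by blast
    ultimately have "realizes d q r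
        (scaleC_op (Poly_Mapping.lookup p m) (op_monomial d T m) +
          (\<Sum>m\<in>I. scaleC_op (Poly_Mapping.lookup p m) (op_monomial d T m)))
        (\<lambda>w. Poly_Mapping.lookup p m * (\<Prod>j\<in>{1..d}. w j ^ Poly_Mapping.lookup m j) +
          (\<Sum>m\<in>I. Poly_Mapping.lookup p m * (\<Prod>j\<in>{1..d}. w j ^ Poly_Mapping.lookup m j)))
        (smult (Poly_Mapping.lookup p m) a' + a) (\<lambda>j. smult (Poly_Mapping.lookup p m) (b' j) + b j)"
      by (intro realizes_add realizes_scaleC)
    then show ?case unfolding sum.insert[OF insert.hyps] by blast
  qed
  from this[of "Poly_Mapping.keys p"] show ?thesis
    unfolding op_mpoly_def mpoly_eval_def[abs_def] by simp
qed

text \<open>Real suprema are meaningful only for bounded sets. Monomials have modulus at most 1 on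
  the polydisc, so the sum of the moduli of the coefficients is a bound.\<close>

lemma bdd_above_mpoly_eval: "bdd_above ((\<lambda>z. cmod (mpoly_eval d p z)) ` polydisc d)"
proof (rule bdd_aboveI2)
  fix z assume z: "z \<in> polydisc d"
  have "cmod (Poly_Mapping.lookup p m * (\<Prod>j\<in>{1..d}. z j ^ Poly_Mapping.lookup m j)) \<le>
      cmod (Poly_Mapping.lookup p m) * 1" for m
  proof -
    have "(\<Prod>j\<in>{1..d}. cmod (z j) ^ Poly_Mapping.lookup m j) \<le> (\<Prod>j\<in>{1..d}. 1)"
    proof (rule prod_mono)
      fix j assume "j \<in> {1..d}"
      then have "cmod (z j) < 1" using z by (auto simp: polydisc_def PiE_def Pi_def)
      then show "0 \<le> cmod (z j) ^ Poly_Mapping.lookup m j \<and> cmod (z j) ^ Poly_Mapping.lookup m j \<le> 1"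
        by (simp add: power_le_one)
    qed
    then show ?thesis
      unfolding norm_mult prod_norm[symmetric] norm_power by (intro mult_left_mono) simp_all
  qed
  then show "cmod (mpoly_eval d p z) \<le> (\<Sum>m\<in>Poly_Mapping.keys p. cmod (Poly_Mapping.lookup p m) * 1)"
    unfolding mpoly_eval_def by (rule sum_norm_le)
qed

text \<open>Shrinking \<open>x\<close> by a factor \<open>s < 1\<close> brings it into the open
  polydisc; then \<open>s\<close> tends to 1.\<close>

lemma mpoly_eval_closed_polydisc:
  assumes x: "\<And>j. j \<in> {1..d} \<Longrightarrow> cmod (x j) \<le> 1"
  shows "cmod (mpoly_eval d p x) \<le> (SUP z\<in>polydisc d. cmod (mpoly_eval d p z))"
proof -
  let ?g = "\<lambda>s. cmod (mpoly_eval d p (\<lambda>j. complex_of_real s * x j))"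
  have le: "?g s \<le> (SUP z\<in>polydisc d. cmod (mpoly_eval d p z))" if s: "s \<in> {0<..<1}" for s
  proof -
    \<comment> \<open>\<open>polydisc\<close> contains only functions that are undefined off
      \<open>{1..d}\<close>, hence the restriction; the evaluation reads no other
      coordinates.\<close>
    define y where "y = restrict (\<lambda>j. complex_of_real s * x j) {1..d}"
    have "cmod (complex_of_real s * x j) < 1" if "j \<in> {1..d}" for j
    proof -
      have "cmod (complex_of_real s * x j) \<le> s * 1"
        using x[OF that] s by (simp add: norm_mult)
      then show ?thesis using s by simp
    qed
    then have "y \<in> polydisc d"
      unfolding polydisc_def y_def by (intro restrict_PiE_iff[THEN iffD2]) auto
    moreover have "mpoly_eval d p y = mpoly_eval d p (\<lambda>j. complex_of_real s * x j)"
      unfolding mpoly_eval_def y_def by (intro sum.cong prod.cong refl arg_cong2[where f = "(*)"]) simp_all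
    ultimately show ?thesis
      using cSUP_upper[OF _ bdd_above_mpoly_eval] by metis
  qed
  have "continuous (at_left 1) ?g"
    unfolding mpoly_eval_def by (intro continuous_intros)
  then have "(?g \<longlongrightarrow> ?g 1) (at_left 1)"
    by (simp add: continuous_within)
  then have "?g 1 \<le> (SUP z\<in>polydisc d. cmod (mpoly_eval d p z))"
  proof (rule tendsto_upperbound)
    have "\<forall>\<^sub>F s in at_left (1::real). s \<in> {0<..<1}"
      by (rule eventually_at_left_real) simp
    then show "\<forall>\<^sub>F s in at_left 1. ?g s \<le> (SUP z\<in>polydisc d. cmod (mpoly_eval d p z))"
      by eventually_elim (rule le)
  qed simp
  then show ?thesis by simp
qed

lemma norm_le_realizes_mpoly:
  assumes p: "realizes d q r A (mpoly_eval d p) a b"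
    and q: "\<And>j. j \<in> {1..d} \<Longrightarrow> q j \<in> Han"
    and r: "\<And>j. j \<in> {1..d} \<Longrightarrow> r j \<in> {0..1}"
    and H: "\<And>j. j \<in> {1..d} \<Longrightarrow> norm (hankel (q j)) \<le> 1 - (r j)\<^sup>2"
  shows "norm A \<le> (SUP z\<in>polydisc d. cmod (mpoly_eval d p z))"
proof (rule dense_ge)
  \<comment> \<open>A strict majorant of the supremum gives the strict bound on the closed polydisc
    that the Schwarz-Pick inequality takes, and it makes \<open>M\<close> positive even when the
    supremum is 0.\<close>
  fix M assume M: "(SUP z\<in>polydisc d. cmod (mpoly_eval d p z)) < M"
  have bd: "cmod (mpoly_eval d p x) < M" if "\<And>j. j \<in> {1..d} \<Longrightarrow> cmod (x j) \<le> 1" for x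
    using mpoly_eval_closed_polydisc[of d x p] that M by fastforce
  have "M > 0"
    using bd[of "\<lambda>_. 0"] norm_ge_zero[of "mpoly_eval d p (\<lambda>_. 0)"] by (simp del: norm_ge_zero)
  show "norm A \<le> M"
  proof (rule norm_le_has_symbol[OF realizesD(1)[OF p] \<open>M > 0\<close> q H])
    fix z :: complex assume z: "cmod z = 1"
    \<comment> \<open>For \<open>|z| = 1\<close> the weights \<open>1 - |r j * z|^2\<close> at this
      base point are the bounds \<open>1 - (r j)^2\<close> on the Hankel norms, and \<open>b\<close>
      evaluated at \<open>z\<close> gives the partial derivatives there.\<close>
    let ?w = "\<lambda>j. complex_of_real (r j) * z"
    have "M * (\<Sum>j\<in>{1..d}. (1 - (cmod (?w j))\<^sup>2) * cmod (poly (b j) z)) \<le> M\<^sup>2 - (cmod (mpoly_eval d p ?w))\<^sup>2"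
    proof (rule Schwarz_Pick_polydisc)
      show "cmod (?w j) \<le> 1" if "j \<in> {1..d}" for j
        using r[OF that] z by (simp add: norm_mult)
      show "(\<lambda>t. mpoly_eval d p (\<lambda>j. \<phi> j t)) holomorphic_on ball 0 1"
        if "\<And>j. \<phi> j holomorphic_on ball 0 1" for \<phi>
        unfolding mpoly_eval_def by (intro holomorphic_intros that)
    qed (use bd realizesD(3)[OF p] in auto)
    moreover have "(cmod (?w j))\<^sup>2 = (r j)\<^sup>2" for j
      using z by (simp add: norm_mult)
    ultimately show "M * (\<Sum>j\<in>{1..d}. (1 - (r j)\<^sup>2) * cmod (poly (b j) z)) \<le> M\<^sup>2 - (cmod (poly a z))\<^sup>2"
      by (simp only: realizesD(2)[OF p])
  qed
qed

theorem proposition3p9: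
  fixes d :: nat
    and q :: "nat \<Rightarrow> h2"
    and r :: "nat \<Rightarrow> real"
    and T :: "nat \<Rightarrow> ((h2 \<times> ch2) \<Rightarrow>\<^sub>L (h2 \<times> ch2))"
  assumes "\<And>j. j \<in> {1..d} \<Longrightarrow> q j \<in> Han"
    and "\<And>j. j \<in> {1..d} \<Longrightarrow> r j \<in> {0..1}"
    and "\<And>j. j \<in> {1..d} \<Longrightarrow>
      T j = block_op (r j *\<^sub>R M_zeta) 0 (hankel (q j)) (r j *\<^sub>R hadjoint M_cnj_zeta)"
    and "\<And>j. j \<in> {1..d} \<Longrightarrow> norm (T j) \<le> 1"
  shows "(\<forall>i\<in>{1..d}. \<forall>j\<in>{1..d}. T i o\<^sub>L T j = T j o\<^sub>L T i) \<and>
    (\<forall>p\<in>mpolynomials d. norm (op_mpoly d p T) \<le> (SUP z\<in>polydisc d. cmod (mpoly_eval d p z)))"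
proof (intro conjI ballI)
  fix i j assume ij: "i \<in> {1..d}" "j \<in> {1..d}"
  have "has_symbol d q (T j) [:0, of_real (r j):] (\<lambda>i. if i = j then 1 else 0)" if "j \<in> {1..d}" for j
    unfolding assms(3)[OF that] by (intro has_symbol_block_op assms(1) that)
  \<comment> \<open>Both orders of composition have the same symbol up to commutativity of
    polynomial multiplication and addition, so uniqueness of the operator applies.\<close>
  note sym = has_symbol_compose[OF this this]
  show "T i o\<^sub>L T j = T j o\<^sub>L T i"
    by (rule has_symbol_unique[OF sym[OF ij]]) (use sym[OF ij(2,1)] in \<open>simp only: mult.commute add.commute\<close>)
next
  fix p assume "p \<in> mpolynomials d"
  have "\<exists>a b. realizes d q r (T j) (\<lambda>w. w j) a b" if "j \<in> {1..d}" for j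
    unfolding assms(3)[OF that] using realizes_block_op[of j d q r, OF that assms(1)[OF that]] by blast
  then obtain a b where "realizes d q r (op_mpoly d p T) (mpoly_eval d p) a b"
    using realizes_mpoly by blast
  then show "norm (op_mpoly d p T) \<le> (SUP z\<in>polydisc d. cmod (mpoly_eval d p z))"
  proof (rule norm_le_realizes_mpoly)
    show "norm (hankel (q j)) \<le> 1 - (r j)\<^sup>2" if "j \<in> {1..d}" for j
      using assms(2)[OF that] assms(4)[OF that] unfolding assms(3)[OF that] by (rule norm_hankel_le)
  qed (use assms in auto)
qed

end
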